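(* Let $p$ be a prime. The quasi-ideals $\mathbb{G}_a^\sharp$ and $W^{(F)}$ in the ring scheme $\mathbb{G}_a$ (over $\mathbb{Z}$) are isomorphic as quasi-ideals in $\mathbb{G}_a$, and such an isomorphism is unique.
   Context: All schemes are over $\mathbb{Z}$ and $p$ is a fixed prime. Quasi-ideals: if $C$ is a (commutative) ring scheme over a scheme $S$, a quasi-ideal in $C$ is a pair $(I,d)$, where $I$ is a commutative group $S$-scheme with an action of $C$ and $d:I\to C$ is a $C$-linear morphism such that $d(x)\cdot y=d(y)\cdot x$ for every $S$-scheme $S'$ and all $x,y\in I(S')$. An isomorphism of quasi-ideals $(I_1,d_1)\to(I_2,d_2)$ in $C$ is a $C$-linear isomorphism of group schemes $I_1\to I_2$ commuting with the maps $d_i$ to $C$. $\mathbb{G}_a^\sharp:=\operatorname{Spec}A$, where $A\subset\mathbb{Q}[x]$ is the subring generated by the elements $u_n:=x^{p^n}/p^{\frac{p^n-1}{p-1}}$, $n\ge 0$. There is a unique ring homomorphism $\Delta:A\to A\otimes A$ with $\Delta(x)=x\otimes 1+1\otimes x$; it makes $\mathbb{G}_a^\sharp$ a group scheme over $\mathbb{Z}$. The inclusion $\mathbb{Z}[x]\subset A$ gives a homomorphism $\mathbb{G}_a^\sharp\to\mathbb{G}_a$, which is an isomorphism after $\otimes\mathbb{Q}$. There is a unique action of the ring scheme $\mathbb{G}_a$ on $\mathbb{G}_a^\sharp$ inducing the usual action of $\mathbb{G}_a\otimes\mathbb{Q}$ on $\mathbb{G}_a^\sharp\otimes\mathbb{Q}=\mathbb{G}_a\otimes\mathbb{Q}$;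 with it, $\mathbb{G}_a^\sharp\to\mathbb{G}_a$ is a quasi-ideal in $\mathbb{G}_a$. $W$ is the ring scheme over $\mathbb{Z}$ of $p$-typical Witt vectors, with Frobenius $F$ and Verschiebung $V$, and $W^{(F)}:=\operatorname{Ker}(F:W\to W)$. The action of $W$ on $W^{(F)}$ factors through $W/VW=\mathbb{G}_a$, and the composite $W^{(F)}\hookrightarrow W\twoheadrightarrow W/VW=\mathbb{G}_a$ makes $W^{(F)}$ a quasi-ideal in $\mathbb{G}_a$. *)

theory Defs
  imports
    "HOL-Algebra.Module"
    "HOL-Algebra.Generated_Rings"
    "HOL-Library.Poly_Mapping"
    "HOL-Library.FuncSet"
    "HOL-Computational_Algebra.Polynomial"
    "HOL-Computational_Algebra.Primes"
begin

section \<open>Affine schemes, ring schemes and quasi-ideals\<close>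

text \<open>
  Schemes over the integers are given by their functors of points on commutative rings (with 1,
  the zero ring included). All schemes below are affine, i.e. representable functors. The rings
  are those whose carrier lies in a type \<open>'u\<close>, which plays the role of the universe. The
  coordinate rings used below, and their tensor products, are countable, so they have isomorphic
  copies in any infinite \<open>'u\<close>, and by the Yoneda lemma morphisms of schemes between them are
  the same as natural transformations of functors on these rings.

  A functor is a pair of an object part \<open>X\<close> and an arrow part \<open>m\<close>, where \<open>m R S f\<close> is the
  map induced by \<open>f\<close>. As HOL functions are total, only the values of \<open>f\<close> on \<open>carrier R\<close> may matter.
\<close>

definition set_functor ::
    "('u ring \<Rightarrow> 'x set) \<Rightarrow> ('u ring \<Rightarrow> 'u ring \<Rightarrow> ('u \<Rightarrow> 'u) \<Rightarrow> 'x \<Rightarrow> 'x) \<Rightarrow> bool" where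
  "set_functor X m \<longleftrightarrow>
     (\<forall>R S f x. cring R \<and> cring S \<and> f \<in> ring_hom R S \<and> x \<in> X R \<longrightarrow> m R S f x \<in> X S) \<and>
     (\<forall>R S f g x. cring R \<and> cring S \<and> f \<in> ring_hom R S \<and> g \<in> ring_hom R S \<and> x \<in> X R \<and>
        (\<forall>a\<in>carrier R. f a = g a) \<longrightarrow> m R S f x = m R S g x) \<and>
     (\<forall>R x. cring R \<and> x \<in> X R \<longrightarrow> m R R (\<lambda>a. a) x = x) \<and>
     (\<forall>R S T f g x. cring R \<and> cring S \<and> cring T \<and> f \<in> ring_hom R S \<and> g \<in> ring_hom S T \<and>
        x \<in> X R \<longrightarrow> m R T (g \<circ> f) x = m S T g (m R S f x))"

text \<open>
  The ring homomorphisms with domain exactly \<open>carrier A\<close>; these are the \<open>R\<close>-points of the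
  spectrum of \<open>A\<close>.
\<close>

definition Spec_points :: "('a, 'm) ring_scheme \<Rightarrow> ('b, 'n) ring_scheme \<Rightarrow> ('a \<Rightarrow> 'b) set" where
  "Spec_points A R = ring_hom A R \<inter> extensional (carrier A)"

text \<open>Representability is expressed through the universal point \<open>\<xi>\<close>.\<close>

definition affine_scheme ::
    "('u ring \<Rightarrow> 'x set) \<Rightarrow> ('u ring \<Rightarrow> 'u ring \<Rightarrow> ('u \<Rightarrow> 'u) \<Rightarrow> 'x \<Rightarrow> 'x) \<Rightarrow> bool" where
  "affine_scheme X m \<longleftrightarrow> set_functor X m \<and>
     (\<exists>B \<xi>. cring B \<and> \<xi> \<in> X B \<and>
        (\<forall>R. cring R \<longrightarrow> bij_betw (\<lambda>f. m B R f \<xi>) (Spec_points B R) (X R)))"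

record ('u, 'c) ring_functor =
  rpts :: "'u ring \<Rightarrow> 'c ring"
  rmap :: "'u ring \<Rightarrow> 'u ring \<Rightarrow> ('u \<Rightarrow> 'u) \<Rightarrow> 'c \<Rightarrow> 'c"

definition affine_ring_scheme :: "('u, 'c) ring_functor \<Rightarrow> bool" where
  "affine_ring_scheme C \<longleftrightarrow>
     affine_scheme (\<lambda>R. carrier (rpts C R)) (rmap C) \<and>
     (\<forall>R. cring R \<longrightarrow> cring (rpts C R)) \<and>
     (\<forall>R S f. cring R \<and> cring S \<and> f \<in> ring_hom R S \<longrightarrow>
        rmap C R S f \<in> ring_hom (rpts C R) (rpts C S))"

text \<open>
  \<open>qpts Q R\<close> is the group of \<open>R\<close>-points with the action of the ring of \<open>R\<close>-points of the
  ring scheme as scalar multiplication. The fields \<open>monoid.mult\<close> and \<open>one\<close> that a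
  \<^typ>\<open>('c, 'x) module\<close> record inherits from rings play no role.
\<close>

record ('u, 'c, 'x) quasi_ideal_data =
  qpts :: "'u ring \<Rightarrow> ('c, 'x) module"
  qmap :: "'u ring \<Rightarrow> 'u ring \<Rightarrow> ('u \<Rightarrow> 'u) \<Rightarrow> 'x \<Rightarrow> 'x"
  qd :: "'u ring \<Rightarrow> 'x \<Rightarrow> 'c"

definition quasi_ideal :: "('u, 'c) ring_functor \<Rightarrow> ('u, 'c, 'x) quasi_ideal_data \<Rightarrow> bool" where
  "quasi_ideal C Q \<longleftrightarrow>
     affine_ring_scheme C \<and>
     affine_scheme (\<lambda>R. carrier (qpts Q R)) (qmap Q) \<and>
     (\<forall>R. cring R \<longrightarrow> module (rpts C R) (qpts Q R)) \<and>
     (\<forall>R S f. cring R \<and> cring S \<and> f \<in> ring_hom R S \<longrightarrow>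
        (\<forall>x\<in>carrier (qpts Q R). \<forall>y\<in>carrier (qpts Q R).
           qmap Q R S f (x \<oplus>\<^bsub>qpts Q R\<^esub> y) = qmap Q R S f x \<oplus>\<^bsub>qpts Q S\<^esub> qmap Q R S f y) \<and>
        (\<forall>c\<in>carrier (rpts C R). \<forall>x\<in>carrier (qpts Q R).
           qmap Q R S f (c \<odot>\<^bsub>qpts Q R\<^esub> x) = rmap C R S f c \<odot>\<^bsub>qpts Q S\<^esub> qmap Q R S f x) \<and>
        (\<forall>x\<in>carrier (qpts Q R). qd Q S (qmap Q R S f x) = rmap C R S f (qd Q R x))) \<and>
     (\<forall>R. cring R \<longrightarrow>
        qd Q R \<in> carrier (qpts Q R) \<rightarrow> carrier (rpts C R) \<and>
        (\<forall>x\<in>carrier (qpts Q R). \<forall>y\<in>carrier (qpts Q R).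
           qd Q R (x \<oplus>\<^bsub>qpts Q R\<^esub> y) = qd Q R x \<oplus>\<^bsub>rpts C R\<^esub> qd Q R y) \<and>
        (\<forall>c\<in>carrier (rpts C R). \<forall>x\<in>carrier (qpts Q R).
           qd Q R (c \<odot>\<^bsub>qpts Q R\<^esub> x) = c \<otimes>\<^bsub>rpts C R\<^esub> qd Q R x) \<and>
        (\<forall>x\<in>carrier (qpts Q R). \<forall>y\<in>carrier (qpts Q R).
           qd Q R x \<odot>\<^bsub>qpts Q R\<^esub> y = qd Q R y \<odot>\<^bsub>qpts Q R\<^esub> x))"

text \<open>
  The two extensionality conditions pin down the values of \<open>\<phi>\<close> outside its domain, so that
  equality of HOL functions is equality of natural transformations.
\<close>

definition quasi_ideal_iso ::
    "('u, 'c) ring_functor \<Rightarrow> ('u, 'c, 'x) quasi_ideal_data \<Rightarrow> ('u, 'c, 'y) quasi_ideal_data \<Rightarrow>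
     ('u ring \<Rightarrow> 'x \<Rightarrow> 'y) \<Rightarrow> bool" where
  "quasi_ideal_iso C P Q \<phi> \<longleftrightarrow>
     quasi_ideal C P \<and> quasi_ideal C Q \<and>
     \<phi> \<in> extensional {R. cring R} \<and>
     (\<forall>R. cring R \<longrightarrow>
        \<phi> R \<in> extensional (carrier (qpts P R)) \<and>
        bij_betw (\<phi> R) (carrier (qpts P R)) (carrier (qpts Q R)) \<and>
        (\<forall>x\<in>carrier (qpts P R). \<forall>y\<in>carrier (qpts P R).
           \<phi> R (x \<oplus>\<^bsub>qpts P R\<^esub> y) = \<phi> R x \<oplus>\<^bsub>qpts Q R\<^esub> \<phi> R y) \<and>
        (\<forall>c\<in>carrier (rpts C R). \<forall>x\<in>carrier (qpts P R).
           \<phi> R (c \<odot>\<^bsub>qpts P R\<^esub> x) = c \<odot>\<^bsub>qpts Q R\<^esub> \<phi> R x) \<and>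
        (\<forall>x\<in>carrier (qpts P R). qd Q R (\<phi> R x) = qd P R x)) \<and>
     (\<forall>R S f. cring R \<and> cring S \<and> f \<in> ring_hom R S \<longrightarrow>
        (\<forall>x\<in>carrier (qpts P R). \<phi> S (qmap P R S f x) = qmap Q R S f (\<phi> R x)))"

definition Ga :: "('u, 'u) ring_functor" where
  "Ga = \<lparr> rpts = (\<lambda>R. R), rmap = (\<lambda>R S f. f) \<rparr>"


section \<open>The quasi-ideal \<open>G\<^sub>a\<^sup>\<sharp>\<close>\<close>

definition subset_ring :: "'a::comm_ring_1 set \<Rightarrow> 'a ring" where
  "subset_ring S = \<lparr> carrier = S, monoid.mult = (*), one = 1, zero = 0, add = (+) \<rparr>"

definition subring_gen :: "'a::comm_ring_1 set \<Rightarrow> 'a ring" where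
  "subring_gen H = subset_ring (generate_ring (subset_ring UNIV) H)"

definition u_gen :: "nat \<Rightarrow> nat \<Rightarrow> rat poly" where
  "u_gen p n = Polynomial.monom (1 / of_nat p ^ ((p ^ n - 1) div (p - 1))) (p ^ n)"

definition GA_ring :: "nat \<Rightarrow> rat poly ring" where
  "GA_ring p = subring_gen (range (u_gen p))"

text \<open>
  \<open>\<rat>[x,y]\<close> is \<^typ>\<open>rat poly poly\<close>, with \<open>x\<close> the inner and \<open>y\<close> the outer variable; \<open>in_x f\<close> and
  \<open>in_y f\<close> are \<open>f(x)\<close> and \<open>f(y)\<close>. As \<open>A\<close> is torsion-free, hence flat over the integers,
  \<open>A \<otimes> A\<close> and \<open>A \<otimes> \<int>[t]\<close> embed into \<open>\<rat>[x] \<otimes> \<rat>[y] = \<rat>[x,y]\<close> (with \<open>t\<close> going to \<open>y\<close>),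
  and are identified with their images \<open>A_tensor_A\<close> and \<open>A_tensor_Zt\<close>. Here \<open>A\<close> is \<open>GA_ring p\<close>.
\<close>

definition in_x :: "rat poly \<Rightarrow> rat poly poly" where
  "in_x f = [:f:]"

definition var_y :: "rat poly poly" where
  "var_y = [:0, 1:]"

definition subst_xy :: "rat poly \<Rightarrow> rat poly poly \<Rightarrow> rat poly poly" where
  "subst_xy f g = poly (map_poly (\<lambda>a. [:[:a:]:]) f) g"

definition in_y :: "rat poly \<Rightarrow> rat poly poly" where
  "in_y f = subst_xy f var_y"

definition A_tensor_A :: "nat \<Rightarrow> rat poly poly ring" where
  "A_tensor_A p = subring_gen (in_x ` carrier (GA_ring p) \<union> in_y ` carrier (GA_ring p))"

definition A_tensor_Zt :: "nat \<Rightarrow> rat poly poly ring" where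
  "A_tensor_Zt p = subring_gen (insert var_y (in_x ` carrier (GA_ring p)))"

text \<open>
  The comultiplication \<open>x \<mapsto> x \<otimes> 1 + 1 \<otimes> x\<close>, and the coaction \<open>x \<mapsto> x \<otimes> t\<close> that over \<open>\<rat>\<close> is the
  usual action of the ring scheme on itself.
\<close>

definition comult :: "rat poly \<Rightarrow> rat poly poly" where
  "comult f = subst_xy f (in_x [:0, 1:] + var_y)"

definition coact :: "rat poly \<Rightarrow> rat poly poly" where
  "coact f = subst_xy f (in_x [:0, 1:] * var_y)"

text \<open>
  A pair of points \<open>g, h\<close> of the spectrum of \<open>A\<close> is a homomorphism \<open>k\<close> on \<open>A \<otimes> A\<close>, and a pair
  of such a point \<open>h\<close> and a ring element \<open>c\<close> is a homomorphism \<open>k\<close> on \<open>A \<otimes> \<int>[t]\<close>.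
\<close>

definition Ga_sharp_add ::
    "nat \<Rightarrow> 'u ring \<Rightarrow> (rat poly \<Rightarrow> 'u) \<Rightarrow> (rat poly \<Rightarrow> 'u) \<Rightarrow> rat poly \<Rightarrow> 'u" where
  "Ga_sharp_add p R g h =
     (let k = (THE k. k \<in> Spec_points (A_tensor_A p) R \<and>
                 (\<forall>f\<in>carrier (GA_ring p). k (in_x f) = g f \<and> k (in_y f) = h f))
      in restrict (\<lambda>f. k (comult f)) (carrier (GA_ring p)))"

definition Ga_sharp_act ::
    "nat \<Rightarrow> 'u ring \<Rightarrow> 'u \<Rightarrow> (rat poly \<Rightarrow> 'u) \<Rightarrow> rat poly \<Rightarrow> 'u" where
  "Ga_sharp_act p R c h =
     (let k = (THE k. k \<in> Spec_points (A_tensor_Zt p) R \<and>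
                 (\<forall>f\<in>carrier (GA_ring p). k (in_x f) = h f) \<and> k var_y = c)
      in restrict (\<lambda>f. k (coact f)) (carrier (GA_ring p)))"

text \<open>The counit is \<open>f \<mapsto> f(0)\<close>, which takes integer values on \<open>A\<close>.\<close>

definition Ga_sharp_zero :: "nat \<Rightarrow> 'u ring \<Rightarrow> rat poly \<Rightarrow> 'u" where
  "Ga_sharp_zero p R = restrict (\<lambda>f. [\<lfloor>Polynomial.coeff f 0\<rfloor>] \<cdot>\<^bsub>R\<^esub> \<one>\<^bsub>R\<^esub>) (carrier (GA_ring p))"

definition Ga_sharp :: "nat \<Rightarrow> ('u, 'u, rat poly \<Rightarrow> 'u) quasi_ideal_data" where
  "Ga_sharp p =
     \<lparr> qpts = (\<lambda>R. \<lparr> carrier = Spec_points (GA_ring p) R, monoid.mult = undefined, one = undefined,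
                      zero = Ga_sharp_zero p R, add = Ga_sharp_add p R,
                      module.smult = Ga_sharp_act p R \<rparr>),
       qmap = (\<lambda>R S f h. restrict (f \<circ> h) (carrier (GA_ring p))),
       qd = (\<lambda>R h. h [:0, 1:]) \<rparr>"


section \<open>Witt vectors and the quasi-ideal \<open>W\<^sup>(\<^sup>F\<^sup>)\<close>\<close>

text \<open>Integer polynomials in the variables \<open>'v\<close>; monomials are exponent functions.\<close>

type_synonym 'v zpoly = "('v \<Rightarrow>\<^sub>0 nat) \<Rightarrow>\<^sub>0 int"

definition zvar :: "'v \<Rightarrow> 'v zpoly" where
  "zvar v = Poly_Mapping.single (Poly_Mapping.single v 1) 1"

definition zeval :: "'u ring \<Rightarrow> ('v \<Rightarrow> 'u) \<Rightarrow> 'v zpoly \<Rightarrow> 'u" where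
  "zeval R a P =
     (\<Oplus>\<^bsub>R\<^esub>m\<in>Poly_Mapping.keys P. [Poly_Mapping.lookup P m] \<cdot>\<^bsub>R\<^esub>
        (\<Otimes>\<^bsub>R\<^esub>v\<in>Poly_Mapping.keys m. a v [^]\<^bsub>R\<^esub> Poly_Mapping.lookup m v))"

definition ghost :: "nat \<Rightarrow> nat \<Rightarrow> (nat \<Rightarrow> 'a::comm_ring_1) \<Rightarrow> 'a" where
  "ghost p n X = (\<Sum>i\<le>n. of_nat p ^ i * X i ^ (p ^ (n - i)))"

text \<open>The variables \<open>Inl i\<close> and \<open>Inr i\<close> are the components of two generic Witt vectors.\<close>

definition witt_add_poly :: "nat \<Rightarrow> nat \<Rightarrow> (nat + nat) zpoly" where
  "witt_add_poly p = (THE s. \<forall>n. ghost p n s =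
     ghost p n (\<lambda>i. zvar (Inl i)) + ghost p n (\<lambda>i. zvar (Inr i)))"

definition witt_mult_poly :: "nat \<Rightarrow> nat \<Rightarrow> (nat + nat) zpoly" where
  "witt_mult_poly p = (THE s. \<forall>n. ghost p n s =
     ghost p n (\<lambda>i. zvar (Inl i)) * ghost p n (\<lambda>i. zvar (Inr i)))"

definition witt_frob_poly :: "nat \<Rightarrow> nat \<Rightarrow> nat zpoly" where
  "witt_frob_poly p = (THE s. \<forall>n. ghost p n s = ghost p (Suc n) zvar)"

definition witt_ring :: "nat \<Rightarrow> 'u ring \<Rightarrow> (nat \<Rightarrow> 'u) ring" where
  "witt_ring p R =
     \<lparr> carrier = {w. \<forall>n. w n \<in> carrier R},
       monoid.mult = (\<lambda>v w n. zeval R (case_sum v w) (witt_mult_poly p n)),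
       one = (\<lambda>n. if n = 0 then \<one>\<^bsub>R\<^esub> else \<zero>\<^bsub>R\<^esub>),
       zero = (\<lambda>n. \<zero>\<^bsub>R\<^esub>),
       add = (\<lambda>v w n. zeval R (case_sum v w) (witt_add_poly p n)) \<rparr>"

definition witt_frob :: "nat \<Rightarrow> 'u ring \<Rightarrow> (nat \<Rightarrow> 'u) \<Rightarrow> nat \<Rightarrow> 'u" where
  "witt_frob p R w = (\<lambda>n. zeval R w (witt_frob_poly p n))"

text \<open>
  The projection of Witt vectors onto their quotient by the image of Verschiebung is \<open>w \<mapsto> w 0\<close>.
  The action of \<open>c\<close> is multiplication by any lift \<open>a\<close> of \<open>c\<close> along it, the product being
  independent of the lift.
\<close>

definition WF :: "nat \<Rightarrow> ('u, 'u, nat \<Rightarrow> 'u) quasi_ideal_data" where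
  "WF p =
     \<lparr> qpts = (\<lambda>R. \<lparr> carrier = {w \<in> carrier (witt_ring p R). witt_frob p R w = \<zero>\<^bsub>witt_ring p R\<^esub>},
                      monoid.mult = undefined, one = undefined,
                      zero = \<zero>\<^bsub>witt_ring p R\<^esub>, add = add (witt_ring p R),
                      module.smult = (\<lambda>c w. THE v. \<forall>a\<in>carrier (witt_ring p R).
                                 a 0 = c \<longrightarrow> v = a \<otimes>\<^bsub>witt_ring p R\<^esub> w) \<rparr>),
       qmap = (\<lambda>R S f w. f \<circ> w),
       qd = (\<lambda>R w. w 0) \<rparr>"

end

theory Submission
  imports Defs "HOL-Library.Countable"
begin

text \<open>
  Over \<open>\<rat>[x]\<close> there is a unique Witt vector with ghost components \<open>(x, 0, 0, \<dots>)\<close>. It is killed by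
  the Frobenius, and its \<open>n\<close>-th component is \<open>b\<^sub>n u\<^sub>n\<close> for an integer \<open>b\<^sub>n\<close> prime to \<open>p\<close>; as
  \<open>u\<^sub>n\<^sup>p = p u\<^sub>n\<^sub>+\<^sub>1\<close>, these components generate \<open>A\<close> as a ring. Evaluating them at a point of the
  spectrum of \<open>A\<close> gives the isomorphism: it respects sum and action because all identities
  can be checked on ghost components in the torsion-free ring \<open>\<rat>[x, y]\<close>, and it is bijective because on
  both sides \<open>w\<^sub>0, \<dots>, w\<^sub>n\<close> and \<open>w\<^sub>n\<^sub>+\<^sub>1\<close> are tied by \<open>p w\<^sub>n\<^sub>+\<^sub>1 = b\<^sub>n\<^sub>+\<^sub>1 u\<^sub>n\<^sup>p\<close>,
  where \<open>w\<^sub>i = b\<^sub>i u\<^sub>i\<close> for \<open>i \<le> n\<close>. The group and module axioms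
  for \<open>G\<^sub>a\<^sup>\<sharp>\<close> are transported from Witt vectors. For uniqueness, a morphism is determined by
  the image of the universal point, a Witt vector over \<open>A\<close> that is killed by the Frobenius; its ghost components
  are determined by its zeroth component, and \<open>A\<close> is torsion-free.
\<close>

section \<open>Evaluation of integer polynomials\<close>

text \<open>The constants \<open>b_n\<close> are prime to \<open>p\<close> because the vanishing of
  the \<open>n\<close>-th ghost component, freed of a common power of \<open>p\<close>, reads
  \<open>b_n = - b_(n-1)^p\<close> modulo \<open>p\<close>. Hence Bezout recovers \<open>u_n\<close>
  from \<open>b_n u_n\<close> and \<open>p u_n\<close>, which is how a point of \<open>A\<close> is
  rebuilt from a Witt vector. Two obstacles shape the proof. First, \<open>A\<close> is given by
  generators inside \<open>Q[x]\<close>, whereas its points are needed as sequences with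
  \<open>a_n^p = p a_(n+1)\<close>. To get a homomorphism from such a sequence, polynomials are
  expanded in the monomials \<open>x^m / p^v(m)\<close>, where \<open>v(m)\<close> is the exponent
  of \<open>p\<close> in \<open>m!\<close>; the image of each is a product of powers of the
  \<open>a_i\<close> given by the base \<open>p\<close> digits of \<open>m\<close>. The same
  construction with \<open>A\<close> as coefficients replaces the universal property of the tensor
  products. Second, \<open>R\<close> may have \<open>p\<close>-torsion, so the relation between
  \<open>w_(n+1)\<close> and \<open>u_n^p\<close> cannot be read off from ghost components in
  \<open>R\<close>. It is proved over a torsion-free ring mapping to \<open>R\<close>, built from
  the part of the point already constructed. This is why homomorphisms are also needed on rings with
  only finitely many of the \<open>u_n\<close>.\<close>

definition is_subring :: "'a::comm_ring_1 set \<Rightarrow> bool" where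
  "is_subring S \<longleftrightarrow> 1 \<in> S \<and> (\<forall>x\<in>S. \<forall>y\<in>S. x - y \<in> S \<and> x * y \<in> S)"

lemma is_subringD:
  assumes "is_subring S"
  shows "1 \<in> S" "0 \<in> S" "\<And>x. x \<in> S \<Longrightarrow> - x \<in> S"
    "\<And>x y. x \<in> S \<Longrightarrow> y \<in> S \<Longrightarrow> x - y \<in> S"
    "\<And>x y. x \<in> S \<Longrightarrow> y \<in> S \<Longrightarrow> x + y \<in> S"
    "\<And>x y. x \<in> S \<Longrightarrow> y \<in> S \<Longrightarrow> x * y \<in> S"
    "\<And>x n. x \<in> S \<Longrightarrow> x ^ n \<in> S"
proof -
  show one: "1 \<in> S" and diff: "\<And>x y. x \<in> S \<Longrightarrow> y \<in> S \<Longrightarrow> x - y \<in> S"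
    and mult: "\<And>x y. x \<in> S \<Longrightarrow> y \<in> S \<Longrightarrow> x * y \<in> S"
    using assms by (auto simp: is_subring_def)
  show zero: "0 \<in> S" using diff[OF one one] by simp
  show uminus: "\<And>x. x \<in> S \<Longrightarrow> - x \<in> S" using diff[OF zero] by simp
  show "\<And>x y. x \<in> S \<Longrightarrow> y \<in> S \<Longrightarrow> x + y \<in> S"
    using diff uminus by (metis diff_minus_eq_add)
  show "x ^ n \<in> S" if "x \<in> S" for x n
    using that by (induction n) (auto simp: one mult)
qed

lemma is_subring_UNIV [simp]: "is_subring UNIV"
  by (simp add: is_subring_def)

lemma is_subring_of_int:
  assumes "is_subring S"
  shows "of_int k \<in> S"
proof -
  have "of_nat n \<in> S" for n
    by (induction n) (auto simp: is_subringD[OF assms])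
  then show ?thesis
    by (cases k rule: int_cases2) (auto simp: is_subringD[OF assms])
qed

lemma is_subring_sum:
  assumes "is_subring S" "\<And>i. i \<in> I \<Longrightarrow> f i \<in> S"
  shows "sum f I \<in> S"
  using assms(2) by (induction I rule: infinite_finite_induct) (auto simp: is_subringD[OF assms(1)])

lemma subset_ring_simps [simp]:
  "carrier (subset_ring S) = S" "\<one>\<^bsub>subset_ring S\<^esub> = 1" "\<zero>\<^bsub>subset_ring S\<^esub> = 0"
  "x \<otimes>\<^bsub>subset_ring S\<^esub> y = x * y" "x \<oplus>\<^bsub>subset_ring S\<^esub> y = x + y"
  by (simp_all add: subset_ring_def)

lemma cring_subset_ring:
  assumes "is_subring S"
  shows "cring (subset_ring S)"
proof (rule cringI)
  show "abelian_group (subset_ring S)"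
  proof (rule abelian_groupI)
    fix x assume x: "x \<in> carrier (subset_ring S)"
    show "\<exists>y\<in>carrier (subset_ring S). y \<oplus>\<^bsub>subset_ring S\<^esub> x = \<zero>\<^bsub>subset_ring S\<^esub>"
      using x by (intro bexI[of _ "- x"]) (auto simp: is_subringD[OF assms])
  qed (auto simp: is_subringD[OF assms])
  show "Group.comm_monoid (subset_ring S)"
    by (rule comm_monoidI) (auto simp: is_subringD[OF assms])
qed (auto simp: algebra_simps)

lemma a_inv_subset_ring [simp]:
  assumes "is_subring S" "x \<in> S"
  shows "\<ominus>\<^bsub>subset_ring S\<^esub> x = - x"
proof -
  interpret cring "subset_ring S" by (rule cring_subset_ring[OF assms(1)])
  show ?thesis
    by (rule minus_equality) (use assms in \<open>auto simp: is_subringD[OF assms(1)]\<close>)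
qed

text \<open>An integer polynomial is an element of the free abelian group on its monomials, so the
  induction principle of that group applies.\<close>

lemma zpoly_induct [case_names zero monom diff]:
  fixes P :: "'v zpoly \<Rightarrow> bool"
  assumes "P 0" "\<And>m. P (Poly_Mapping.single m 1)" "\<And>Q R. P Q \<Longrightarrow> P R \<Longrightarrow> P (Q - R)"
  shows "P Q"
  by (rule frag_induction[OF subset_UNIV]) (use assms in auto)

text \<open>The record type is fixed to \<open>'u ring\<close> because \<open>zeval\<close> takes
  its ring at exactly this type, without extension fields.\<close>

locale base_cring = cring R for R :: "'u ring" (structure)
begin

lemma add_pow_int_hom:
  "(\<lambda>k::int. [k] \<cdot> \<one>) \<in> ring_hom (subset_ring UNIV) R"
proof (rule ring_hom_memI)
  fix k l :: int
  show "[(k \<otimes>\<^bsub>subset_ring UNIV\<^esub> l)] \<cdot> \<one> = ([k] \<cdot> \<one>) \<otimes> ([l] \<cdot> \<one>)"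
    by (simp add: add_pow_ldistr_int add.int_pow_pow mult.commute)
  show "[(k \<oplus>\<^bsub>subset_ring UNIV\<^esub> l)] \<cdot> \<one> = ([k] \<cdot> \<one>) \<oplus> ([l] \<cdot> \<one>)"
    by (simp add: add.int_pow_mult)
qed auto

definition monom_eval :: "('v \<Rightarrow> 'u) \<Rightarrow> ('v \<Rightarrow>\<^sub>0 nat) \<Rightarrow> 'u" where
  "monom_eval a m = (\<Otimes>v\<in>Poly_Mapping.keys m. a v [^] Poly_Mapping.lookup m v)"

text \<open>The index set may grow so that two monomials can be multiplied over the union of their
  supports; \<open>zeval_superset\<close> does the same for sums.\<close>

lemma monom_eval_superset:
  assumes a: "\<And>v. a v \<in> carrier R" and "finite S" "Poly_Mapping.keys m \<subseteq> S"
  shows "monom_eval a m = (\<Otimes>v\<in>S. a v [^] Poly_Mapping.lookup m v)"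
  unfolding monom_eval_def
  by (rule finprod_mono_neutral_cong_left)
     (use assms in \<open>auto simp: not_in_keys_iff_lookup_eq_zero\<close>)

lemma monom_eval_closed [simp, intro]:
  assumes a: "\<And>v. a v \<in> carrier R"
  shows "monom_eval a m \<in> carrier R"
  using a unfolding monom_eval_def by (auto intro!: finprod_closed)

lemma monom_eval_add:
  assumes a: "\<And>v. a v \<in> carrier R"
  shows "monom_eval a (m + m') = monom_eval a m \<otimes> monom_eval a m'"
proof -
  let ?S = "Poly_Mapping.keys m \<union> Poly_Mapping.keys m'"
  have "monom_eval a (m + m') = (\<Otimes>v\<in>?S. a v [^] Poly_Mapping.lookup m v \<otimes> a v [^] Poly_Mapping.lookup m' v)"
    using a by (subst monom_eval_superset[of a ?S])
      (auto simp: lookup_add nat_pow_mult Poly_Mapping.keys_add intro!: finprod_cong)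
  also have "\<dots> = monom_eval a m \<otimes> monom_eval a m'"
    using a by (subst finprod_multf)
      (auto simp: monom_eval_superset[of a ?S m] monom_eval_superset[of a ?S m'])
  finally show ?thesis .
qed

lemma monom_eval_0: "monom_eval a 0 = \<one>"
  by (simp add: monom_eval_def)

lemma int_zero_pow: "[(0::int)] \<cdot> x = \<zero>"
  by (simp add: add_pow_def)

lemma zeval_superset:
  assumes a: "\<And>v. a v \<in> carrier R" and "finite S" "Poly_Mapping.keys P \<subseteq> S"
  shows "zeval R a P = (\<Oplus>m\<in>S. ([Poly_Mapping.lookup P m] \<cdot> monom_eval a m))"
  unfolding zeval_def monom_eval_def[symmetric]
  by (rule add.finprod_mono_neutral_cong_left)
     (use assms in \<open>auto simp: not_in_keys_iff_lookup_eq_zero int_zero_pow\<close>)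

lemma zeval_closed [simp, intro]:
  assumes a: "\<And>v. a v \<in> carrier R"
  shows "zeval R a P \<in> carrier R"
  using a unfolding zeval_def monom_eval_def[symmetric] by (auto intro!: finsum_closed)

lemma zeval_add:
  assumes a: "\<And>v. a v \<in> carrier R"
  shows "zeval R a (P + Q) = zeval R a P \<oplus> zeval R a Q"
proof -
  let ?S = "Poly_Mapping.keys P \<union> Poly_Mapping.keys Q"
  have "zeval R a (P + Q) = (\<Oplus>m\<in>?S. ([Poly_Mapping.lookup P m] \<cdot> monom_eval a m)
      \<oplus> ([Poly_Mapping.lookup Q m] \<cdot> monom_eval a m))"
    using a by (subst zeval_superset[of a ?S])
      (auto simp: lookup_add add.int_pow_mult Poly_Mapping.keys_add intro!: finsum_cong')
  also have "\<dots> = zeval R a P \<oplus> zeval R a Q"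
    using a by (subst finsum_addf)
      (auto simp: zeval_superset[of a ?S P] zeval_superset[of a ?S Q])
  finally show ?thesis .
qed

lemma zeval_0: "zeval R a 0 = \<zero>"
  by (simp add: zeval_def)

lemma zeval_uminus:
  assumes a: "\<And>v. a v \<in> carrier R"
  shows "zeval R a (- P) = \<ominus> zeval R a P"
  using zeval_add[of a "- P" P, OF a] a by (simp add: zeval_0 minus_equality)

lemma zeval_diff:
  assumes a: "\<And>v. a v \<in> carrier R"
  shows "zeval R a (P - Q) = zeval R a P \<ominus> zeval R a Q"
  using zeval_add[of a P "- Q"] zeval_uminus[of a Q] a by (simp add: a_minus_def)

lemma zeval_frag_of:
  assumes a: "\<And>v. a v \<in> carrier R"
  shows "zeval R a (frag_of m) = monom_eval a m"
  using a by (simp add: zeval_def monom_eval_def[symmetric] keys_frag_of)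

lemma zeval_mult:
  assumes a: "\<And>v. a v \<in> carrier R"
  shows "zeval R a (P * Q) = zeval R a P \<otimes> zeval R a Q"
proof -
  have 1: "zeval R a (frag_of m * Q) = monom_eval a m \<otimes> zeval R a Q" for m Q
  proof (induction Q rule: zpoly_induct)
    case (monom m')
    then show ?case
      using a by (simp add: zeval_frag_of mult_single monom_eval_add)
  next
    case (diff P Q)
    then show ?case
      using a by (simp add: right_diff_distrib zeval_diff) (simp add: a_minus_def r_distr r_minus)
  qed (use a in \<open>auto simp: zeval_0\<close>)
  show ?thesis
  proof (induction P rule: zpoly_induct)
    case (monom m)
    then show ?case using a by (simp add: 1 zeval_frag_of)
  next
    case (diff P Q)
    then show ?case
      using a by (simp add: left_diff_distrib zeval_diff) (simp add: a_minus_def l_distr l_minus)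
  qed (use a in \<open>auto simp: zeval_0\<close>)
qed

lemma zeval_one:
  assumes a: "\<And>v. a v \<in> carrier R"
  shows "zeval R a 1 = \<one>"
  using zeval_frag_of[of a 0, OF a] by (simp add: monom_eval_0)

lemma zeval_hom:
  assumes a: "\<And>v. a v \<in> carrier R"
  shows "zeval R a \<in> ring_hom (subset_ring UNIV) R"
  by (rule ring_hom_memI) (use a in \<open>auto simp: zeval_add zeval_mult zeval_one\<close>)

lemma zeval_zvar:
  assumes a: "\<And>v. a v \<in> carrier R"
  shows "zeval R a (zvar v) = a v"
  using zeval_frag_of[of a "Poly_Mapping.single v 1", OF a] a
  by (simp add: zvar_def monom_eval_def)

end

text \<open>The source of the functoriality of Witt vectors, and of the transfer of identities from
  torsion-free rings to \<open>R\<close>.\<close>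

lemma ring_hom_zeval:
  assumes "cring R" "cring S" and f: "f \<in> ring_hom R S" and a: "\<And>v. a v \<in> carrier R"
  shows "f (zeval R a P) = zeval S (f \<circ> a) P"
proof -
  interpret R: base_cring R by (rule base_cring.intro) fact
  interpret S: base_cring S by (rule base_cring.intro) fact
  interpret f: ring_hom_cring R S f
    by (intro ring_hom_cringI f assms)
  have fa: "(f \<circ> a) v \<in> carrier S" for v using a by auto
  have m: "f (R.monom_eval a m) = S.monom_eval (f \<circ> a) m" for m
    unfolding R.monom_eval_def S.monom_eval_def
    using a by (subst f.hom_finprod) (auto intro!: S.finprod_cong simp: f.ring.hom_nat_pow)
  have neg: "f (\<ominus>\<^bsub>R\<^esub> x) = \<ominus>\<^bsub>S\<^esub> f x" if "x \<in> carrier R" for x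
    using that by simp
  show ?thesis
  proof (induction P rule: zpoly_induct)
    case (monom m)
    then show ?case using R.zeval_frag_of[of a m, OF a] S.zeval_frag_of[of "f \<circ> a" m, OF fa] by (simp add: m comp_def)
  next
    case (diff P Q)
    then show ?case
      using R.zeval_diff[of a P Q, OF a] S.zeval_diff[of "f \<circ> a" P Q, OF fa] a by (simp add: a_minus_def comp_def)
  qed (auto simp: R.zeval_0 S.zeval_0)
qed

text \<open>Evaluation in a type-class ring, where ordinary algebra is available;
  \<open>zeval_subset_ring\<close> and \<open>ring_hom_tev\<close> lead back to rings given as
  records.\<close>

definition tev :: "('v \<Rightarrow> 'a::comm_ring_1) \<Rightarrow> 'v zpoly \<Rightarrow> 'a" where
  "tev = zeval (subset_ring UNIV)"

lemma base_cring_subset_ring: "is_subring S \<Longrightarrow> base_cring (subset_ring S)"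
  by (simp add: base_cring_def cring_subset_ring)

lemma tev_simps [simp]:
  "tev a (P + Q) = tev a P + tev a Q" "tev a (P - Q) = tev a P - tev a Q"
  "tev a (P * Q) = tev a P * tev a Q" "tev a (- P) = - tev a P"
  "tev a 0 = 0" "tev a 1 = 1" "tev a (zvar v) = a v"
proof -
  interpret base_cring "subset_ring UNIV :: 'a ring" by (simp add: base_cring_subset_ring)
  show add: "tev a (P + Q) = tev a P + tev a Q" for P Q
    unfolding tev_def by (subst zeval_add) auto
  show mult: "tev a (P * Q) = tev a P * tev a Q"
    unfolding tev_def by (subst zeval_mult) auto
  show zero: "tev a 0 = 0" and "tev a 1 = 1" "tev a (zvar v) = a v"
    unfolding tev_def by (simp_all add: zeval_0 zeval_one zeval_zvar)
  show uminus: "tev a (- P) = - tev a P" for P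
    using add[of P "- P"] zero by (simp add: add_eq_0_iff)
  show "tev a (P - Q) = tev a P - tev a Q"
    using add[of P "- Q"] uminus by simp
qed

lemma tev_power [simp]: "tev a (P ^ n) = tev a P ^ n"
  by (induction n) auto

lemma tev_of_nat [simp]: "tev a (of_nat n) = of_nat n"
  by (induction n) auto

lemma tev_sum [simp]: "tev a (sum f I) = (\<Sum>i\<in>I. tev a (f i))"
  by (induction I rule: infinite_finite_induct) auto

lemma zeval_subset_ring:
  assumes "is_subring S" "\<And>v. a v \<in> S"
  shows "zeval (subset_ring S) a P = tev a P"
proof -
  have "(\<lambda>x. x) \<in> ring_hom (subset_ring S) (subset_ring UNIV)"
    by (rule ring_hom_memI) auto
  from ring_hom_zeval[OF cring_subset_ring[OF assms(1)] cring_subset_ring[OF is_subring_UNIV] this, of a P] assms(2)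
  show ?thesis by (simp add: tev_def comp_def)
qed

lemma tev_closed:
  assumes "is_subring S" "\<And>v. a v \<in> S"
  shows "tev a P \<in> S"
proof -
  interpret base_cring "subset_ring S" by (rule base_cring_subset_ring[OF assms(1)])
  show ?thesis using zeval_closed[of a P] assms zeval_subset_ring[of S a P] by simp
qed

lemma ring_hom_tev:
  assumes "is_subring S" "cring R" "f \<in> ring_hom (subset_ring S) R" "\<And>v. a v \<in> S"
  shows "f (tev a P) = zeval R (f \<circ> a) P"
  using ring_hom_zeval[OF cring_subset_ring[OF assms(1)] assms(2,3), of a P] assms(4)
    zeval_subset_ring[OF assms(1), of a P] by simp

lemma poly_mapping_eq_sum_single:
  "(\<Sum>v\<in>Poly_Mapping.keys m. Poly_Mapping.single v (Poly_Mapping.lookup m v)) = m"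
  by (rule poly_mapping_eqI)
     (auto simp: lookup_sum lookup_single when_def not_in_keys_iff_lookup_eq_zero)

lemma single_eq_prod_zvar:
  "Poly_Mapping.single m 1 = (\<Prod>v\<in>Poly_Mapping.keys m. zvar v ^ Poly_Mapping.lookup m v)"
proof -
  have pow: "(zvar v :: 'v zpoly) ^ n = Poly_Mapping.single (Poly_Mapping.single v n) 1" for v :: 'v and n
    by (induction n) (simp_all add: zvar_def mult_single flip: single_add)
  have "(\<Prod>v\<in>S. zvar v ^ f v) = Poly_Mapping.single (\<Sum>v\<in>S. Poly_Mapping.single v (f v)) 1" 
    if "finite S" for S :: "'v set" and f
    using that by (induction S) (auto simp: pow mult_single)
  from this[of "Poly_Mapping.keys m" "Poly_Mapping.lookup m"] show ?thesis
    by (simp add: poly_mapping_eq_sum_single)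
qed

text \<open>For statements stable under products and differences, such as the Frobenius congruence
  below, it is enough to treat the variables.\<close>

lemma zpoly_ring_induct [case_names zero one zvar mult diff]:
  fixes P :: "'v zpoly \<Rightarrow> bool"
  assumes "P 0" "P 1" "\<And>v. P (zvar v)" "\<And>Q R. P Q \<Longrightarrow> P R \<Longrightarrow> P (Q * R)"
    "\<And>Q R. P Q \<Longrightarrow> P R \<Longrightarrow> P (Q - R)"
  shows "P Q"
proof (induction Q rule: zpoly_induct)
  case (monom m)
  have pow: "P (zvar v ^ n)" for v n
    by (induction n) (auto intro: assms)
  have "P (\<Prod>v\<in>S. zvar v ^ f v)" if "finite S" for S f
    using that by (induction S) (auto intro: assms pow)
  then show ?case by (simp add: single_eq_prod_zvar)
qed (use assms in auto)

text \<open>Over such a ring a sequence is determined by its ghost components. As a type class, the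
  property passes automatically to \<open>rat poly poly\<close> and to integer polynomials.\<close>

class torsion_free_ring = comm_ring_1 +
  assumes torsion_free: "of_nat n * x = 0 \<Longrightarrow> n = 0 \<or> x = 0"

instance int :: torsion_free_ring
  by standard auto

instance rat :: torsion_free_ring
  by standard auto

instance poly :: (torsion_free_ring) torsion_free_ring
proof
  fix n and x :: "'a poly"
  assume "of_nat n * x = 0"
  then have "of_nat n * Polynomial.coeff x i = 0" for i
    by (metis coeff_0 coeff_smult of_nat_poly mult_pCons_left mult_zero_left pCons_0_0 add_0_right)
  then show "n = 0 \<or> x = 0"
    using torsion_free by (metis poly_eqI coeff_0)
qed

instance poly_mapping :: (comm_monoid_add, torsion_free_ring) torsion_free_ring
proof
  fix n and x :: "'a \<Rightarrow>\<^sub>0 'b"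
  assume *: "of_nat n * x = 0"
  have "Poly_Mapping.lookup (of_nat n * x) i = of_nat n * Poly_Mapping.lookup x i" for i
    by (induction n) (simp_all add: lookup_add distrib_right)
  with * have "of_nat n * Poly_Mapping.lookup x i = 0" for i by simp
  then show "n = 0 \<or> x = 0"
    using torsion_free by (metis poly_mapping_eqI lookup_zero)
qed

section \<open>Congruences modulo powers of \<open>p\<close>\<close>

lemma prime_dvd_freshman:
  fixes a b :: "'a::comm_ring_1"
  assumes "prime p"
  shows "of_nat p dvd (a + b) ^ p - a ^ p - b ^ p"
proof -
  have p: "p > 0" using assms prime_gt_0_nat by blast
  have "{..p} = insert 0 (insert p {0<..<p})" using p by auto
  then have "(a + b) ^ p - a ^ p - b ^ p = (\<Sum>k\<in>{0<..<p}. of_nat (p choose k) * a ^ k * b ^ (p - k))"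
    using p by (simp add: binomial_ring)
  also have "of_nat p dvd \<dots>"
  proof (rule dvd_sum)
    fix k assume "k \<in> {0<..<p}"
    then have "p dvd (p choose k)" by (intro dvd_choose_prime assms) auto
    then have "(of_nat p :: 'a) dvd of_nat (p choose k)" by (metis dvd_def of_nat_mult)
    then show "(of_nat p :: 'a) dvd of_nat (p choose k) * a ^ k * b ^ (p - k)"
      by (simp add: dvd_mult2)
  qed
  finally show ?thesis .
qed

text \<open>When \<open>a - b\<close> is split off from \<open>a ^ p - b ^ p\<close>, the cofactor
  is a sum of \<open>p\<close> terms, each congruent to \<open>b ^ (p - 1)\<close> modulo
  \<open>p\<close>; it contributes one further factor \<open>p\<close>.\<close>

lemma dvd_power_diff_step:
  fixes a b :: "'a::comm_ring_1"
  assumes "of_nat p ^ Suc j dvd a - b"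
  shows "of_nat p ^ Suc (Suc j) dvd a ^ p - b ^ p"
proof (cases p)
  case (Suc q)
  have mod: "of_nat p dvd a ^ i - b ^ i" for i
  proof (cases i)
    case (Suc i')
    have "of_nat p dvd a - b" using assms by (metis dvd_mult_left power_Suc)
    then show ?thesis unfolding Suc diff_power_eq_sum by (rule dvd_mult2)
  qed auto
  have "of_nat p dvd (\<Sum>i<Suc q. a ^ i * b ^ (q - i))"
  proof -
    have "of_nat p dvd (\<Sum>i<Suc q. (a ^ i - b ^ i) * b ^ (q - i))"
      by (intro dvd_sum dvd_mult2 mod)
    moreover have "(\<Sum>i<Suc q. b ^ i * b ^ (q - i)) = (\<Sum>i<Suc q. b ^ q)"
      by (intro sum.cong) (auto simp flip: power_add)
    ultimately have "of_nat p dvd (\<Sum>i<Suc q. (a ^ i - b ^ i) * b ^ (q - i)) + of_nat (Suc q) * b ^ q"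
      using Suc by (simp add: dvd_add)
    also have "\<dots> = (\<Sum>i<Suc q. a ^ i * b ^ (q - i))"
      using \<open>(\<Sum>i<Suc q. b ^ i * b ^ (q - i)) = (\<Sum>i<Suc q. b ^ q)\<close>
      by (simp add: left_diff_distrib sum_subtractf)
    finally show ?thesis .
  qed
  then have "of_nat p ^ Suc j * of_nat p dvd (a - b) * (\<Sum>i<Suc q. a ^ i * b ^ (q - i))"
    by (intro mult_dvd_mono assms)
  then have "of_nat p ^ Suc j * of_nat p dvd a ^ p - b ^ p"
    unfolding Suc diff_power_eq_sum .
  then show ?thesis by (simp add: mult_ac)
qed (use assms in auto)

lemma dvd_power_prime_power_diff:
  fixes a b :: "'a::comm_ring_1"
  assumes "of_nat p dvd a - b"
  shows "of_nat p ^ Suc k dvd a ^ (p ^ k) - b ^ (p ^ k)"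
proof (induction k)
  case (Suc k)
  have "of_nat p ^ Suc (Suc k) dvd (a ^ (p ^ k)) ^ p - (b ^ (p ^ k)) ^ p"
    by (rule dvd_power_diff_step) (rule Suc)
  then show ?case by (simp add: mult.commute flip: power_mult)
qed (use assms in simp)

text \<open>On variables the two sides are equal, and products preserve the congruence; differences
  need the binomial congruence.\<close>

lemma dvd_frobenius_lift:
  assumes "prime p"
  shows "of_nat p dvd tev (\<lambda>v. zvar v ^ p) P - (P :: 'v zpoly) ^ p"
proof (induction P rule: zpoly_ring_induct)
  case zero
  then show ?case using prime_gt_0_nat[OF assms] by (simp add: power_0_left)
next
  case (mult Q R)
  let ?\<phi> = "tev (\<lambda>v. zvar v ^ p) :: 'v zpoly \<Rightarrow> 'v zpoly"
  have "of_nat p dvd (?\<phi> Q - Q ^ p) * ?\<phi> R + Q ^ p * (?\<phi> R - R ^ p)"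
    by (intro dvd_add dvd_mult dvd_mult2 mult)
  also have "\<dots> = ?\<phi> (Q * R) - (Q * R) ^ p"
    by (simp add: algebra_simps power_mult_distrib)
  finally show ?case .
next
  case (diff Q R)
  let ?\<phi> = "tev (\<lambda>v. zvar v ^ p) :: 'v zpoly \<Rightarrow> 'v zpoly"
  \<comment> \<open>The binomial congruence is applied to \<open>Q = (Q - R) + R\<close>, which
    avoids the sign of \<open>(- R) ^ p\<close> and with it a special case for
    \<open>p = 2\<close>.\<close>
  have "of_nat p dvd (?\<phi> Q - Q ^ p) - (?\<phi> R - R ^ p) + ((Q - R + R) ^ p - (Q - R) ^ p - R ^ p)"
    by (intro dvd_add dvd_diff diff prime_dvd_freshman assms)
  then show ?case by (simp add: algebra_simps)
qed auto

section \<open>Ghost components\<close>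

lemma ghost_tev: "tev a (ghost p n X) = ghost p n (\<lambda>i. tev a (X i))"
  by (simp add: ghost_def)

text \<open>Separates the newest component: modulo \<open>p ^ Suc n\<close>, this ghost component
  depends only on the \<open>p\<close>-th powers of the earlier components.\<close>

lemma ghost_Suc: "ghost p (Suc n) X = ghost p n (\<lambda>i. X i ^ p) + of_nat p ^ Suc n * X (Suc n)"
  by (simp add: ghost_def Suc_diff_le flip: power_mult)

lemma ghost_0 [simp]: "ghost p 0 X = X 0"
  by (simp add: ghost_def)

text \<open>By induction only the last summand \<open>p ^ n * X n\<close> could differ, and
  \<open>p ^ n\<close> is not a zero divisor. Only the ghost components up to \<open>n\<close> are
  compared, so that truncated vectors can be treated too.\<close>

lemma ghost_eqD:
  fixes X Y :: "nat \<Rightarrow> 'a::torsion_free_ring"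
  assumes "p > 0" "\<And>i. i \<le> n \<Longrightarrow> ghost p i X = ghost p i Y"
  shows "X n = Y n"
  using assms(2)
proof (induction n rule: less_induct)
  case (less n)
  have "(\<Sum>i<n. of_nat p ^ i * X i ^ (p ^ (n - i))) = (\<Sum>i<n. of_nat p ^ i * Y i ^ (p ^ (n - i)))"
    using less by (intro sum.cong) auto
  moreover have "ghost p n X = ghost p n Y" using less by simp
  ultimately have "of_nat (p ^ n) * X n = of_nat (p ^ n) * Y n"
    unfolding ghost_def lessThan_Suc_atMost[symmetric] by simp
  then have "of_nat (p ^ n) * (X n - Y n) = 0"
    by (simp add: right_diff_distrib)
  then show ?case using torsion_free assms(1) by fastforce
qed

lemma ghost_inj:
  fixes X Y :: "nat \<Rightarrow> 'a::torsion_free_ring"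
  assumes "p > 0" "\<And>n. ghost p n X = ghost p n Y"
  shows "X = Y"
  using ghost_eqD[OF assms(1)] assms(2) by blast

text \<open>
  Dwork's criterion: \<open>zvar v \<mapsto> zvar v ^ p\<close> lifts the Frobenius modulo \<open>p\<close>, and
  sequences satisfying the congruence below are exactly those of ghost components.
\<close>

definition dwork :: "nat \<Rightarrow> (nat \<Rightarrow> 'v zpoly) \<Rightarrow> bool" where
  "dwork p g \<longleftrightarrow> (\<forall>n. of_nat p ^ Suc n dvd g (Suc n) - tev (\<lambda>v. zvar v ^ p) (g n))"

text \<open>Components are found one at a time: the criterion makes what the earlier components
  leave over divisible by \<open>p ^ Suc n\<close>, and the quotient is the next component.\<close>

lemma dwork_ghost_exists:
  fixes g :: "nat \<Rightarrow> 'v zpoly"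
  assumes "prime p" "dwork p g"
  shows "\<exists>s. \<forall>n. ghost p n s = g n"
proof -
  let ?\<phi> = "tev (\<lambda>v. zvar v ^ p) :: 'v zpoly \<Rightarrow> 'v zpoly"
  have step: "\<exists>x. ghost p (Suc n) (s(Suc n := x)) = g (Suc n)" if "ghost p n s = g n" for n s
  proof -
    \<comment> \<open>\<open>?\<phi> (s i)\<close> and \<open>s i ^ p\<close> agree modulo
      \<open>p\<close>, so their powers with exponent \<open>p ^ (n - i)\<close> agree modulo
      \<open>p ^ Suc (n - i)\<close>; the weight \<open>p ^ i\<close> supplies the rest.\<close>
    have "of_nat p ^ Suc n dvd ghost p n (\<lambda>i. ?\<phi> (s i)) - ghost p n (\<lambda>i. s i ^ p)"
      unfolding ghost_def sum_subtractf[symmetric]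
    proof (rule dvd_sum)
      fix i assume "i \<in> {..n}"
      then have "(of_nat p ^ Suc n :: 'v zpoly) = of_nat p ^ i * of_nat p ^ Suc (n - i)"
        by (metis add_Suc_right atMost_iff le_add_diff_inverse power_add)
      also have "\<dots> dvd of_nat p ^ i * (?\<phi> (s i) ^ p ^ (n - i) - (s i ^ p) ^ p ^ (n - i))"
        by (intro mult_dvd_mono dvd_refl dvd_power_prime_power_diff dvd_frobenius_lift assms)
      finally show "of_nat p ^ Suc n dvd of_nat p ^ i * ?\<phi> (s i) ^ p ^ (n - i) - of_nat p ^ i * (s i ^ p) ^ p ^ (n - i)"
        by (simp add: right_diff_distrib)
    qed
    moreover have "of_nat p ^ Suc n dvd g (Suc n) - ?\<phi> (g n)"
      using assms(2) by (auto simp: dwork_def)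
    moreover have "?\<phi> (g n) = ghost p n (\<lambda>i. ?\<phi> (s i))"
      unfolding that[symmetric] by (rule ghost_tev)
    ultimately have "of_nat p ^ Suc n dvd
        (g (Suc n) - ?\<phi> (g n)) + (ghost p n (\<lambda>i. ?\<phi> (s i)) - ghost p n (\<lambda>i. s i ^ p))"
      by (intro dvd_add)
    then have "of_nat p ^ Suc n dvd g (Suc n) - ghost p n (\<lambda>i. s i ^ p)"
      unfolding \<open>?\<phi> (g n) = _\<close> by simp
    then obtain x where x: "g (Suc n) - ghost p n (\<lambda>i. s i ^ p) = of_nat p ^ Suc n * x"
      by (elim dvdE)
    have "ghost p n (\<lambda>i. (s(Suc n := x)) i ^ p) = ghost p n (\<lambda>i. s i ^ p)"
      unfolding ghost_def by (intro sum.cong) auto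
    then have "ghost p (Suc n) (s(Suc n := x)) = g (Suc n)"
      using x by (simp add: ghost_Suc algebra_simps)
    then show ?thesis ..
  qed
  \<comment> \<open>\<open>t n\<close> is correct up to index \<open>n\<close> and later stages
    change only later entries, so the diagonal \<open>t i i\<close> is the limit. The constant start
    \<open>g 0\<close> matters at index \<open>0\<close> only, every other entry being overwritten
    in time.\<close>
  define ext where "ext n s = s(Suc n := (SOME x. ghost p (Suc n) (s(Suc n := x)) = g (Suc n)))" for n s
  define t where "t = rec_nat (\<lambda>_. g 0) ext"
  have t0: "t 0 = (\<lambda>_. g 0)" and tS: "t (Suc n) = ext n (t n)" for n
    by (simp_all add: t_def)
  have gh: "ghost p n (t n) = g n" for n
  proof (induction n)
    case (Suc n)
    show ?case unfolding tS ext_def by (rule someI_ex, rule step, rule Suc)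
  qed (simp add: t0)
  have stable: "t (i + k) i = t i i" for i k
    by (induction k) (auto simp: tS ext_def)
  have "ghost p n (\<lambda>i. t i i) = ghost p n (t n)" for n
    unfolding ghost_def
    by (intro sum.cong) (auto simp: stable dest!: le_Suc_ex)
  then show ?thesis using gh by auto
qed

lemma dwork_ghost_zvar:
  "dwork p (\<lambda>n. ghost p n (\<lambda>i. zvar (c i)))"
  by (simp add: dwork_def ghost_tev ghost_Suc)

lemma dwork_add: "dwork p g \<Longrightarrow> dwork p h \<Longrightarrow> dwork p (\<lambda>n. g n + h n)"
  unfolding dwork_def using dvd_add by (simp add: add_diff_add)

lemma dwork_uminus: "dwork p g \<Longrightarrow> dwork p (\<lambda>n. - g n)"
  unfolding dwork_def using dvd_minus_iff by (metis minus_diff_minus tev_simps(4))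

lemma dwork_mult: 
  assumes "dwork p g" "dwork p h"
  shows "dwork p (\<lambda>n. g n * h n)"
  unfolding dwork_def
proof
  fix n
  let ?\<phi> = "tev (\<lambda>v. zvar v ^ p) :: 'a zpoly \<Rightarrow> 'a zpoly"
  have "of_nat p ^ Suc n dvd (g (Suc n) - ?\<phi> (g n)) * h (Suc n) + ?\<phi> (g n) * (h (Suc n) - ?\<phi> (h n))"
    using assms by (intro dvd_add dvd_mult dvd_mult2) (auto simp: dwork_def)
  then show "of_nat p ^ Suc n dvd g (Suc n) * h (Suc n) - ?\<phi> (g n * h n)"
    by (simp add: algebra_simps)
qed

lemma dwork_shift: "dwork p g \<Longrightarrow> dwork p (\<lambda>n. g (Suc n))"
  unfolding dwork_def by (metis dvd_mult_left power_Suc mult.commute)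

text \<open>Turns the \<open>THE\<close> in the definitions of the Witt polynomials into their
  characterising ghost equations.\<close>

lemma ghost_The:
  fixes g :: "nat \<Rightarrow> 'v zpoly"
  assumes "prime p" "dwork p g"
  shows "ghost p n (THE s. \<forall>n. ghost p n s = g n) = g n"
proof -
  have "\<exists>!s. \<forall>n. ghost p n s = g n"
    using dwork_ghost_exists[OF assms] ghost_inj[OF prime_gt_0_nat[OF assms(1)]]
    by (metis (no_types))
  from theI'[OF this] show ?thesis by blast
qed

section \<open>Ghost equations of the Witt polynomials\<close>

locale prime_nat =
  fixes p :: nat
  assumes prime_p: "prime p"
begin

lemma p_gt_0: "p > 0" and p_gt_1: "p > 1" and p_ge_2: "p \<ge> 2"
  using prime_p prime_gt_0_nat prime_gt_1_nat prime_ge_2_nat by auto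

lemma ghost_witt_add_poly:
  "ghost p n (witt_add_poly p) = ghost p n (\<lambda>i. zvar (Inl i)) + ghost p n (\<lambda>i. zvar (Inr i))"
  unfolding witt_add_poly_def
  by (rule ghost_The[OF prime_p]) (intro dwork_add dwork_ghost_zvar)

lemma ghost_witt_mult_poly:
  "ghost p n (witt_mult_poly p) = ghost p n (\<lambda>i. zvar (Inl i)) * ghost p n (\<lambda>i. zvar (Inr i))"
  unfolding witt_mult_poly_def
  by (rule ghost_The[OF prime_p]) (intro dwork_mult dwork_ghost_zvar)

lemma ghost_witt_frob_poly: "ghost p n (witt_frob_poly p) = ghost p (Suc n) zvar"
  unfolding witt_frob_poly_def
  by (rule ghost_The[OF prime_p]) (intro dwork_shift dwork_ghost_zvar)

text \<open>Type-class counterparts of the Witt vector operations on records, accessible to ghost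
  components.\<close>

definition wadd :: "(nat \<Rightarrow> 'a::comm_ring_1) \<Rightarrow> (nat \<Rightarrow> 'a) \<Rightarrow> nat \<Rightarrow> 'a" where
  "wadd X Y = (\<lambda>n. tev (case_sum X Y) (witt_add_poly p n))"

definition wmult :: "(nat \<Rightarrow> 'a::comm_ring_1) \<Rightarrow> (nat \<Rightarrow> 'a) \<Rightarrow> nat \<Rightarrow> 'a" where
  "wmult X Y = (\<lambda>n. tev (case_sum X Y) (witt_mult_poly p n))"

definition wfrob :: "(nat \<Rightarrow> 'a::comm_ring_1) \<Rightarrow> nat \<Rightarrow> 'a" where
  "wfrob X = (\<lambda>n. tev X (witt_frob_poly p n))"

lemma ghost_wadd: "ghost p n (wadd X Y) = ghost p n X + ghost p n Y"
  unfolding wadd_def ghost_tev[symmetric] ghost_witt_add_poly tev_simps by (simp add: ghost_tev)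

lemma ghost_wmult: "ghost p n (wmult X Y) = ghost p n X * ghost p n Y"
  unfolding wmult_def ghost_tev[symmetric] ghost_witt_mult_poly tev_simps by (simp add: ghost_tev)

lemma ghost_wfrob: "ghost p n (wfrob X) = ghost p (Suc n) X"
  unfolding wfrob_def ghost_tev[symmetric] ghost_witt_frob_poly by (simp add: ghost_tev)

end

section \<open>The ring of Witt vectors\<close>

context prime_nat
begin

lemma ghost_zero [simp]: "ghost p n (\<lambda>_. 0) = 0"
  using p_gt_0 by (simp add: ghost_def power_0_left)

definition wone :: "nat \<Rightarrow> 'a::comm_ring_1" where
  "wone = (\<lambda>n. if n = 0 then 1 else 0)"

lemma ghost_wone [simp]: "ghost p n wone = 1"
  using p_gt_0 by (cases n) (simp_all add: ghost_def wone_def power_0_left sum.atMost_Suc_shift del: sum.atMost_Suc)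

lemma wadd_commute: "wadd X Y = wadd Y (X :: nat \<Rightarrow> 'a::torsion_free_ring)"
  and wadd_assoc: "wadd (wadd X Y) Z = wadd X (wadd Y Z)"
  and wadd_0: "wadd (\<lambda>_. 0) X = X"
  and wmult_commute: "wmult X Y = wmult Y X"
  and wmult_assoc: "wmult (wmult X Y) Z = wmult X (wmult Y Z)"
  and wmult_1: "wmult wone X = X"
  and wmult_wadd: "wmult (wadd X Y) Z = wadd (wmult X Z) (wmult Y Z)"
  and wfrob_wadd: "wfrob (wadd X Y) = wadd (wfrob X) (wfrob Y)"
  and wfrob_wmult: "wfrob (wmult X Y) = wmult (wfrob X) (wfrob Y)"
  and wfrob_0: "wfrob (\<lambda>_. 0 :: 'a) = (\<lambda>_. 0)"
  by (rule ghost_inj[OF p_gt_0]; simp add: ghost_wadd ghost_wmult ghost_wfrob algebra_simps)+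

lemma wadd_at_0: "wadd X Y 0 = X 0 + Y 0"
  using ghost_wadd[of 0 X Y] by simp

lemma wmult_at_0: "wmult X Y 0 = X 0 * Y 0"
  using ghost_wmult[of 0 X Y] by simp

text \<open>Multiplication by the Teichmueller representative \<open>(c, 0, 0, ...)\<close> in
  closed form.\<close>

definition tscale :: "'a::comm_ring_1 \<Rightarrow> (nat \<Rightarrow> 'a) \<Rightarrow> nat \<Rightarrow> 'a" where
  "tscale c X = (\<lambda>n. c ^ (p ^ n) * X n)"

lemma ghost_tscale: "ghost p n (tscale c X) = c ^ (p ^ n) * ghost p n X"
  unfolding ghost_def tscale_def sum_distrib_left
  by (intro sum.cong) (simp_all add: power_mult_distrib mult_ac flip: power_mult power_add)

definition wversch :: "(nat \<Rightarrow> 'a::comm_ring_1) \<Rightarrow> nat \<Rightarrow> 'a" where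
  "wversch X = (\<lambda>n. case n of 0 \<Rightarrow> 0 | Suc m \<Rightarrow> X m)"

lemma ghost_Suc_shift: "ghost p (Suc n) X = X 0 ^ (p ^ Suc n) + of_nat p * ghost p n (\<lambda>i. X (Suc i))"
  by (simp add: ghost_def sum.atMost_Suc_shift sum_distrib_left mult_ac del: sum.atMost_Suc)

lemma ghost_wversch_Suc: "ghost p (Suc n) (wversch X) = of_nat p * ghost p n X"
  using p_gt_0 by (simp add: ghost_Suc_shift wversch_def power_0_left)

text \<open>Write \<open>X\<close> as the Teichmueller lift of \<open>X 0\<close> plus a Verschiebung and use \<open>V a \<cdot> b = V (a \<cdot> F b)\<close>.\<close>

lemma wmult_decompose:
  fixes X Y :: "nat \<Rightarrow> 'a::torsion_free_ring"
  shows "wmult X Y = wadd (tscale (X 0) Y) (wversch (wmult (\<lambda>n. X (Suc n)) (wfrob Y)))"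
proof (rule ghost_inj[OF p_gt_0])
  fix n
  show "ghost p n (wmult X Y) = ghost p n (wadd (tscale (X 0) Y) (wversch (wmult (\<lambda>n. X (Suc n)) (wfrob Y))))"
  proof (cases n)
    case 0
    then show ?thesis by (simp add: wadd_at_0 wmult_at_0 tscale_def wversch_def)
  next
    case (Suc m)
    then show ?thesis
      by (simp add: ghost_wadd ghost_wmult ghost_tscale ghost_wversch_Suc ghost_wfrob algebra_simps)
        (simp add: ghost_Suc_shift[of m X] algebra_simps)
  qed
qed

end

locale witt_base = prime_nat p + base_cring R for p :: nat and R :: "'u ring" (structure)
begin

abbreviation W where "W \<equiv> witt_ring p R"

text \<open>
  Every ring is a quotient of a torsion-free one, on whose Witt vectors identities can be checked on ghost components.
\<close>

definition eps :: "'u zpoly \<Rightarrow> 'u" where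
  "eps = zeval R (\<lambda>a. if a \<in> carrier R then a else \<zero>)"

lemma eps_hom: "eps \<in> ring_hom (subset_ring UNIV) R"
  unfolding eps_def by (rule zeval_hom) simp

lemma eps_closed [simp]: "eps P \<in> carrier R"
  using ring_hom_closed[OF eps_hom] by simp

lemma eps_simps [simp]: 
  "eps (P + Q) = eps P \<oplus> eps Q" "eps (P * Q) = eps P \<otimes> eps Q" "eps 1 = \<one>" "eps 0 = \<zero>"
  using ring_hom_add[OF eps_hom] ring_hom_mult[OF eps_hom] ring_hom_one[OF eps_hom]
    ring_hom_zero[OF eps_hom cring.axioms(1)[OF cring_subset_ring] ring_axioms]
  by auto

lemma eps_power [simp]: "eps (P ^ n) = eps P [^] n"
  by (induction n) (simp_all add: m_comm)

lemma eps_zvar [simp]: "a \<in> carrier R \<Longrightarrow> eps (zvar a) = a"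
  unfolding eps_def by (simp add: zeval_zvar)

lemma eps_tev: "eps (tev X P) = zeval R (\<lambda>v. eps (X v)) P"
  using ring_hom_tev[OF is_subring_UNIV is_cring eps_hom, of X P] by (simp add: comp_def)

definition eps_seq :: "(nat \<Rightarrow> 'u zpoly) \<Rightarrow> nat \<Rightarrow> 'u" where
  "eps_seq X = (\<lambda>n. eps (X n))"

lemma witt_carrier_iff: "w \<in> carrier W \<longleftrightarrow> (\<forall>n. w n \<in> carrier R)"
  by (simp add: witt_ring_def)

lemma eps_seq_closed [simp]: "eps_seq X \<in> carrier W"
  by (simp add: witt_carrier_iff eps_seq_def)

text \<open>The lift is made explicit because additive inverses and truncations use that its
  components are variables determined by the entries \<open>w n\<close>.\<close>

lemma witt_lift:
  assumes "w \<in> carrier W"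
  obtains X where "w = eps_seq X" "X = (\<lambda>n. zvar (w n))"
  using assms by (auto simp: witt_carrier_iff eps_seq_def)

lemma eps_case_sum: "(\<lambda>v. eps (case_sum X Y v)) = case_sum (eps_seq X) (eps_seq Y)"
  by (auto simp: eps_seq_def split: sum.splits)

lemma witt_ops_eps_seq:
  "eps_seq X \<oplus>\<^bsub>W\<^esub> eps_seq Y = eps_seq (wadd X Y)" "eps_seq X \<otimes>\<^bsub>W\<^esub> eps_seq Y = eps_seq (wmult X Y)"
  "\<zero>\<^bsub>W\<^esub> = eps_seq (\<lambda>_. 0)" "\<one>\<^bsub>W\<^esub> = eps_seq wone" "witt_frob p R (eps_seq X) = eps_seq (wfrob X)"
  unfolding witt_ring_def witt_frob_def wadd_def wmult_def wfrob_def wone_def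
  by (auto simp: eps_tev eps_case_sum eps_seq_def[abs_def] fun_eq_iff)

lemma cring_witt: "cring W"
proof (rule cringI)
  show "abelian_group W"
  proof (rule abelian_groupI)
    fix x assume "x \<in> carrier W"
    then obtain X where X: "x = eps_seq X" "X = (\<lambda>n. zvar (x n))" by (rule witt_lift)
    \<comment> \<open>There is no polynomial for negation at hand; Dwork's criterion supplies a
      vector with the opposite ghost components over the ring of polynomials.\<close>
    have "dwork p (\<lambda>n. - ghost p n X)" unfolding X(2) by (intro dwork_uminus dwork_ghost_zvar)
    then obtain Y where Y: "\<And>n. ghost p n Y = - ghost p n X"
      using dwork_ghost_exists[OF prime_p] by blast
    have "wadd Y X = (\<lambda>_. 0)"
      by (rule ghost_inj[OF p_gt_0]) (simp add: ghost_wadd Y)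
    then show "\<exists>y\<in>carrier W. y \<oplus>\<^bsub>W\<^esub> x = \<zero>\<^bsub>W\<^esub>"
      by (intro bexI[of _ "eps_seq Y"]) (simp_all add: X(1) witt_ops_eps_seq)
  qed (auto elim!: witt_lift simp: witt_ops_eps_seq wadd_assoc wadd_0 intro: arg_cong[where f = eps_seq, OF wadd_commute])
  show "Group.comm_monoid W"
    by (rule comm_monoidI) (auto elim!: witt_lift simp: witt_ops_eps_seq wmult_assoc wmult_1 intro: arg_cong[where f = eps_seq, OF wmult_commute])
qed (auto elim!: witt_lift simp: witt_ops_eps_seq wmult_wadd)

lemma frob_add:
  "v \<in> carrier W \<Longrightarrow> w \<in> carrier W \<Longrightarrow> witt_frob p R (v \<oplus>\<^bsub>W\<^esub> w) = witt_frob p R v \<oplus>\<^bsub>W\<^esub> witt_frob p R w"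
  by (auto elim!: witt_lift simp: witt_ops_eps_seq wfrob_wadd)

lemma frob_mult:
  "v \<in> carrier W \<Longrightarrow> w \<in> carrier W \<Longrightarrow> witt_frob p R (v \<otimes>\<^bsub>W\<^esub> w) = witt_frob p R v \<otimes>\<^bsub>W\<^esub> witt_frob p R w"
  by (auto elim!: witt_lift simp: witt_ops_eps_seq wfrob_wmult)

lemma frob_zero: "witt_frob p R \<zero>\<^bsub>W\<^esub> = \<zero>\<^bsub>W\<^esub>"
  by (simp add: witt_ops_eps_seq wfrob_0)

lemma frob_closed: "w \<in> carrier W \<Longrightarrow> witt_frob p R w \<in> carrier W"
  by (auto elim!: witt_lift simp: witt_ops_eps_seq)

lemma witt_add_at_0:
  "v \<in> carrier W \<Longrightarrow> w \<in> carrier W \<Longrightarrow> (v \<oplus>\<^bsub>W\<^esub> w) 0 = v 0 \<oplus> w 0"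
  by (auto elim!: witt_lift simp: witt_ops_eps_seq) (simp add: eps_seq_def wadd_at_0)

lemma witt_mult_at_0:
  "v \<in> carrier W \<Longrightarrow> w \<in> carrier W \<Longrightarrow> (v \<otimes>\<^bsub>W\<^esub> w) 0 = v 0 \<otimes> w 0"
  by (auto elim!: witt_lift simp: witt_ops_eps_seq) (simp add: eps_seq_def wmult_at_0)

definition frob_kernel :: "(nat \<Rightarrow> 'u) set" where
  "frob_kernel = {w \<in> carrier W. witt_frob p R w = \<zero>\<^bsub>W\<^esub>}"

text \<open>By \<open>wmult_decompose\<close> the product is the Teichmueller multiple by
  \<open>a 0\<close> plus a Verschiebung of a multiple of \<open>F w\<close>, and the latter
  vanishes. Hence the action depends on \<open>a\<close> only through \<open>a 0\<close>.\<close>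

lemma witt_mult_frob_kernel:
  assumes a: "a \<in> carrier W" and w: "w \<in> frob_kernel"
  shows "a \<otimes>\<^bsub>W\<^esub> w = (\<lambda>n. a 0 [^] (p ^ n) \<otimes> w n)"
proof -
  interpret W: cring W by (rule cring_witt)
  obtain X where X: "a = eps_seq X" using a by (rule witt_lift)
  obtain Y where Y: "w = eps_seq Y" using w by (auto simp: frob_kernel_def elim: witt_lift)
  have "eps_seq (wmult (\<lambda>n. X (Suc n)) (wfrob Y)) = eps_seq (\<lambda>n. X (Suc n)) \<otimes>\<^bsub>W\<^esub> witt_frob p R w"
    by (simp add: witt_ops_eps_seq Y)
  also have "\<dots> = \<zero>\<^bsub>W\<^esub>" using w by (simp add: frob_kernel_def)
  finally have "eps_seq (wversch (wmult (\<lambda>n. X (Suc n)) (wfrob Y))) = \<zero>\<^bsub>W\<^esub>"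
    unfolding witt_ops_eps_seq by (auto simp: eps_seq_def fun_eq_iff wversch_def split: nat.splits)
  then have "a \<otimes>\<^bsub>W\<^esub> w = eps_seq (tscale (X 0) Y) \<oplus>\<^bsub>W\<^esub> \<zero>\<^bsub>W\<^esub>"
    unfolding X Y witt_ops_eps_seq(2) by (subst wmult_decompose) (simp add: witt_ops_eps_seq(1)[symmetric])
  also have "\<dots> = eps_seq (tscale (X 0) Y)" by simp
  finally show ?thesis by (simp add: X Y eps_seq_def tscale_def)
qed

lemma frob_kernel_closed:
  "\<zero>\<^bsub>W\<^esub> \<in> frob_kernel"
  "v \<in> frob_kernel \<Longrightarrow> w \<in> frob_kernel \<Longrightarrow> v \<oplus>\<^bsub>W\<^esub> w \<in> frob_kernel"
  "a \<in> carrier W \<Longrightarrow> w \<in> frob_kernel \<Longrightarrow> a \<otimes>\<^bsub>W\<^esub> w \<in> frob_kernel"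
  "w \<in> frob_kernel \<Longrightarrow> \<ominus>\<^bsub>W\<^esub> w \<in> frob_kernel"
proof -
  interpret W: cring W by (rule cring_witt)
  show zero: "\<zero>\<^bsub>W\<^esub> \<in> frob_kernel" by (simp add: frob_kernel_def frob_zero)
  show "v \<in> frob_kernel \<Longrightarrow> w \<in> frob_kernel \<Longrightarrow> v \<oplus>\<^bsub>W\<^esub> w \<in> frob_kernel"
    by (auto simp: frob_kernel_def frob_add)
  show mult: "a \<in> carrier W \<Longrightarrow> w \<in> frob_kernel \<Longrightarrow> a \<otimes>\<^bsub>W\<^esub> w \<in> frob_kernel" for a w
    by (auto simp: frob_kernel_def frob_mult frob_closed)
  show "w \<in> frob_kernel \<Longrightarrow> \<ominus>\<^bsub>W\<^esub> w \<in> frob_kernel"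
    using mult[of "\<ominus>\<^bsub>W\<^esub> \<one>\<^bsub>W\<^esub>" w] by (simp add: W.l_minus frob_kernel_def)
qed

lemma frob_kernel_subset: "frob_kernel \<subseteq> carrier W"
  by (auto simp: frob_kernel_def)

definition kscale :: "'u \<Rightarrow> (nat \<Rightarrow> 'u) \<Rightarrow> nat \<Rightarrow> 'u" where
  "kscale c w = (\<lambda>n. c [^] (p ^ n) \<otimes> w n)"

lemma WF_simps [simp]:
  "carrier (qpts (WF p) R) = frob_kernel"
  "x \<oplus>\<^bsub>qpts (WF p) R\<^esub> y = x \<oplus>\<^bsub>W\<^esub> y"
  "\<zero>\<^bsub>qpts (WF p) R\<^esub> = \<zero>\<^bsub>W\<^esub>"
  "qmap (WF p) R S f w = f \<circ> w" "qd (WF p) R w = w 0"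
  by (auto simp: WF_def frob_kernel_def)

lemma witt_mult_lift:
  assumes "c \<in> carrier R" "w \<in> frob_kernel"
  shows "kscale c w = (\<lambda>n. if n = 0 then c else \<zero>) \<otimes>\<^bsub>W\<^esub> w" 
    and "(\<lambda>n. if n = 0 then c else \<zero>) \<in> carrier W"
  using assms by (auto simp: kscale_def witt_carrier_iff witt_mult_frob_kernel)

text \<open>The \<open>THE\<close> is meaningful because the product depends on \<open>a 0\<close>
  only and because \<open>(c, 0, 0, ...)\<close> is a lift of \<open>c\<close>.\<close>

lemma WF_smult:
  assumes "c \<in> carrier R" "w \<in> frob_kernel"
  shows "c \<odot>\<^bsub>qpts (WF p) R\<^esub> w = kscale c w"
proof -
  have "(THE v. \<forall>a\<in>carrier W. a 0 = c \<longrightarrow> v = a \<otimes>\<^bsub>W\<^esub> w) = kscale c w"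
  proof (rule the_equality)
    show "\<forall>a\<in>carrier W. a 0 = c \<longrightarrow> kscale c w = a \<otimes>\<^bsub>W\<^esub> w"
      using assms by (auto simp: witt_mult_frob_kernel kscale_def)
  next
    fix v assume "\<forall>a\<in>carrier W. a 0 = c \<longrightarrow> v = a \<otimes>\<^bsub>W\<^esub> w"
    then show "v = kscale c w"
      using witt_mult_lift[OF assms] by fastforce
  qed
  then show ?thesis by (simp add: WF_def)
qed

lemma WF_module: "module R (qpts (WF p) R)"
proof -
  interpret W: cring W by (rule cring_witt)
  let ?K = "qpts (WF p) R"
  have K: "w \<in> frob_kernel \<Longrightarrow> w \<in> carrier W" for w using frob_kernel_subset by auto
  have closed: "kscale c w \<in> frob_kernel" if "c \<in> carrier R" "w \<in> frob_kernel" for c w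
    using that by (simp add: witt_mult_lift frob_kernel_closed)
  have lin: "kscale (a 0) w = a \<otimes>\<^bsub>W\<^esub> w" if "a \<in> carrier W" "w \<in> frob_kernel" for a w
    using that by (simp add: witt_mult_frob_kernel kscale_def)
  show ?thesis
  proof (rule moduleI)
    show "cring R" by (rule is_cring)
    show "abelian_group ?K"
    proof (rule abelian_groupI)
      fix x assume x: "x \<in> carrier ?K"
      show "\<exists>y\<in>carrier ?K. y \<oplus>\<^bsub>?K\<^esub> x = \<zero>\<^bsub>?K\<^esub>"
        using x by (intro bexI[of _ "\<ominus>\<^bsub>W\<^esub> x"]) (auto simp: frob_kernel_closed K W.l_neg)
    qed (auto simp: frob_kernel_closed K W.a_ac)
  next
    fix a x assume "a \<in> carrier R" "x \<in> carrier ?K"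
    then show "a \<odot>\<^bsub>?K\<^esub> x \<in> carrier ?K" by (simp add: WF_smult closed)
  next
    fix a b x assume ab: "a \<in> carrier R" "b \<in> carrier R" and x: "x \<in> carrier ?K"
    \<comment> \<open>The Witt sum of \<open>A\<close> and \<open>B\<close> need not be
      \<open>(a \<oplus> b, 0, 0, ...)\<close>, but it is a lift of \<open>a \<oplus> b\<close>, and
      any lift computes the action.\<close>
    define A B where "A = (\<lambda>n::nat. if n = 0 then a else \<zero>)" and "B = (\<lambda>n::nat. if n = 0 then b else \<zero>)"
    have [simp]: "A \<in> carrier W" "B \<in> carrier W" using ab by (auto simp: A_def B_def witt_carrier_iff)
    have A0: "A 0 = a" "B 0 = b" by (auto simp: A_def B_def)
    have "kscale (a \<oplus> b) x = kscale a x \<oplus>\<^bsub>W\<^esub> kscale b x"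
      using lin[of A x] lin[of B x] lin[of "A \<oplus>\<^bsub>W\<^esub> B" x] x
      by (simp add: A0 witt_add_at_0 W.l_distr K)
    then show "(a \<oplus> b) \<odot>\<^bsub>?K\<^esub> x = a \<odot>\<^bsub>?K\<^esub> x \<oplus>\<^bsub>?K\<^esub> b \<odot>\<^bsub>?K\<^esub> x"
      using ab x by (simp add: WF_smult)
    have "kscale (a \<otimes> b) x = kscale a (kscale b x)"
      using lin[of A "kscale b x"] lin[of B x] lin[of "A \<otimes>\<^bsub>W\<^esub> B" x] x ab closed[of b x]
      by (simp add: A0 witt_mult_at_0 W.m_assoc K closed)
    then show "(a \<otimes> b) \<odot>\<^bsub>?K\<^esub> x = a \<odot>\<^bsub>?K\<^esub> (b \<odot>\<^bsub>?K\<^esub> x)"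
      using ab x by (simp add: WF_smult closed)
  next
    fix a x y assume a: "a \<in> carrier R" and xy: "x \<in> carrier ?K" "y \<in> carrier ?K"
    then show "a \<odot>\<^bsub>?K\<^esub> (x \<oplus>\<^bsub>?K\<^esub> y) = a \<odot>\<^bsub>?K\<^esub> x \<oplus>\<^bsub>?K\<^esub> a \<odot>\<^bsub>?K\<^esub> y"
      by (simp add: WF_smult frob_kernel_closed witt_mult_lift W.r_distr K)
  next
    fix x assume x: "x \<in> carrier ?K"
    then show "\<one> \<odot>\<^bsub>?K\<^esub> x = x"
      using K[of x] by (simp add: WF_smult kscale_def witt_carrier_iff)
  qed
qed

lemma WF_d:
  "x \<in> frob_kernel \<Longrightarrow> y \<in> frob_kernel \<Longrightarrow> kscale (x 0) y = kscale (y 0) x"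
  "x \<in> frob_kernel \<Longrightarrow> c \<in> carrier R \<Longrightarrow> kscale c x 0 = c \<otimes> x 0"
proof -
  interpret W: cring W by (rule cring_witt)
  show "kscale (x 0) y = kscale (y 0) x" if xy: "x \<in> frob_kernel" "y \<in> frob_kernel"
  proof -
    have W: "x \<in> carrier W" "y \<in> carrier W" using xy frob_kernel_subset by auto
    then show ?thesis
      using witt_mult_frob_kernel[OF W(1) xy(2)] witt_mult_frob_kernel[OF W(2) xy(1)] W.m_comm[OF W]
      by (simp add: kscale_def)
  qed
  show "x \<in> frob_kernel \<Longrightarrow> c \<in> carrier R \<Longrightarrow> kscale c x 0 = c \<otimes> x 0"
    by (simp add: kscale_def)
qed

end

lemma (in prime_nat) witt_ring_natural:
  assumes "cring R" "cring S" and f: "f \<in> ring_hom R S"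
    and vw: "v \<in> carrier (witt_ring p R)" "w \<in> carrier (witt_ring p R)"
  shows "f \<circ> v \<in> carrier (witt_ring p S)"
    "f \<circ> (v \<oplus>\<^bsub>witt_ring p R\<^esub> w) = (f \<circ> v) \<oplus>\<^bsub>witt_ring p S\<^esub> (f \<circ> w)"
    "f \<circ> (v \<otimes>\<^bsub>witt_ring p R\<^esub> w) = (f \<circ> v) \<otimes>\<^bsub>witt_ring p S\<^esub> (f \<circ> w)"
    "f \<circ> witt_frob p R v = witt_frob p S (f \<circ> v)"
    "f \<circ> \<zero>\<^bsub>witt_ring p R\<^esub> = \<zero>\<^bsub>witt_ring p S\<^esub>"
proof -
  have v: "\<And>n. v n \<in> carrier R" and w: "\<And>n. w n \<in> carrier R"
    using vw by (auto simp: witt_ring_def)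
  have vw': "case_sum v w i \<in> carrier R" for i using v w by (cases i) auto
  have comp: "f \<circ> case_sum v w = case_sum (f \<circ> v) (f \<circ> w)"
    by (auto simp: fun_eq_iff split: sum.splits)
  show "f \<circ> v \<in> carrier (witt_ring p S)"
    using v ring_hom_closed[OF f] by (simp add: witt_ring_def)
  show "f \<circ> (v \<oplus>\<^bsub>witt_ring p R\<^esub> w) = (f \<circ> v) \<oplus>\<^bsub>witt_ring p S\<^esub> (f \<circ> w)"
    "f \<circ> (v \<otimes>\<^bsub>witt_ring p R\<^esub> w) = (f \<circ> v) \<otimes>\<^bsub>witt_ring p S\<^esub> (f \<circ> w)"
    by (auto simp: witt_ring_def fun_eq_iff ring_hom_zeval[OF assms(1-3) vw'] comp)
  show "f \<circ> witt_frob p R v = witt_frob p S (f \<circ> v)"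
    by (auto simp: witt_frob_def fun_eq_iff ring_hom_zeval[OF assms(1-3) v])
  show "f \<circ> \<zero>\<^bsub>witt_ring p R\<^esub> = \<zero>\<^bsub>witt_ring p S\<^esub>"
    using ring_hom_zero[OF f] assms by (auto simp: witt_ring_def fun_eq_iff cring_def)
qed

section \<open>Homomorphisms out of rings with divided monomials\<close>

text \<open>The base case treats only the terms of the given \<open>F\<close>, whose coefficients
  inherit the integrality known for \<open>F\<close>.\<close>

lemma poly_monom_induct [case_names monom zero plus]:
  assumes F: "\<And>j. Q (Polynomial.monom (Polynomial.coeff F j) j)" "Q 0"
    and add: "\<And>G H. Q G \<Longrightarrow> Q H \<Longrightarrow> Q (G + H)"
  shows "Q (F :: 'a::comm_ring_1 poly)"
proof -
  have "Q (\<Sum>j\<in>I. Polynomial.monom (Polynomial.coeff F j) j)" if "finite I" for I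
    using that by induction (auto intro: add F)
  from this[of "{..Polynomial.degree F}"] show ?thesis by (simp add: poly_as_sum_of_monoms)
qed

text \<open>In degree \<open>j\<close>, denominators up to \<open>p ^ v j\<close> over
  \<open>S\<close> are allowed. With \<open>v\<close> given by digits, \<open>S = \<int>\<close>
  yields a ring containing \<open>A\<close>, and \<open>S = A\<close> one containing
  \<open>A_tensor_A\<close>.\<close>

definition weighted :: "nat \<Rightarrow> (nat \<Rightarrow> nat) \<Rightarrow> 'a::comm_ring_1 set \<Rightarrow> 'a poly set" where
  "weighted p v S = {F. \<forall>j. of_nat p ^ v j * Polynomial.coeff F j \<in> S}"

lemma weighted_monom:
  assumes "is_subring S" "of_nat p ^ v j * c \<in> S"
  shows "Polynomial.monom c j \<in> weighted p v S"
  using assms by (auto simp: weighted_def is_subringD(2))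

lemma weighted_coeff: "F \<in> weighted p v S \<Longrightarrow> of_nat p ^ v j * Polynomial.coeff F j \<in> S"
  by (simp add: weighted_def)

text \<open>Superadditivity of \<open>v\<close> makes the product of two permitted denominators
  permitted; the surplus is a power of \<open>p\<close>, which lies in \<open>S\<close>.\<close>

lemma is_subring_weighted:
  assumes S: "is_subring S" and v: "v 0 = 0" "\<And>i j. v i + v j \<le> v (i + j)"
  shows "is_subring (weighted p v S)"
  unfolding is_subring_def
proof (intro conjI ballI)
  show "1 \<in> weighted p v S"
    using weighted_monom[OF S, of p v 0 1] v by (simp add: is_subringD[OF S] monom_0 one_pCons)
next
  fix F G assume FG: "F \<in> weighted p v S" "G \<in> weighted p v S"
  then show "F - G \<in> weighted p v S"
    by (auto simp: weighted_def right_diff_distrib is_subringD[OF S])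
  show "F * G \<in> weighted p v S"
    unfolding weighted_def
  proof (intro CollectI allI)
    fix n
    have "of_nat p ^ v n * Polynomial.coeff (F * G) n =
        (\<Sum>i\<le>n. of_nat p ^ (v n - v i - v (n - i)) *
          ((of_nat p ^ v i * Polynomial.coeff F i) * (of_nat p ^ v (n - i) * Polynomial.coeff G (n - i))))"
      unfolding coeff_mult sum_distrib_left
    proof (rule sum.cong)
      fix i assume "i \<in> {..n}"
      then have "v n = (v n - v i - v (n - i)) + v i + v (n - i)" using v(2)[of i "n - i"] by simp
      then have "(of_nat p :: 'a) ^ v n = of_nat p ^ (v n - v i - v (n - i)) * of_nat p ^ v i * of_nat p ^ v (n - i)"
        by (metis power_add)
      then show "of_nat p ^ v n * (Polynomial.coeff F i * Polynomial.coeff G (n - i)) =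
        of_nat p ^ (v n - v i - v (n - i)) *
          ((of_nat p ^ v i * Polynomial.coeff F i) * (of_nat p ^ v (n - i) * Polynomial.coeff G (n - i)))"
        by (simp add: mult_ac)
    qed simp
    also have "\<dots> \<in> S"
      using FG is_subring_of_int[OF S, of "int p"]
      by (intro is_subring_sum[OF S] is_subringD(6)[OF S] is_subringD(7)[OF S] weighted_coeff) auto
    finally show "of_nat p ^ v n * Polynomial.coeff (F * G) n \<in> S" .
  qed
qed

context base_cring
begin

lemma ring_hom_of_int:
  assumes S: "is_subring S" and g: "g \<in> ring_hom (subset_ring S) R"
  shows "g (of_int k) = [k] \<cdot> \<one>"
proof -
  interpret S: cring "subset_ring S" by (rule cring_subset_ring[OF S])
  interpret g: ring_hom_cring "subset_ring S" R g
    by (intro ring_hom_cringI g S.is_cring is_cring)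
  interpret h: ring_hom_cring "subset_ring UNIV :: int ring" R "\<lambda>k. [k] \<cdot> \<one>"
    by (intro ring_hom_cringI add_pow_int_hom is_cring cring_subset_ring is_subring_UNIV)
  have nat: "g (of_nat n) = [int n] \<cdot> \<one>" for n
  proof (induction n)
    case 0
    then show ?case using g.hom_zero h.hom_zero by simp
  next
    case (Suc n)
    have "g (of_nat (Suc n)) = g 1 \<oplus> g (of_nat n)"
      using g.hom_add[of 1 "of_nat n"] is_subring_of_int[OF S, of "int n"] by (simp add: is_subringD[OF S])
    also have "\<dots> = [int (Suc n)] \<cdot> \<one>"
      using h.hom_add[of 1 "int n"] h.hom_one g.hom_one by (simp add: Suc)
    finally show ?case .
  qed
  show ?thesis
  proof (cases k rule: int_cases2)
    case (nonneg n)
    then show ?thesis using nat by simp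
  next
    case (nonpos n)
    have "g (- of_nat n) = \<ominus> g (of_nat n)"
      using g.hom_a_inv[of "of_nat n"] is_subring_of_int[OF S, of "int n"] S by simp
    moreover have "[(- int n)] \<cdot> \<one> = \<ominus> ([int n] \<cdot> \<one>)"
      using h.hom_a_inv[of "int n"] by simp
    ultimately show ?thesis using nonpos nat by simp
  qed
qed

text \<open>The multiplication law of the monomials \<open>x^j / p^v(j)\<close>, with
  \<open>M j\<close> as the intended image: the product of two of them is the next one times a
  leftover power of \<open>p\<close>.\<close>

definition graded :: "nat \<Rightarrow> (nat \<Rightarrow> nat) \<Rightarrow> (nat \<Rightarrow> 'u) \<Rightarrow> bool" where
  "graded p v M \<longleftrightarrow> v 0 = 0 \<and> M 0 = \<one> \<and> (\<forall>i. M i \<in> carrier R) \<and>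
     (\<forall>i j. \<exists>c. v (i + j) = v i + v j + c \<and> M i \<otimes> M j = ([int p] \<cdot> \<one>) [^] c \<otimes> M (i + j))"

lemma graded_weight: "graded p v M \<Longrightarrow> v i + v j \<le> v (i + j)"
  unfolding graded_def by (metis le_add1)

lemma is_subring_weighted_graded:
  "is_subring S \<Longrightarrow> graded p v M \<Longrightarrow> is_subring (weighted p v S)"
  by (rule is_subring_weighted) (auto simp: graded_weight, simp add: graded_def)

text \<open>Expands \<open>F\<close> in the monomials \<open>x^j / p^v(j)\<close>, where the
  coefficients lie in \<open>S\<close>, and replaces each monomial by \<open>M j\<close>.\<close>

definition poly_ext :: "nat \<Rightarrow> (nat \<Rightarrow> nat) \<Rightarrow> ('a::comm_ring_1 \<Rightarrow> 'u) \<Rightarrow> (nat \<Rightarrow> 'u) \<Rightarrow> 'a poly \<Rightarrow> 'u" where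
  "poly_ext p v g M F = (\<Oplus>j\<in>{..Polynomial.degree F}. g (of_nat p ^ v j * Polynomial.coeff F j) \<otimes> M j)"

text \<open>The map is additive by construction, so multiplicativity is needed only on monomials,
  where it is the law recorded in \<open>graded\<close>.\<close>

lemma poly_ext_hom:
  assumes S: "is_subring S" and g: "g \<in> ring_hom (subset_ring S) R" and M: "graded p v M"
  shows "poly_ext p v g M \<in> ring_hom (subset_ring (weighted p v S)) R"
    and "of_nat p ^ v j * c \<in> S \<Longrightarrow>
      poly_ext p v g M (Polynomial.monom c j) = g (of_nat p ^ v j * c) \<otimes> M j"
proof -
  interpret S: cring "subset_ring S" by (rule cring_subset_ring[OF S])
  interpret g: ring_hom_cring "subset_ring S" R g
    by (intro ring_hom_cringI g S.is_cring is_cring)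
  let ?H = "poly_ext p v g M" and ?A = "weighted p v S"
  have A: "is_subring ?A" by (rule is_subring_weighted_graded[OF S M])
  have Mc [simp]: "M j \<in> carrier R" for j using M by (simp add: graded_def)
  have gc [simp]: "x \<in> S \<Longrightarrow> g x \<in> carrier R" for x using g.hom_closed by simp
  have g0 [simp]: "g 0 = \<zero>" using g.hom_zero by simp
  have ext: "?H F = (\<Oplus>j\<in>{..n}. g (of_nat p ^ v j * Polynomial.coeff F j) \<otimes> M j)"
    if "F \<in> ?A" "Polynomial.degree F \<le> n" for F n
    unfolding poly_ext_def
    by (rule add.finprod_mono_neutral_cong_left)
       (use that in \<open>auto simp: coeff_eq_0 weighted_coeff\<close>)
  have closed: "?H F \<in> carrier R" if "F \<in> ?A" for F
    unfolding poly_ext_def using that by (intro finsum_closed) (auto simp: weighted_coeff)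
  have add: "?H (F + G) = ?H F \<oplus> ?H G" if FG: "F \<in> ?A" "G \<in> ?A" for F G
  proof -
    define n where "n = max (Polynomial.degree F) (Polynomial.degree G)"
    have n: "Polynomial.degree F \<le> n" "Polynomial.degree G \<le> n" "Polynomial.degree (F + G) \<le> n"
      using degree_add_le_max[of F G] by (auto simp: n_def)
    have "?H (F + G) = (\<Oplus>j\<in>{..n}. g (of_nat p ^ v j * Polynomial.coeff F j) \<otimes> M j
        \<oplus> g (of_nat p ^ v j * Polynomial.coeff G j) \<otimes> M j)"
      using FG by (subst ext[OF is_subringD(5)[OF A FG] n(3)], intro finsum_cong')
        (auto simp: weighted_coeff distrib_left l_distr g.hom_add[simplified])
    also have "\<dots> = ?H F \<oplus> ?H G"
      using FG by (subst finsum_addf) (auto simp: weighted_coeff ext[OF _ n(1)] ext[OF _ n(2)])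
    finally show ?thesis .
  qed
  show monom: "?H (Polynomial.monom c j) = g (of_nat p ^ v j * c) \<otimes> M j" if c: "of_nat p ^ v j * c \<in> S" for c j
  proof -
    have "?H (Polynomial.monom c j) =
        (\<Oplus>i\<in>{..j}. if j = i then g (of_nat p ^ v j * c) \<otimes> M j else \<zero>)"
      using c by (subst ext[of _ j], auto simp: weighted_monom[OF S] degree_monom_le intro!: finsum_cong')
    also have "\<dots> = g (of_nat p ^ v j * c) \<otimes> M j"
      using c by (subst finsum_singleton) auto
    finally show ?thesis .
  qed
  have gp: "g (of_nat p ^ k * x) = ([int p] \<cdot> \<one>) [^] k \<otimes> g x" if "x \<in> S" for k x
  proof (induction k)
    case (Suc k)
    have pS: "of_nat p \<in> S" using is_subring_of_int[OF S, of "int p"] by simp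
    have "g (of_nat p * (of_nat p ^ k * x)) = g (of_nat p) \<otimes> g (of_nat p ^ k * x)"
      using that pS g.hom_mult[of "of_nat p" "of_nat p ^ k * x"] by (simp add: is_subringD[OF S])
    then show ?case
      using that ring_hom_of_int[OF S g, of "int p"] by (simp add: Suc mult.assoc m_ac)
  qed (use that in simp)
  have mm: "?H (Polynomial.monom c i * Polynomial.monom d j) = ?H (Polynomial.monom c i) \<otimes> ?H (Polynomial.monom d j)"
    if cd: "of_nat p ^ v i * c \<in> S" "of_nat p ^ v j * d \<in> S" for c d i j
  proof -
    obtain e where e: "v (i + j) = v i + v j + e" "M i \<otimes> M j = ([int p] \<cdot> \<one>) [^] e \<otimes> M (i + j)"
      using M unfolding graded_def by blast
    have *: "of_nat p ^ v (i + j) * (c * d) = of_nat p ^ e * ((of_nat p ^ v i * c) * (of_nat p ^ v j * d))"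
      by (simp add: e power_add mult_ac)
    have pS: "of_nat p ^ e \<in> S" using is_subring_of_int[OF S, of "int p ^ e"] by simp
    have "?H (Polynomial.monom (c * d) (i + j)) = g (of_nat p ^ v (i + j) * (c * d)) \<otimes> M (i + j)"
      using cd pS by (intro monom) (auto simp: * is_subringD[OF S])
    also have "\<dots> = ([int p] \<cdot> \<one>) [^] e \<otimes> (g (of_nat p ^ v i * c) \<otimes> g (of_nat p ^ v j * d)) \<otimes> M (i + j)"
      unfolding * using cd by (subst gp) (auto simp: is_subringD[OF S] g.hom_mult[simplified])
    also have "\<dots> = (g (of_nat p ^ v i * c) \<otimes> g (of_nat p ^ v j * d)) \<otimes> (M i \<otimes> M j)"
      using cd by (simp add: e(2) m_ac)
    also have "\<dots> = ?H (Polynomial.monom c i) \<otimes> ?H (Polynomial.monom d j)"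
      using cd by (simp add: monom m_ac)
    finally show ?thesis by (simp add: mult_monom)
  qed
  have A0: "0 \<in> ?A" "?H 0 = \<zero>" using monom[of 0 0] by (auto simp: is_subringD[OF A] is_subringD[OF S])
  have mult: "?H (F * G) = ?H F \<otimes> ?H G" if FG: "F \<in> ?A" "G \<in> ?A" for F G
  proof -
    \<comment> \<open>Membership in \<open>?A\<close> is carried through the induction because
      additivity of \<open>?H\<close> is available only there.\<close>
    have 1: "G \<in> ?A \<and> ?H (Polynomial.monom c i * G) = ?H (Polynomial.monom c i) \<otimes> ?H G" 
      if c: "of_nat p ^ v i * c \<in> S" for c i
    proof (induction G rule: poly_monom_induct)
      case (plus G H)
      then show ?case using c A
        by (simp add: add distrib_left weighted_monom[OF S] is_subringD[OF A] closed r_distr)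
    qed (use FG c A0 in \<open>auto simp: mm weighted_coeff weighted_monom[OF S] closed\<close>)
    have "F \<in> ?A \<and> ?H (F * G) = ?H F \<otimes> ?H G"
    proof (induction F rule: poly_monom_induct)
      case (plus F F')
      then show ?case using FG A
        by (simp add: add distrib_right is_subringD[OF A] closed l_distr)
    qed (use FG 1 A0 in \<open>auto simp: weighted_coeff weighted_monom[OF S] closed\<close>)
    then show ?thesis ..
  qed
  have "?H 1 = \<one>"
    using monom[of 0 1] M g.hom_one by (simp add: graded_def monom_0 one_pCons is_subringD[OF S])
  then show "?H \<in> ring_hom (subset_ring ?A) R"
    by (intro ring_hom_memI) (auto simp: closed add mult)
qed

end

section \<open>Divided power monomials and digits in base \<open>p\<close>\<close>

context prime_nat
begin

text \<open>
  \<open>digit_monom stop a 0 m\<close> is the product of the \<open>a i ^ m\<^sub>i\<close> over the base \<open>p\<close> digits \<open>m\<^sub>i\<close> of \<open>m\<close>, except that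
  no digit is carried beyond an index where \<open>stop\<close> holds; \<open>digit_weight stop 0 m\<close> is the matching exponent of \<open>p\<close> in
  the denominator of \<open>x\<^sup>m\<close>. The cases used are \<open>stop i = False\<close> (the ring \<open>A\<close>), \<open>stop i = True\<close> (a polynomial ring)
  and \<open>stop i = (i \<ge> n)\<close> (the subring of \<open>A\<close> generated by \<open>u\<^sub>0, \<dots>, u\<^sub>n\<close>).
\<close>

function digit_weight :: "(nat \<Rightarrow> bool) \<Rightarrow> nat \<Rightarrow> nat \<Rightarrow> nat" where
  "digit_weight stop i m = (if stop i \<or> m = 0 then 0 else m div p + digit_weight stop (Suc i) (m div p))"
  by pat_completeness auto
termination
  by (relation "measure (\<lambda>(_, _, m). m)") (use p_gt_1 in auto)

declare digit_weight.simps [simp del]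

lemma digit_weight_0: "digit_weight stop i 0 = 0" and digit_weight_1: "digit_weight stop i (Suc 0) = 0"
  using p_gt_1 by (auto simp: digit_weight.simps[of _ _ 0] digit_weight.simps[of _ _ "Suc 0"])

text \<open>The geometric sum \<open>(p^n - 1) / (p - 1)\<close>: the exponent of \<open>p\<close>
  in the denominator of \<open>u_n\<close>, and also in the factorial of \<open>p^n\<close>.\<close>

definition uexp :: "nat \<Rightarrow> nat" where
  "uexp n = (\<Sum>j<n. p ^ j)"

lemma uexp_simps [simp]: "uexp 0 = 0" "uexp (Suc n) = p ^ n + uexp n"
  by (simp_all add: uexp_def)

lemma uexp_eq: "(p ^ n - 1) div (p - 1) = uexp n"
proof -
  obtain q where q: "p = Suc q" "q > 0" using p_gt_1 that[of "p - 1"] by auto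
  have "p ^ n = q * uexp n + 1"
  proof (induction n)
    case (Suc n)
    have "p ^ Suc n = q * p ^ n + p ^ n" using q(1) by (metis add.commute mult_Suc power_Suc)
    also have "\<dots> = q * uexp (Suc n) + 1" unfolding uexp_simps distrib_left using Suc by linarith
    finally show ?case .
  qed simp
  then show ?thesis using q by simp
qed

lemma u_gen_eq: "u_gen p n = Polynomial.monom (1 / of_nat p ^ uexp n) (p ^ n)"
  unfolding u_gen_def uexp_eq ..

text \<open>Without stops, \<open>digit_weight\<close> adds the integer parts of
  \<open>m / p^k\<close>, which is Legendre's formula for the exponent of \<open>p\<close> in
  \<open>m!\<close>. A stop at place \<open>n\<close> or later does not affect the number
  \<open>p ^ n\<close>.\<close>

lemma digit_weight_power: "(\<And>j. j < n \<Longrightarrow> \<not> stop (i + j)) \<Longrightarrow> digit_weight stop i (p ^ n) = uexp n"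
proof (induction n arbitrary: i)
  case (Suc n)
  have "digit_weight stop i (p ^ Suc n) = p ^ n + digit_weight stop (Suc i) (p ^ n)"
    using Suc(2)[of 0] p_gt_0 by (subst digit_weight.simps) simp
  also have "digit_weight stop (Suc i) (p ^ n) = uexp n" using Suc(2)[of "Suc _"] by (intro Suc(1)) simp
  finally show ?case by simp
qed (simp add: digit_weight_1)

end

context witt_base
begin

function digit_monom :: "(nat \<Rightarrow> bool) \<Rightarrow> (nat \<Rightarrow> 'u) \<Rightarrow> nat \<Rightarrow> nat \<Rightarrow> 'u" where
  "digit_monom stop a i m = (if stop i \<or> m = 0 then a i [^] m
     else a i [^] (m mod p) \<otimes> digit_monom stop a (Suc i) (m div p))"
  by pat_completeness auto
termination
  by (relation "measure (\<lambda>(_, _, _, m). m)") (use p_gt_1 in auto)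

declare digit_monom.simps [simp del]

text \<open>The relations \<open>u_i^p = p u_(i+1)\<close> between the generators of
  \<open>A\<close>; none is imposed at a stop.\<close>

definition divided_powers :: "(nat \<Rightarrow> bool) \<Rightarrow> (nat \<Rightarrow> 'u) \<Rightarrow> bool" where
  "divided_powers stop a \<longleftrightarrow> (\<forall>i. a i \<in> carrier R) \<and>
     (\<forall>i. \<not> stop i \<longrightarrow> a i [^] p = ([int p] \<cdot> \<one>) \<otimes> a (Suc i))"

lemma digit_monom_closed:
  assumes "\<And>i. a i \<in> carrier R"
  shows "digit_monom stop a i m \<in> carrier R"
proof (induction m arbitrary: i rule: less_induct)
  case (less m)
  then show ?case using assms p_gt_1 by (subst digit_monom.simps) auto
qed

lemma digit_monom_0: "digit_monom stop a i 0 = \<one>"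
  by (simp add: digit_monom.simps)

lemma digit_monom_1: "(\<And>i. a i \<in> carrier R) \<Longrightarrow> digit_monom stop a i (Suc 0) = a i"
  using p_gt_1 by (simp add: digit_monom.simps[of _ _ _ "Suc 0"] digit_monom_0)

text \<open>\<open>p ^ n\<close> has a single nonzero digit, a \<open>1\<close> at place
  \<open>n\<close>.\<close>

lemma digit_monom_power:
  assumes a: "\<And>i. a i \<in> carrier R"
  shows "(\<And>j. j < n \<Longrightarrow> \<not> stop (i + j)) \<Longrightarrow> digit_monom stop a i (p ^ n) = a (i + n)"
proof (induction n arbitrary: i)
  case (Suc n)
  have "digit_monom stop a i (p ^ Suc n) = digit_monom stop a (Suc i) (p ^ n)"
    using Suc(2)[of 0] p_gt_0 by (subst digit_monom.simps) (simp add: digit_monom_closed[OF a])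
  also have "\<dots> = a (Suc i + n)" using Suc(2)[of "Suc _"] by (intro Suc(1)) simp
  finally show ?case by simp
qed (simp add: digit_monom_1[OF a])

text \<open>This is addition with carries in base \<open>p\<close>. A carry at place
  \<open>i\<close> replaces \<open>a i [^] p\<close> by \<open>p\<close> times
  \<open>a (Suc i)\<close> and raises the weight of the sum by one, so a single \<open>c\<close>
  counts both.\<close>

lemma digit_monom_mult:
  assumes dp: "divided_powers stop a"
  shows "\<exists>c. digit_weight stop i (m + k) = digit_weight stop i m + digit_weight stop i k + c \<and>
    digit_monom stop a i m \<otimes> digit_monom stop a i k = ([int p] \<cdot> \<one>) [^] c \<otimes> digit_monom stop a i (m + k)"
proof (induction "m + k" arbitrary: i m k rule: less_induct)
  case less
  let ?P = "[int p] \<cdot> \<one>" and ?D = "digit_monom stop a" and ?v = "digit_weight stop"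
  have a [simp]: "\<And>i. a i \<in> carrier R" using dp by (simp add: divided_powers_def)
  note [simp] = digit_monom_closed[OF a]
  consider "stop i" | "m = 0" | "k = 0" | "\<not> stop i" "m > 0" "k > 0" by blast
  then show ?case
  proof cases
    case 1
    then show ?thesis
      by (intro exI[of _ 0]) (simp add: digit_monom.simps[of stop a i] digit_weight.simps[of stop i] nat_pow_mult)
  next
    case 4
    define m0 m' k0 k' where "m0 = m mod p" and "m' = m div p" and "k0 = k mod p" and "k' = k div p"
    have small: "m0 < p" "k0 < p" using p_gt_0 by (auto simp: m0_def k0_def)
    have mk: "m = m0 + p * m'" "k = k0 + p * k'" by (simp_all add: m0_def m'_def k0_def k'_def)
    have Dm: "?D i m = a i [^] m0 \<otimes> ?D (Suc i) m'" "?D i k = a i [^] k0 \<otimes> ?D (Suc i) k'"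
      "?v i m = m' + ?v (Suc i) m'" "?v i k = k' + ?v (Suc i) k'"
      using 4 by (simp_all add: digit_monom.simps[of stop a i] digit_weight.simps[of stop i] m0_def m'_def k0_def k'_def)
    \<comment> \<open>Dropping the last digits at least halves the sum, which leaves room for the
      induction hypothesis even after a carry adds one.\<close>
    have "2 * (m' + k') \<le> p * (m' + k')" using p_ge_2 by (intro mult_right_mono) auto
    then have le: "2 * (m' + k') + m0 + k0 \<le> m + k" unfolding mk by (simp add: algebra_simps)
    then have lt: "m' + k' < m + k" using 4 by arith
    obtain c where c: "?v (Suc i) (m' + k') = ?v (Suc i) m' + ?v (Suc i) k' + c"
      "?D (Suc i) m' \<otimes> ?D (Suc i) k' = ?P [^] c \<otimes> ?D (Suc i) (m' + k')"
      using less[OF lt] by blast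
    have prod: "?D i m \<otimes> ?D i k = a i [^] (m0 + k0) \<otimes> (?P [^] c \<otimes> ?D (Suc i) (m' + k'))"
      by (simp add: Dm c(2)[symmetric] nat_pow_mult[symmetric] m_ac)
    show ?thesis
    proof (cases "m0 + k0 < p")
      case True
      have "m + k = m0 + k0 + p * (m' + k')" unfolding mk by (simp add: algebra_simps)
      then have dm: "(m + k) div p = m' + k'" "(m + k) mod p = m0 + k0"
        using True p_gt_0 by simp_all
      then have v: "?v i (m + k) = m' + k' + ?v (Suc i) (m' + k')" and
        "?D i (m + k) = a i [^] (m0 + k0) \<otimes> ?D (Suc i) (m' + k')"
        using 4 dm by (simp_all add: digit_monom.simps[of stop a i] digit_weight.simps[of stop i])
      then have "?D i m \<otimes> ?D i k = ?P [^] c \<otimes> ?D i (m + k)"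
        unfolding prod by (simp add: m_lcomm)
      with v show ?thesis
        by (intro exI[of _ c]) (simp add: Dm c(1))
    next
      case False
      define r where "r = m0 + k0 - p"
      have r: "m0 + k0 = r + p" "r < p" using False small by (auto simp: r_def)
      have "m + k = r + p * Suc (m' + k')" unfolding mk using r by (simp add: algebra_simps)
      then have dm: "(m + k) div p = Suc (m' + k')" "(m + k) mod p = r"
        using r(2) p_gt_0 by (simp_all del: mult_Suc_right)
      \<comment> \<open>The induction hypothesis is used a second time to add the carry
        \<open>1\<close> to \<open>m' + k'\<close>, which may cause further carries, counted by
        \<open>d\<close>.\<close>
      have "m' + k' + Suc 0 < m + k" using le r p_ge_2 by arith
      from less[OF this, of "Suc i"] obtain d where d:
        "?v (Suc i) (Suc (m' + k')) = ?v (Suc i) (m' + k') + d"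
        "?D (Suc i) (m' + k') \<otimes> a (Suc i) = ?P [^] d \<otimes> ?D (Suc i) (Suc (m' + k'))"
        by (auto simp: digit_weight_1 digit_monom_1)
      have v: "?v i (m + k) = Suc (m' + k') + ?v (Suc i) (Suc (m' + k'))"
        "?D i (m + k) = a i [^] r \<otimes> ?D (Suc i) (Suc (m' + k'))"
        using 4 dm by (simp_all add: digit_monom.simps[of stop a i] digit_weight.simps[of stop i])
      have "a i [^] (m0 + k0) = a i [^] r \<otimes> (?P \<otimes> a (Suc i))"
        using dp 4 by (simp add: r(1) nat_pow_mult[symmetric] divided_powers_def)
      then have "?D i m \<otimes> ?D i k = (?P \<otimes> ?P [^] c) \<otimes> (a i [^] r \<otimes> (?D (Suc i) (m' + k') \<otimes> a (Suc i)))"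
        by (simp add: prod m_ac)
      also have "\<dots> = (?P \<otimes> ?P [^] c \<otimes> ?P [^] d) \<otimes> ?D i (m + k)"
        by (simp add: d(2) v m_ac)
      also have "?P \<otimes> ?P [^] c \<otimes> ?P [^] d = ?P [^] (Suc c + d)"
        by (simp add: nat_pow_mult[symmetric] m_ac)
      finally show ?thesis
        by (intro exI[of _ "Suc c + d"]) (simp add: v Dm c d)
    qed
  qed (auto intro!: exI[of _ 0] simp: digit_weight_0 digit_monom_0)
qed

lemma graded_dmon: "divided_powers stop a \<Longrightarrow> graded p (digit_weight stop i) (digit_monom stop a i)"
  using digit_monom_mult by (auto simp: graded_def digit_weight_0 digit_monom_0 digit_monom_closed divided_powers_def)

text \<open>The element \<open>x\<close> stands for \<open>1 / p ^ uexp n\<close>, so that one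
  statement serves coefficients in \<open>rat\<close> and in \<open>rat poly\<close>; the monomial
  in question is then \<open>u_n\<close>.\<close>

lemma divided_hom_exists:
  fixes S :: "'a::comm_ring_1 set"
  assumes S: "is_subring S" and g: "g \<in> ring_hom (subset_ring S) R" and a: "divided_powers stop a"
  obtains B k where "is_subring B" "k \<in> ring_hom (subset_ring B) R"
    "\<And>c. c \<in> S \<Longrightarrow> [:c:] \<in> B" "\<And>c. c \<in> S \<Longrightarrow> k [:c:] = g c"
    "\<And>x n. (\<And>i. i < n \<Longrightarrow> \<not> stop i) \<Longrightarrow> of_nat p ^ uexp n * x = 1 \<Longrightarrow> Polynomial.monom x (p ^ n) \<in> B"
    "\<And>x n. (\<And>i. i < n \<Longrightarrow> \<not> stop i) \<Longrightarrow> of_nat p ^ uexp n * x = 1 \<Longrightarrow> k (Polynomial.monom x (p ^ n)) = a n"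
proof (rule that)
  let ?v = "digit_weight stop 0" and ?M = "digit_monom stop a 0"
  let ?B = "weighted p ?v S" and ?k = "poly_ext p ?v g ?M"
  have ac: "\<And>i. a i \<in> carrier R" using a by (simp add: divided_powers_def)
  have gr: "graded p ?v ?M" by (rule graded_dmon[OF a])
  show "is_subring ?B" by (rule is_subring_weighted_graded[OF S gr])
  show "?k \<in> ring_hom (subset_ring ?B) R" by (rule poly_ext_hom[OF S g gr])
  show "[:c:] \<in> ?B" if "c \<in> S" for c
    using weighted_monom[OF S, of p ?v 0 c] that by (simp add: digit_weight_0 monom_0)
  show "?k [:c:] = g c" if "c \<in> S" for c
    using poly_ext_hom(2)[OF S g gr, of 0 c] that ring_hom_closed[OF g, of c] by (simp add: digit_weight_0 digit_monom_0 monom_0)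
  fix x n assume n: "\<And>i. i < n \<Longrightarrow> \<not> stop i" and x: "of_nat p ^ uexp n * x = (1 :: 'a)"
  then have v: "?v (p ^ n) = uexp n" by (intro digit_weight_power) auto
  show "Polynomial.monom x (p ^ n) \<in> ?B"
    by (rule weighted_monom[OF S]) (simp add: v x is_subringD[OF S])
  show "?k (Polynomial.monom x (p ^ n)) = a n"
    using poly_ext_hom(2)[OF S g gr, of "p ^ n" x] n ring_hom_one[OF g] digit_monom_power[OF ac, of n stop 0]
    by (simp add: v x is_subringD[OF S] ac)
qed

text \<open>On \<open>\<int>\<close> the floor merely converts an integral rational to type
  \<open>int\<close>.\<close>

lemma floor_hom: "(\<lambda>q::rat. [\<lfloor>q\<rfloor>] \<cdot> \<one>) \<in> ring_hom (subset_ring \<int>) R"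
proof (rule ring_hom_memI)
  fix x y :: rat assume "x \<in> carrier (subset_ring \<int>)" "y \<in> carrier (subset_ring \<int>)"
  then obtain i j where xy: "x = of_int i" "y = of_int j" by (auto elim!: Ints_cases)
  then have "x * y = of_int (i * j)" "x + y = of_int (i + j)" by simp_all
  then show "[\<lfloor>x \<otimes>\<^bsub>subset_ring \<int>\<^esub> y\<rfloor>] \<cdot> \<one> = ([\<lfloor>x\<rfloor>] \<cdot> \<one>) \<otimes> ([\<lfloor>y\<rfloor>] \<cdot> \<one>)"
    "[\<lfloor>x \<oplus>\<^bsub>subset_ring \<int>\<^esub> y\<rfloor>] \<cdot> \<one> = ([\<lfloor>x\<rfloor>] \<cdot> \<one>) \<oplus> ([\<lfloor>y\<rfloor>] \<cdot> \<one>)"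
    using ring_hom_mult[OF add_pow_int_hom, of i j] ring_hom_add[OF add_pow_int_hom, of i j]
    by (simp_all only: subset_ring_simps floor_of_int xy UNIV_I)
qed auto

end

lemma is_subring_Ints: "is_subring (\<int> :: rat set)"
  by (auto simp: is_subring_def)

section \<open>Generated subrings\<close>

definition gen :: "'a::comm_ring_1 set \<Rightarrow> 'a set" where
  "gen H = generate_ring (subset_ring UNIV) H"

lemma subring_gen_eq: "subring_gen H = subset_ring (gen H)"
  by (simp add: subring_gen_def gen_def)

lemma is_subring_gen: "is_subring (gen H)"
proof -
  have "x - y \<in> gen H" if "x \<in> gen H" "y \<in> gen H" for x y
    using generate_ring.eng_add[OF that(1)[unfolded gen_def] generate_ring.a_inv[OF that(2)[unfolded gen_def]]]
    by (simp add: gen_def)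
  moreover have "x * y \<in> gen H" if "x \<in> gen H" "y \<in> gen H" for x y
    using generate_ring.eng_mult[OF that[unfolded gen_def]] by (simp add: gen_def)
  moreover have "1 \<in> gen H"
    using generate_ring.one[of "subset_ring UNIV :: 'a ring" H] by (simp add: gen_def)
  ultimately show ?thesis by (simp add: is_subring_def)
qed

lemma gen_incl: "x \<in> H \<Longrightarrow> x \<in> gen H"
  by (simp add: gen_def generate_ring.incl)

lemma gen_induct [consumes 1, case_names one incl uminus add mult]:
  assumes "x \<in> gen H" "P 1" "\<And>h. h \<in> H \<Longrightarrow> P h" "\<And>h. h \<in> gen H \<Longrightarrow> P h \<Longrightarrow> P (- h)"
    "\<And>h k. h \<in> gen H \<Longrightarrow> k \<in> gen H \<Longrightarrow> P h \<Longrightarrow> P k \<Longrightarrow> P (h + k)"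
    "\<And>h k. h \<in> gen H \<Longrightarrow> k \<in> gen H \<Longrightarrow> P h \<Longrightarrow> P k \<Longrightarrow> P (h * k)"
  shows "P x"
  using assms(1)[unfolded gen_def]
  by (induction rule: generate_ring.induct) (use assms(2-) in \<open>auto simp: gen_def\<close>)

lemma gen_least:
  assumes "is_subring B" "H \<subseteq> B"
  shows "gen H \<subseteq> B"
proof
  fix x assume "x \<in> gen H"
  then show "x \<in> B"
    by (induction rule: gen_induct) (use assms in \<open>auto simp: is_subringD[OF assms(1)]\<close>)
qed

lemma ring_hom_gen_eq:
  assumes "cring R" "f \<in> ring_hom (subset_ring (gen H)) R" "g \<in> ring_hom (subset_ring (gen H)) R"
    and "\<And>x. x \<in> H \<Longrightarrow> f x = g x" and "x \<in> gen H"
  shows "f x = g x"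
proof -
  interpret R: cring R by fact
  interpret G: cring "subset_ring (gen H)" by (rule cring_subset_ring[OF is_subring_gen])
  interpret f: ring_hom_cring "subset_ring (gen H)" R f by (intro ring_hom_cringI assms G.is_cring)
  interpret g: ring_hom_cring "subset_ring (gen H)" R g by (intro ring_hom_cringI assms G.is_cring)
  show ?thesis using assms(5)
  proof (induction rule: gen_induct)
    case (uminus h)
    then show ?case using f.hom_a_inv[of h] g.hom_a_inv[of h] by (simp add: is_subring_gen)
  next
    case (add h k)
    then show ?case using f.hom_add[of h k] g.hom_add[of h k] by simp
  next
    case (mult h k)
    then show ?case using f.hom_mult[of h k] g.hom_mult[of h k] by simp
  qed (use assms(4) f.hom_one g.hom_one in auto)
qed

lemma Spec_points_gen_eqI:
  assumes "cring R" "f \<in> Spec_points (subring_gen H) R" "g \<in> Spec_points (subring_gen H) R"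
    and "\<And>x. x \<in> H \<Longrightarrow> f x = g x"
  shows "f = g"
proof
  fix x
  show "f x = g x"
  proof (cases "x \<in> gen H")
    case True
    then show ?thesis
      using ring_hom_gen_eq[OF assms(1) _ _ assms(4)] assms(2,3) by (auto simp: Spec_points_def subring_gen_eq)
  next
    case False
    then show ?thesis using assms(2,3) by (auto simp: Spec_points_def subring_gen_eq extensional_def)
  qed
qed

lemma restrict_Spec_points:
  assumes "is_subring B" "A \<subseteq> B" "is_subring A" "k \<in> ring_hom (subset_ring B) R"
  shows "restrict k A \<in> Spec_points (subset_ring A) R"
  unfolding Spec_points_def
proof
  show "restrict k A \<in> ring_hom (subset_ring A) R"
    using assms(2) ring_hom_closed[OF assms(4)] ring_hom_mult[OF assms(4)] ring_hom_add[OF assms(4)]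
      ring_hom_one[OF assms(4)]
    by (intro ring_hom_memI) (auto simp: is_subringD[OF assms(3)] subset_iff)
qed simp

lemma Spec_points_hom: "g \<in> Spec_points A R \<Longrightarrow> g \<in> ring_hom A R"
  by (simp add: Spec_points_def)

definition rhom :: "('a::comm_ring_1 \<Rightarrow> 'b::comm_ring_1) \<Rightarrow> bool" where
  "rhom f \<longleftrightarrow> f 1 = 1 \<and> (\<forall>x y. f (x + y) = f x + f y) \<and> (\<forall>x y. f (x * y) = f x * f y)"

lemma rhomD:
  assumes "rhom f"
  shows "f 1 = 1" "f 0 = 0" "f (x + y) = f x + f y" "f (x * y) = f x * f y" "f (- x) = - f x"
    "f (x - y) = f x - f y" "f (x ^ n) = f x ^ n" "f (of_nat m) = of_nat m" "f (of_int i) = of_int i"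
    "f (sum h I) = (\<Sum>i\<in>I. f (h i))"
proof -
  have f: "f 1 = 1" "\<And>x y. f (x + y) = f x + f y" "\<And>x y. f (x * y) = f x * f y"
    using assms by (auto simp: rhom_def)
  then show "f 1 = 1" "f (x + y) = f x + f y" "f (x * y) = f x * f y" by auto
  show zero: "f 0 = 0" using f(2)[of 0 0] by simp
  show uminus: "f (- x) = - f x" for x using f(2)[of x "- x"] zero by (simp add: add_eq_0_iff)
  show "f (x - y) = f x - f y" using f(2)[of x "- y"] uminus by simp
  show "f (x ^ n) = f x ^ n" by (induction n) (auto simp: f)
  show nat: "f (of_nat m) = of_nat m" for m by (induction m) (auto simp: f zero)
  show "f (of_int i) = of_int i" by (cases i rule: int_cases2) (auto simp: nat uminus)
  show "f (sum h I) = (\<Sum>i\<in>I. f (h i))" by (induction I rule: infinite_finite_induct) (auto simp: f zero)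
qed

lemma ghost_rhom: "rhom f \<Longrightarrow> ghost p n (\<lambda>i. f (X i)) = f (ghost p n X)"
  by (simp add: ghost_def rhomD)

lemma rhom_gen:
  assumes f: "rhom f" and B: "is_subring B" "\<And>x. x \<in> H \<Longrightarrow> f x \<in> B"
  shows "f \<in> ring_hom (subset_ring (gen H)) (subset_ring B)"
proof (rule ring_hom_memI)
  fix x assume "x \<in> carrier (subset_ring (gen H))"
  then have "x \<in> gen H" by simp
  then show "f x \<in> carrier (subset_ring B)"
    by (induction rule: gen_induct) (use B(2) in \<open>auto simp: rhomD[OF f] is_subringD[OF B(1)]\<close>)
qed (auto simp: rhomD[OF f])

section \<open>The coordinate ring of the additive divided power group\<close>

lemma rhom_in_x: "rhom in_x"
  by (simp add: rhom_def in_x_def one_pCons)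

lemma subst_xy_pCons: "subst_xy (pCons a f) g = [:[:a:]:] + g * subst_xy f g"
  by (simp add: subst_xy_def map_poly_pCons)

lemma subst_xy_0: "subst_xy 0 g = 0"
  by (simp add: subst_xy_def)

lemma subst_xy_add: "subst_xy (f + f') g = subst_xy f g + subst_xy f' g"
  by (induction f f' rule: poly_induct2) (simp_all add: subst_xy_pCons subst_xy_0 algebra_simps)

lemma rhom_subst_xy: "rhom (\<lambda>f. subst_xy f g)"
proof -
  have const: "subst_xy (smult a f) g = [:[:a:]:] * subst_xy f g" for a f
    by (induction f) (simp_all add: subst_xy_pCons subst_xy_0 algebra_simps)
  have "subst_xy (f * f') g = subst_xy f g * subst_xy f' g" for f f'
    by (induction f) (simp_all add: subst_xy_pCons subst_xy_0 subst_xy_add const algebra_simps)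
  moreover have "subst_xy 1 g = 1" by (simp add: one_pCons subst_xy_pCons subst_xy_0)
  ultimately show ?thesis by (simp add: rhom_def subst_xy_add)
qed

lemma rhom_comult: "rhom comult" and rhom_coact: "rhom coact" and rhom_in_y: "rhom in_y"
  using rhom_subst_xy by (auto simp: comult_def[abs_def] coact_def[abs_def] in_y_def[abs_def])

lemma subst_xy_monom: "subst_xy (Polynomial.monom c n) g = [:[:c:]:] * g ^ n"
  by (induction n) (simp_all add: monom_0 monom_Suc subst_xy_pCons subst_xy_0 algebra_simps)

lemma subst_xy_x: "subst_xy [:0, 1:] g = g"
proof -
  have "[:0, 1 :: rat:] = Polynomial.monom 1 1" "[:[:1 :: rat:]:] = 1"
    by (simp_all add: monom_Suc monom_0 one_pCons)
  then show ?thesis by (simp only: subst_xy_monom) simp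
qed

lemma in_y_monom: "in_y (Polynomial.monom c n) = Polynomial.monom [:c:] n"
proof -
  have "var_y = Polynomial.monom 1 1" by (simp add: var_y_def monom_Suc monom_0 one_pCons)
  then have "var_y ^ n = Polynomial.monom 1 n" unfolding \<open>var_y = _\<close> monom_power by simp
  then show ?thesis by (simp add: in_y_def subst_xy_monom smult_monom)
qed

lemma monom_sum_coeff: "(\<Sum>i\<in>I. Polynomial.monom (f i) n) = Polynomial.monom (\<Sum>i\<in>I. f i) n"
  by (induction I rule: infinite_finite_induct) (simp_all add: add_monom)

lemma of_nat_mult_monom: "of_nat m * Polynomial.monom c n = Polynomial.monom (of_nat m * c) n"
  by (simp add: of_nat_poly smult_monom)

lemma of_int_mult_monom: "of_int m * Polynomial.monom c n = Polynomial.monom (of_int m * c) n"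
  by (simp add: of_int_poly smult_monom)

context prime_nat
begin

text \<open>
  The Witt vector over \<open>\<rat>[x]\<close> with ghost components \<open>(x, 0, 0, \<dots>)\<close> has components
  \<open>wcoef n * u_gen p n\<close>.
\<close>

function wcoef :: "nat \<Rightarrow> int" where
  "wcoef n = (if n = 0 then 1
     else - (\<Sum>i\<in>{..<n}. wcoef i ^ (p ^ (n - i)) * int p ^ (uexp (n - i) - (n - i))))"
  by pat_completeness auto
termination by (relation "measure id") auto

declare wcoef.simps [simp del]

lemma wcoef_0: "wcoef 0 = 1"
  by (simp add: wcoef.simps)

text \<open>Keeps the natural number subtraction in the exponents of \<open>wcoef\<close>
  honest.\<close>

lemma uexp_ge: "n \<le> uexp n"
proof (induction n)
  case (Suc n)
  moreover have "1 \<le> p ^ n" using p_gt_0 by simp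
  ultimately show ?case unfolding uexp_simps by linarith
qed simp

lemma uexp_gt: "n \<ge> 2 \<Longrightarrow> n < uexp n"
proof (induction n)
  case (Suc n)
  have "1 \<le> p ^ n" using p_gt_0 by simp
  moreover have "1 < p ^ n" if "n \<ge> 1" using that p_gt_1 by (intro one_less_power) auto
  ultimately show ?case using Suc uexp_ge[of n] by (cases "n \<ge> 2") auto
qed simp

lemma uexp_add: "uexp (i + k) = uexp i * p ^ k + uexp k"
  by (induction i) (simp_all add: algebra_simps power_add)

text \<open>This is the vanishing of the \<open>n\<close>-th ghost component of
  \<open>wcoef i * u i\<close>, divided by the common factor \<open>p^n / p^(uexp n)\<close> and by
  the power of \<open>x\<close>; the exponents match by \<open>uexp_add\<close>.\<close>

lemma wcoef_sum:
  assumes "n > 0"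
  shows "(\<Sum>i\<le>n. wcoef i ^ (p ^ (n - i)) * int p ^ (uexp (n - i) - (n - i))) = 0"
  unfolding lessThan_Suc_atMost[symmetric] using assms by (simp add: wcoef.simps[of n])

text \<open>The exponent \<open>uexp k - k\<close> is zero for \<open>k = 0, 1\<close> and positive
  from \<open>k = 2\<close> on. Modulo \<open>p\<close> only two terms of the recursion survive, and
  \<open>wcoef (Suc n)\<close> is congruent to \<open>- wcoef n ^ p\<close>.\<close>

lemma wcoef_not_dvd: "\<not> int p dvd wcoef n"
proof (induction n)
  case 0
  then show ?case using p_gt_1 by (simp add: wcoef_0)
next
  case (Suc n)
  have pr: "prime (int p)" using prime_p by simp
  have "int p dvd (\<Sum>i<n. wcoef i ^ (p ^ (Suc n - i)) * int p ^ (uexp (Suc n - i) - (Suc n - i)))"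
  proof (rule dvd_sum)
    fix i assume "i \<in> {..<n}"
    then have "Suc n - i \<ge> 2" by auto
    from uexp_gt[OF this] have "uexp (Suc n - i) - (Suc n - i) > 0" by linarith
    then show "int p dvd wcoef i ^ (p ^ (Suc n - i)) * int p ^ (uexp (Suc n - i) - (Suc n - i))"
      by (intro dvd_mult) (simp add: dvd_power)
  qed
  moreover have "wcoef n ^ p = - wcoef (Suc n)
      - (\<Sum>i<n. wcoef i ^ (p ^ (Suc n - i)) * int p ^ (uexp (Suc n - i) - (Suc n - i)))"
    by (subst wcoef.simps[of "Suc n"]) simp
  ultimately have "int p dvd wcoef n ^ p" if "int p dvd wcoef (Suc n)"
    using dvd_diff[OF that[folded dvd_minus_iff[of "int p" "wcoef (Suc n)"]]] by simp
  then show ?case using Suc pr prime_dvd_power by blast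
qed

lemma wcoef_bezout: "\<exists>s t. s * wcoef n + t * int p = 1"
proof -
  have "prime (int p)" using prime_p by simp
  then have "coprime (int p) (wcoef n)" using wcoef_not_dvd by (simp add: prime_imp_coprime)
  then have "gcd (wcoef n) (int p) = 1" by (simp add: coprime_iff_gcd_eq_1 gcd.commute)
  then show ?thesis using bezout_int[of "wcoef n" "int p"] by auto
qed

text \<open>The coefficients by which \<open>u n\<close> is recovered from
  \<open>wcoef n * u n\<close> and \<open>p * u n\<close>.\<close>

definition bez_s :: "nat \<Rightarrow> int" where "bez_s n = (SOME s. \<exists>t. s * wcoef n + t * int p = 1)"
definition bez_t :: "nat \<Rightarrow> int" where "bez_t n = (SOME t. bez_s n * wcoef n + t * int p = 1)"

lemma bezout_wcoef: "bez_s n * wcoef n + bez_t n * int p = 1"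
  unfolding bez_t_def by (rule someI_ex) (unfold bez_s_def, rule someI_ex, rule wcoef_bezout)

abbreviation u where "u \<equiv> u_gen p"

definition y :: "nat \<Rightarrow> rat poly" where
  "y n = of_int (wcoef n) * u n"

lemma y_eq: "y n = Polynomial.monom (of_int (wcoef n) / of_nat p ^ uexp n) (p ^ n)"
  by (simp add: y_def u_gen_eq of_int_mult_monom)

lemma u_0: "u 0 = [:0, 1:]" and y_0: "y 0 = [:0, 1:]"
  by (simp_all add: u_gen_eq y_eq wcoef_0 monom_0 monom_Suc)

text \<open>The \<open>p\<close>-th power has denominator exponent \<open>uexp n * p\<close>, one
  less than \<open>uexp (Suc n)\<close>.\<close>

lemma u_power: "u n ^ p = of_nat p * u (Suc n)"
proof -
  have "uexp (Suc n) = Suc (uexp n * p)" using uexp_add[of n 1] by simp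
  then show ?thesis
    using p_gt_0 unfolding u_gen_eq monom_power of_nat_mult_monom
    by (simp del: uexp_simps add: power_divide mult.commute flip: power_mult)
qed

lemma u_Suc: "u (Suc n) = of_int (bez_s (Suc n)) * y (Suc n) + of_int (bez_t (Suc n)) * u n ^ p"
proof -
  have "of_int (bez_s (Suc n)) * y (Suc n) + of_int (bez_t (Suc n)) * u n ^ p =
    of_int (bez_s (Suc n) * wcoef (Suc n) + bez_t (Suc n) * int p) * u (Suc n)"
    by (simp add: y_def u_power algebra_simps)
  then show ?thesis by (simp add: bezout_wcoef)
qed

lemma ghost_y: "ghost p n y = (if n = 0 then [:0, 1:] else 0)"
proof (cases "n = 0")
  case False
  have summand: "of_nat p ^ i * y i ^ (p ^ (n - i)) = Polynomial.monom (of_nat p ^ n / of_nat p ^ uexp n *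
      of_int (wcoef i ^ (p ^ (n - i)) * int p ^ (uexp (n - i) - (n - i)))) (p ^ n)" if "i \<le> n" for i
  proof -
    have pp: "(of_nat p :: rat) \<noteq> 0" using p_gt_0 by simp
    have e: "uexp n = uexp i * p ^ (n - i) + uexp (n - i)" using uexp_add[of i "n - i"] that by simp
    have "uexp (n - i) = (uexp (n - i) - (n - i)) + (n - i)" using uexp_ge[of "n - i"] by simp
    then have e2: "(of_nat p :: rat) ^ uexp (n - i) = of_nat p ^ (uexp (n - i) - (n - i)) * of_nat p ^ (n - i)"
      by (metis power_add)
    have n: "(of_nat p :: rat) ^ n = of_nat p ^ i * of_nat p ^ (n - i)" using that by (simp flip: power_add)
    have "of_nat p ^ i * y i ^ (p ^ (n - i)) = Polynomial.monom (of_nat p ^ i * 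
        (of_int (wcoef i) ^ (p ^ (n - i)) / of_nat p ^ (uexp i * p ^ (n - i)))) (p ^ n)"
      using that of_nat_mult_monom[of "p ^ i", where 'a = rat]
      by (simp add: y_eq monom_power power_divide flip: power_mult power_add)
    also have "of_nat p ^ i * (of_int (wcoef i) ^ (p ^ (n - i)) / of_nat p ^ (uexp i * p ^ (n - i)))
      = of_nat p ^ n / of_nat p ^ uexp n * (of_int (wcoef i ^ (p ^ (n - i)) * int p ^ (uexp (n - i) - (n - i))) :: rat)"
      using pp unfolding e power_add e2 n by (simp add: field_simps)
    finally show ?thesis .
  qed
  have "ghost p n y = Polynomial.monom (of_nat p ^ n / of_nat p ^ uexp n *
      of_int (\<Sum>i\<le>n. wcoef i ^ (p ^ (n - i)) * int p ^ (uexp (n - i) - (n - i)))) (p ^ n)"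
    unfolding ghost_def of_int_sum sum_distrib_left monom_sum_coeff[symmetric]
    by (rule sum.cong) (auto simp: summand)
  then show ?thesis using False unfolding wcoef_sum[of n, OF False[unfolded neq0_conv]] by simp
qed (simp add: y_0)

definition A :: "rat poly set" where "A = gen (range u)"

lemma GA_ring_eq: "GA_ring p = subset_ring A"
  by (simp add: GA_ring_def subring_gen_eq A_def)

lemma is_subring_A: "is_subring A"
  by (simp add: A_def is_subring_gen)

lemma u_in_A: "u n \<in> A" and y_in_A: "y n \<in> A"
proof -
  show "u n \<in> A" by (simp add: A_def gen_incl)
  then show "y n \<in> A" by (simp add: y_def is_subringD[OF is_subring_A] is_subring_of_int[OF is_subring_A])
qed

text \<open>Bezout recovers \<open>u (Suc n)\<close> from \<open>y (Suc n)\<close> and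
  \<open>u n ^ p\<close>. On the generators \<open>y\<close>, unlike \<open>u\<close>,
  comultiplication and coaction are Witt vector formulas.\<close>

lemma A_eq_gen_y: "A = gen (range y)"
proof
  have "u n \<in> gen (range y)" for n
  proof (induction n)
    case 0
    have "y 0 \<in> gen (range y)" by (rule gen_incl) simp
    then show ?case by (simp add: u_0 y_0)
  next
    case (Suc n)
    then show ?case unfolding u_Suc 
      by (simp add: is_subringD[OF is_subring_gen] is_subring_of_int[OF is_subring_gen] gen_incl)
  qed
  then show "A \<subseteq> gen (range y)"
    unfolding A_def by (intro gen_least is_subring_gen) auto
  show "gen (range y) \<subseteq> A"
    by (intro gen_least is_subring_A) (auto simp: y_in_A)
qed

definition AA :: "rat poly poly set" where "AA = gen (in_x ` A \<union> in_y ` A)"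
definition AT :: "rat poly poly set" where "AT = gen (insert var_y (in_x ` A))"

lemma A_tensor_eq: "A_tensor_A p = subset_ring AA" "A_tensor_Zt p = subset_ring AT"
  by (simp_all add: A_tensor_A_def A_tensor_Zt_def subring_gen_eq AA_def AT_def GA_ring_eq)

lemma is_subring_AA: "is_subring AA" and is_subring_AT: "is_subring AT"
  by (simp_all add: AA_def AT_def is_subring_gen)

text \<open>Both vectors have ghost components \<open>(x + var_y, 0, 0, ...)\<close>.\<close>

lemma comult_y: "(\<lambda>n. comult (y n)) = wadd (\<lambda>n. in_x (y n)) (\<lambda>n. in_y (y n))"
proof (rule ghost_inj[OF p_gt_0])
  fix n
  have "in_y [:0, 1:] = var_y" "comult [:0, 1:] = in_x [:0, 1:] + var_y"
    by (simp_all add: in_y_def comult_def subst_xy_x)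
  then show "ghost p n (\<lambda>n. comult (y n)) = ghost p n (wadd (\<lambda>n. in_x (y n)) (\<lambda>n. in_y (y n)))"
    by (simp add: ghost_wadd ghost_rhom rhom_in_x rhom_in_y rhom_comult ghost_y rhomD(2))
qed

text \<open>The powers of \<open>var_y\<close> multiply ghost components that vanish beyond index
  \<open>0\<close>, so both sides have ghost components \<open>(x var_y, 0, 0, ...)\<close>.\<close>

lemma coact_y: "(\<lambda>n. coact (y n)) = tscale var_y (\<lambda>n. in_x (y n))"
proof (rule ghost_inj[OF p_gt_0])
  fix n
  have "coact [:0, 1:] = in_x [:0, 1:] * var_y"
    by (simp add: coact_def subst_xy_x)
  then show "ghost p n (\<lambda>n. coact (y n)) = ghost p n (tscale var_y (\<lambda>n. in_x (y n)))"
    by (simp add: ghost_tscale ghost_rhom rhom_in_x rhom_coact ghost_y rhomD(2))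
qed

lemma in_x_AA: "c \<in> A \<Longrightarrow> in_x c \<in> AA" and in_y_AA: "c \<in> A \<Longrightarrow> in_y c \<in> AA"
  and in_x_AT: "c \<in> A \<Longrightarrow> in_x c \<in> AT" and var_y_AT: "var_y \<in> AT"
  by (auto simp: AA_def AT_def intro: gen_incl)

text \<open>On \<open>u n\<close> this would be a divisibility statement about binomial
  coefficients. On \<open>y n\<close> the value is an integer polynomial, the Witt addition
  polynomial, in elements of \<open>AA\<close>.\<close>

lemma comult_hom: "comult \<in> ring_hom (subset_ring A) (subset_ring AA)"
  unfolding A_eq_gen_y
proof (rule rhom_gen[OF rhom_comult is_subring_AA])
  fix x assume "x \<in> range y"
  then obtain n where "x = y n" by blast
  moreover have "comult (y n) = wadd (\<lambda>n. in_x (y n)) (\<lambda>n. in_y (y n)) n"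
    using comult_y by (rule fun_cong)
  moreover have "\<dots> \<in> AA"
    unfolding wadd_def
    by (rule tev_closed[OF is_subring_AA]) (auto simp: in_x_AA in_y_AA y_in_A split: sum.splits)
  ultimately show "comult x \<in> AA" by simp
qed

lemma coact_hom: "coact \<in> ring_hom (subset_ring A) (subset_ring AT)"
  unfolding A_eq_gen_y
proof (rule rhom_gen[OF rhom_coact is_subring_AT])
  fix x assume "x \<in> range y"
  then obtain n where "x = y n" by blast
  moreover have "coact (y n) = tscale var_y (\<lambda>n. in_x (y n)) n"
    using coact_y by (rule fun_cong)
  ultimately show "coact x \<in> AT"
    by (simp add: tscale_def is_subringD[OF is_subring_AT] in_x_AT var_y_AT y_in_A)
qed

end

section \<open>The comparison map on points\<close>

text \<open>\<open>y\<close> is the universal Witt vector, the one belonging to the identity point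
  of \<open>A\<close>.\<close>

definition (in prime_nat) Phi :: "(rat poly \<Rightarrow> 'u) \<Rightarrow> nat \<Rightarrow> 'u" where
  "Phi g = (\<lambda>n. g (y n))"

context witt_base
begin

abbreviation sharp_pts where "sharp_pts \<equiv> Spec_points (GA_ring p) R"

lemma sharp_pts_hom: "g \<in> sharp_pts \<Longrightarrow> g \<in> ring_hom (subset_ring A) R"
  by (simp add: Spec_points_def GA_ring_eq)

lemma sharp_pts_closed: "g \<in> sharp_pts \<Longrightarrow> c \<in> A \<Longrightarrow> g c \<in> carrier R"
  using ring_hom_closed[OF sharp_pts_hom] by simp

lemma wfrob_y: "wfrob y = (\<lambda>_. 0)"
  by (rule ghost_inj[OF p_gt_0]) (simp add: ghost_wfrob ghost_y)

lemma Phi_in_frob_kernel: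
  assumes g: "g \<in> sharp_pts"
  shows "Phi g \<in> frob_kernel"
proof -
  have "witt_frob p R (Phi g) n = g (wfrob y n)" for n
    unfolding witt_frob_def Phi_def wfrob_def
    using ring_hom_tev[OF is_subring_A is_cring sharp_pts_hom[OF g], of y] y_in_A by (simp add: comp_def)
  moreover have "g 0 = \<zero>"
    using ring_hom_zero[OF sharp_pts_hom[OF g] cring.axioms(1)[OF cring_subset_ring[OF is_subring_A]] ring_axioms]
    by simp
  ultimately show ?thesis
    using sharp_pts_closed[OF g y_in_A]
    by (auto simp: frob_kernel_def witt_carrier_iff Phi_def wfrob_y witt_ring_def)
qed

lemma Phi_inj:
  assumes "g \<in> sharp_pts" "h \<in> sharp_pts" "Phi g = Phi h"
  shows "g = h"
proof (rule Spec_points_gen_eqI[OF is_cring])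
  show "g \<in> Spec_points (subring_gen (range y)) R" "h \<in> Spec_points (subring_gen (range y)) R"
    using assms by (simp_all add: GA_ring_eq A_eq_gen_y subring_gen_eq)
  show "g x = h x" if "x \<in> range y" for x
    using that fun_cong[OF assms(3)] by (auto simp: Phi_def)
qed

lemma sharp_pts_divided_powers:
  assumes g: "g \<in> sharp_pts"
  shows "divided_powers (\<lambda>_. False) (\<lambda>n. g (u n))"
  unfolding divided_powers_def
proof (intro conjI allI impI)
  fix i
  show "g (u i) \<in> carrier R" by (rule sharp_pts_closed[OF g u_in_A])
  have pow: "g (c ^ n) = g c [^] n" if "c \<in> A" for c n
  proof (induction n)
    case (Suc n)
    then show ?case
      using ring_hom_mult[OF sharp_pts_hom[OF g], of c "c ^ n"] that sharp_pts_closed[OF g that]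
      by (simp add: is_subringD[OF is_subring_A] m_comm)
  qed (use ring_hom_one[OF sharp_pts_hom[OF g]] in simp)
  have "g (u i) [^] p = g (of_nat p * u (Suc i))" by (simp add: u_power u_in_A flip: pow)
  also have "\<dots> = ([int p] \<cdot> \<one>) \<otimes> g (u (Suc i))"
    using ring_hom_mult[OF sharp_pts_hom[OF g], of "of_nat p" "u (Suc i)"] u_in_A
      is_subring_of_int[OF is_subring_A, of "int p"] ring_hom_of_int[OF is_subring_A sharp_pts_hom[OF g], of "int p"]
    by simp
  finally show "g (u i) [^] p = ([int p] \<cdot> \<one>) \<otimes> g (u (Suc i))" .
qed

text \<open>Integer constants. Only the \<open>u n\<close> not preceded by a stop are known to lie
  in \<open>B\<close>, so this covers \<open>A\<close>, the polynomial ring in \<open>x\<close>, and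
  the ring generated by \<open>u_0, ..., u_n\<close>.\<close>

lemma base_hom_exists:
  assumes a: "divided_powers stop a"
  obtains B k where "is_subring B" "k \<in> ring_hom (subset_ring B) R"
    "\<And>n. (\<And>i. i < n \<Longrightarrow> \<not> stop i) \<Longrightarrow> u n \<in> B" "\<And>n. (\<And>i. i < n \<Longrightarrow> \<not> stop i) \<Longrightarrow> k (u n) = a n"
proof -
  have "(of_nat p :: rat) ^ uexp n * (1 / of_nat p ^ uexp n) = 1" for n
    using p_gt_0 by simp
  from divided_hom_exists[OF is_subring_Ints floor_hom a] this show ?thesis
    using that unfolding u_gen_eq by (metis (no_types, lifting))
qed

text \<open>With \<open>sharp_pts_divided_powers\<close>, this identifies the points of
  \<open>A\<close> with the sequences satisfying \<open>a_n^p = p a_(n+1)\<close>.\<close>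

lemma sharp_pts_exists:
  assumes a: "divided_powers (\<lambda>_. False) a"
  obtains g where "g \<in> sharp_pts" "\<And>n. g (u n) = a n"
proof -
  obtain B k where B: "is_subring B" "k \<in> ring_hom (subset_ring B) R" "\<And>n. u n \<in> B" "\<And>n. k (u n) = a n"
    using base_hom_exists[OF a] by (metis (no_types, lifting))
  have "A \<subseteq> B" unfolding A_def using B by (intro gen_least) auto
  from restrict_Spec_points[OF B(1) this is_subring_A B(2)] show ?thesis
    using that[of "restrict k A"] B(4) u_in_A by (simp add: GA_ring_eq)
qed

text \<open>Constants from \<open>A\<close> in the inner variable, divided powers in the outer one.
  No stops give \<open>A_tensor_A\<close>, stops everywhere give \<open>A_tensor_Zt\<close>.\<close>

lemma tensor_point_exists:
  assumes g: "g \<in> sharp_pts" and a: "divided_powers stop a"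
  obtains B k where "is_subring B" "k \<in> ring_hom (subset_ring B) R"
    "\<And>c. c \<in> A \<Longrightarrow> in_x c \<in> B" "\<And>c. c \<in> A \<Longrightarrow> k (in_x c) = g c"
    "\<And>n. (\<And>i. i < n \<Longrightarrow> \<not> stop i) \<Longrightarrow> in_y (u n) \<in> B" "\<And>n. (\<And>i. i < n \<Longrightarrow> \<not> stop i) \<Longrightarrow> k (in_y (u n)) = a n"
proof -
  have "of_nat p ^ uexp n * [:1 / of_nat p ^ uexp n:] = (1 :: rat poly)" for n
    using p_gt_0 of_nat_mult_monom[of "p ^ uexp n" "1 / of_nat p ^ uexp n :: rat" 0]
    by (simp add: monom_0 one_pCons)
  from divided_hom_exists[OF is_subring_A sharp_pts_hom[OF g] a] this show ?thesis
    using that unfolding u_gen_eq in_y_monom in_x_def by (metis (no_types, lifting))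
qed

text \<open>The universal property of the tensor product for the subring of
  \<open>rat poly poly\<close>; it gives meaning to the \<open>THE\<close> in
  \<open>Ga_sharp_add\<close>, as \<open>AT_point\<close> does for
  \<open>Ga_sharp_act\<close>.\<close>

lemma AA_point:
  assumes g: "g \<in> sharp_pts" and h: "h \<in> sharp_pts"
  shows "\<exists>!k. k \<in> Spec_points (A_tensor_A p) R \<and> (\<forall>f\<in>A. k (in_x f) = g f \<and> k (in_y f) = h f)"
proof (rule ex_ex1I)
  obtain B k where B: "is_subring B" and k: "k \<in> ring_hom (subset_ring B) R"
    and x: "\<And>c. c \<in> A \<Longrightarrow> in_x c \<in> B" "\<And>c. c \<in> A \<Longrightarrow> k (in_x c) = g c"
    and yu: "\<And>n. in_y (u n) \<in> B" "\<And>n. k (in_y (u n)) = h (u n)"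
    using tensor_point_exists[OF g sharp_pts_divided_powers[OF h]] by (metis (no_types, lifting))
  have in_y: "in_y \<in> ring_hom (subset_ring A) (subset_ring B)"
    unfolding A_def by (rule rhom_gen[OF rhom_in_y B]) (auto simp: yu)
  then have yB: "in_y f \<in> B" if "f \<in> A" for f using ring_hom_closed that by fastforce
  have yh: "k (in_y f) = h f" if "f \<in> A" for f
    using ring_hom_gen_eq[OF is_cring, of "k \<circ> in_y" "range u" h f] ring_hom_trans[OF in_y k] sharp_pts_hom[OF h] that yu
    by (auto simp: A_def)
  have "AA \<subseteq> B" unfolding AA_def using x yB by (intro gen_least B) auto
  from restrict_Spec_points[OF B this is_subring_AA k]
  show "\<exists>k. k \<in> Spec_points (A_tensor_A p) R \<and> (\<forall>f\<in>A. k (in_x f) = g f \<and> k (in_y f) = h f)"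
    using x yh by (intro exI[of _ "restrict k AA"]) (auto simp: A_tensor_eq in_x_AA in_y_AA)
next
  fix k k' assume k: "k \<in> Spec_points (A_tensor_A p) R \<and> (\<forall>f\<in>A. k (in_x f) = g f \<and> k (in_y f) = h f)"
    and k': "k' \<in> Spec_points (A_tensor_A p) R \<and> (\<forall>f\<in>A. k' (in_x f) = g f \<and> k' (in_y f) = h f)"
  then show "k = k'"
    by (intro Spec_points_gen_eqI[OF is_cring, of k "in_x ` A \<union> in_y ` A" k'])
       (auto simp: A_tensor_eq AA_def subring_gen_eq)
qed

lemma AT_point:
  assumes g: "g \<in> sharp_pts" and c: "c \<in> carrier R"
  shows "\<exists>!k. k \<in> Spec_points (A_tensor_Zt p) R \<and> (\<forall>f\<in>A. k (in_x f) = g f) \<and> k var_y = c"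
proof (rule ex_ex1I)
  have yx: "in_y (u 0) = var_y" by (simp add: u_0 in_y_def subst_xy_x)
  \<comment> \<open>With a stop at every place no relation is imposed, so the variable may be sent
    to any \<open>c\<close>.\<close>
  have "divided_powers (\<lambda>_. True) (\<lambda>_. c)" using c by (simp add: divided_powers_def)
  from tensor_point_exists[OF g this] obtain B k where B: "is_subring B" and k: "k \<in> ring_hom (subset_ring B) R"
    and x: "\<And>c. c \<in> A \<Longrightarrow> in_x c \<in> B" "\<And>c. c \<in> A \<Longrightarrow> k (in_x c) = g c"
    and yu: "var_y \<in> B" "k var_y = c"
    unfolding yx[symmetric] by (metis not_less_zero)
  have "AT \<subseteq> B" unfolding AT_def using x yu by (intro gen_least B) auto
  from restrict_Spec_points[OF B this is_subring_AT k]
  show "\<exists>k. k \<in> Spec_points (A_tensor_Zt p) R \<and> (\<forall>f\<in>A. k (in_x f) = g f) \<and> k var_y = c"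
    using x yu by (intro exI[of _ "restrict k AT"]) (auto simp: A_tensor_eq in_x_AT var_y_AT)
next
  fix k k' assume k: "k \<in> Spec_points (A_tensor_Zt p) R \<and> (\<forall>f\<in>A. k (in_x f) = g f) \<and> k var_y = c"
    and k': "k' \<in> Spec_points (A_tensor_Zt p) R \<and> (\<forall>f\<in>A. k' (in_x f) = g f) \<and> k' var_y = c"
  then show "k = k'"
    by (intro Spec_points_gen_eqI[OF is_cring, of k "insert var_y (in_x ` A)" k'])
       (auto simp: A_tensor_eq AT_def subring_gen_eq)
qed

lemma Ga_sharp_simps:
  "carrier (qpts (Ga_sharp p) R) = sharp_pts"
  "x \<oplus>\<^bsub>qpts (Ga_sharp p) R\<^esub> z = Ga_sharp_add p R x z"
  "\<zero>\<^bsub>qpts (Ga_sharp p) R\<^esub> = Ga_sharp_zero p R"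
  "c \<odot>\<^bsub>qpts (Ga_sharp p) R\<^esub> x = Ga_sharp_act p R c x"
  "qmap (Ga_sharp p) R S f h = restrict (f \<circ> h) A" "qd (Ga_sharp p) R h = h [:0, 1:]"
  by (auto simp: Ga_sharp_def GA_ring_eq)

text \<open>Applying \<open>k\<close> to \<open>comult_y\<close> turns the Witt sum of the two
  copies of \<open>y\<close> into that of \<open>Phi g\<close> and \<open>Phi h\<close>.\<close>

lemma Ga_sharp_add:
  assumes g: "g \<in> sharp_pts" and h: "h \<in> sharp_pts"
  shows "Ga_sharp_add p R g h \<in> sharp_pts" "Phi (Ga_sharp_add p R g h) = Phi g \<oplus>\<^bsub>W\<^esub> Phi h"
proof -
  define k where "k = (THE k. k \<in> Spec_points (A_tensor_A p) R \<and>
    (\<forall>f\<in>A. k (in_x f) = g f \<and> k (in_y f) = h f))"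
  have k: "k \<in> Spec_points (subset_ring AA) R" "\<And>f. f \<in> A \<Longrightarrow> k (in_x f) = g f" "\<And>f. f \<in> A \<Longrightarrow> k (in_y f) = h f"
    using theI'[OF AA_point[OF g h], folded k_def] by (auto simp: A_tensor_eq)
  have add: "Ga_sharp_add p R g h = restrict (k \<circ> comult) A"
    by (simp add: Ga_sharp_add_def k_def GA_ring_eq comp_def)
  show "Ga_sharp_add p R g h \<in> sharp_pts"
    unfolding add GA_ring_eq
    by (rule restrict_Spec_points[OF is_subring_A order.refl is_subring_A])
       (rule ring_hom_trans[OF comult_hom Spec_points_hom[OF k(1)]])
  show "Phi (Ga_sharp_add p R g h) = Phi g \<oplus>\<^bsub>W\<^esub> Phi h"
  proof
    fix n
    have "Phi (Ga_sharp_add p R g h) n = k (comult (y n))"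
      by (simp add: Phi_def add y_in_A)
    also have "comult (y n) = tev (case_sum (\<lambda>n. in_x (y n)) (\<lambda>n. in_y (y n))) (witt_add_poly p n)"
      using fun_cong[OF comult_y, of n] by (simp add: wadd_def)
    also have "k \<dots> = zeval R (k \<circ> case_sum (\<lambda>n. in_x (y n)) (\<lambda>n. in_y (y n))) (witt_add_poly p n)"
      by (rule ring_hom_tev[OF is_subring_AA is_cring Spec_points_hom[OF k(1)]])
         (auto simp: in_x_AA in_y_AA y_in_A split: sum.splits)
    also have "k \<circ> case_sum (\<lambda>n. in_x (y n)) (\<lambda>n. in_y (y n)) = case_sum (Phi g) (Phi h)"
      by (auto simp: fun_eq_iff Phi_def k(2,3) y_in_A split: sum.splits)
    finally show "Phi (Ga_sharp_add p R g h) n = (Phi g \<oplus>\<^bsub>W\<^esub> Phi h) n"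
      by (simp add: witt_ring_def)
  qed
qed

lemma Ga_sharp_act:
  assumes g: "g \<in> sharp_pts" and c: "c \<in> carrier R"
  shows "Ga_sharp_act p R c g \<in> sharp_pts" "Phi (Ga_sharp_act p R c g) = kscale c (Phi g)"
proof -
  define k where "k = (THE k. k \<in> Spec_points (A_tensor_Zt p) R \<and> (\<forall>f\<in>A. k (in_x f) = g f) \<and> k var_y = c)"
  have k: "k \<in> Spec_points (subset_ring AT) R" "\<And>f. f \<in> A \<Longrightarrow> k (in_x f) = g f" "k var_y = c"
    using theI'[OF AT_point[OF g c], folded k_def] by (auto simp: A_tensor_eq)
  have act: "Ga_sharp_act p R c g = restrict (k \<circ> coact) A"
    by (simp add: Ga_sharp_act_def k_def GA_ring_eq comp_def)
  show "Ga_sharp_act p R c g \<in> sharp_pts"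
    unfolding act GA_ring_eq
    by (rule restrict_Spec_points[OF is_subring_A order.refl is_subring_A])
       (rule ring_hom_trans[OF coact_hom Spec_points_hom[OF k(1)]])
  note kh = Spec_points_hom[OF k(1)]
  have pow: "k (var_y ^ m) = c [^] m" for m
  proof (induction m)
    case (Suc m)
    then show ?case
      using ring_hom_mult[OF kh, of var_y "var_y ^ m"] c
      by (simp add: is_subringD[OF is_subring_AT] var_y_AT k(3) m_comm)
  qed (use ring_hom_one[OF kh] in simp)
  show "Phi (Ga_sharp_act p R c g) = kscale c (Phi g)"
  proof
    fix n
    have "Phi (Ga_sharp_act p R c g) n = k (coact (y n))"
      by (simp add: Phi_def act y_in_A)
    also have "coact (y n) = var_y ^ (p ^ n) * in_x (y n)"
      using fun_cong[OF coact_y, of n] by (simp add: tscale_def)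
    also have "k \<dots> = kscale c (Phi g) n"
      using ring_hom_mult[OF kh, of "var_y ^ (p ^ n)" "in_x (y n)"]
      by (simp add: is_subringD[OF is_subring_AT] var_y_AT in_x_AT y_in_A pow k(2) kscale_def Phi_def)
    finally show "Phi (Ga_sharp_act p R c g) n = kscale c (Phi g) n" .
  qed
qed

lemma Ga_sharp_zero:
  shows "Ga_sharp_zero p R \<in> sharp_pts" "Phi (Ga_sharp_zero p R) = \<zero>\<^bsub>W\<^esub>"
proof -
  have u0: "Polynomial.coeff (u n) 0 = 0" for n
    using p_gt_0 by (simp add: u_gen_eq)
  have y0: "Polynomial.coeff (y n) 0 = 0" for n
    using p_gt_0 by (simp add: y_eq)
  have "rhom (\<lambda>f :: rat poly. Polynomial.coeff f 0)"
    by (simp add: rhom_def coeff_mult)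
  then have "(\<lambda>f :: rat poly. Polynomial.coeff f 0) \<in> ring_hom (subset_ring A) (subset_ring \<int>)"
    unfolding A_def by (rule rhom_gen[OF _ is_subring_Ints]) (auto simp: u0)
  from restrict_Spec_points[OF is_subring_A order.refl is_subring_A ring_hom_trans[OF this floor_hom]]
  show "Ga_sharp_zero p R \<in> sharp_pts"
    by (simp add: Ga_sharp_zero_def GA_ring_eq comp_def)
  show "Phi (Ga_sharp_zero p R) = \<zero>\<^bsub>W\<^esub>"
    by (auto simp: Phi_def Ga_sharp_zero_def GA_ring_eq y_in_A y0 witt_ring_def int_zero_pow)
qed

text \<open>Ghost components of the Frobenius up to \<open>n\<close> involve ghost components up to
  \<open>Suc n\<close> only. Lifting entries to variables gives equal entries equal lifts.\<close>

lemma witt_frob_cong: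
  assumes "v \<in> carrier W" "w \<in> carrier W" "\<And>i. i \<le> Suc n \<Longrightarrow> v i = w i"
  shows "witt_frob p R v n = witt_frob p R w n"
proof -
  obtain X Y where X: "v = eps_seq X" "X = (\<lambda>n. zvar (v n))" and Y: "w = eps_seq Y" "Y = (\<lambda>n. zvar (w n))"
    using assms(1,2) by (elim witt_lift)
  have "wfrob X n = wfrob Y n"
  proof (rule ghost_eqD[OF p_gt_0])
    fix i assume "i \<le> n"
    then have "ghost p (Suc i) X = ghost p (Suc i) Y"
      unfolding ghost_def by (intro sum.cong) (auto simp: X(2) Y(2) assms(3))
    then show "ghost p i (wfrob X) = ghost p i (wfrob Y)" by (simp add: ghost_wfrob)
  qed
  then have "eps_seq (wfrob X) n = eps_seq (wfrob Y) n" by (simp add: eps_seq_def)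
  then show ?thesis using X(1) Y(1) witt_ops_eps_seq(5) by metis
qed

text \<open>Up to index \<open>n\<close> the ghost components of \<open>Z\<close> are those of
  \<open>y\<close>; the one of index \<open>Suc n\<close> is off by
  \<open>p ^ Suc n * (Z (Suc n) - in_x (y (Suc n)))\<close>.\<close>

lemma wfrob_truncated:
  assumes "\<And>i. i \<le> n \<Longrightarrow> Z i = in_x (y i)"
  shows "wfrob Z n = of_nat p * (Z (Suc n) - in_x (y (Suc n)))"
proof -
  define D where "D = of_nat p * (Z (Suc n) - in_x (y (Suc n)))"
  \<comment> \<open>Up to index \<open>n\<close> the only nonzero ghost component of
    \<open>X\<close> is the last, \<open>p ^ n * D\<close>, which is also that of the Frobenius of
    \<open>Z\<close>.\<close>
  define X where "X = (\<lambda>i. if i = n then D else 0)"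
  have gy: "ghost p (Suc i) (\<lambda>i. in_x (y i)) = 0" for i
    by (simp add: ghost_rhom[OF rhom_in_x] ghost_y rhomD[OF rhom_in_x])
  have "wfrob Z n = X n"
  proof (rule ghost_eqD[OF p_gt_0])
    fix i assume i: "i \<le> n"
    have X0: "ghost p i X = (if i = n then of_nat p ^ n * D else 0)"
    proof -
      have "ghost p i X = (\<Sum>j\<le>i. if j = n then of_nat p ^ n * D else 0)"
        unfolding ghost_def using i p_gt_0 by (intro sum.cong) (auto simp: X_def power_0_left)
      then show ?thesis using i by auto
    qed
    show "ghost p i (wfrob Z) = ghost p i X"
    proof (cases "i = n")
      case True
      have "ghost p n (\<lambda>i. Z i ^ p) = ghost p n (\<lambda>i. in_x (y i) ^ p)"
        unfolding ghost_def by (intro sum.cong) (auto simp: assms)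
      then have "ghost p (Suc n) Z = ghost p (Suc n) (\<lambda>i. in_x (y i)) + of_nat p ^ Suc n * (Z (Suc n) - in_x (y (Suc n)))"
        unfolding ghost_Suc by (simp add: algebra_simps)
      then show ?thesis using True gy[of n] X0 by (simp add: ghost_wfrob D_def algebra_simps)
    next
      case False
      have "ghost p (Suc i) Z = ghost p (Suc i) (\<lambda>i. in_x (y i))"
        unfolding ghost_def using i False by (intro sum.cong) (auto simp: assms)
      then show ?thesis using False gy by (simp add: ghost_wfrob X0)
    qed
  qed
  then show ?thesis by (simp add: X_def D_def)
qed

text \<open>
  The relation holds in \<open>\<int>[u\<^sub>0, \<dots>, u\<^sub>n][t]\<close>, which maps to \<open>R\<close> by \<open>u\<^sub>i \<mapsto> a i\<close> and \<open>t \<mapsto> w (Suc n)\<close>.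
\<close>

lemma frob_kernel_step:
  assumes w: "w \<in> frob_kernel" and a: "\<And>i. a i \<in> carrier R"
    and rel: "\<And>i. i < n \<Longrightarrow> a i [^] p = ([int p] \<cdot> \<one>) \<otimes> a (Suc i)"
    and aw: "\<And>i. i \<le> n \<Longrightarrow> ([wcoef i] \<cdot> \<one>) \<otimes> a i = w i"
  shows "([int p] \<cdot> \<one>) \<otimes> w (Suc n) = ([wcoef (Suc n)] \<cdot> \<one>) \<otimes> a n [^] p"
proof -
  have wc: "\<And>i. w i \<in> carrier R" using w frob_kernel_subset by (auto simp: witt_carrier_iff)
  \<comment> \<open>The relation between \<open>a n\<close> and \<open>a (Suc n)\<close> is not
    among the hypotheses, so the chain is stopped at \<open>n\<close>.\<close>
  have "divided_powers (\<lambda>i. i \<ge> n) a" using a rel by (simp add: divided_powers_def)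
  then obtain B k where B: "is_subring B" "k \<in> ring_hom (subset_ring B) R"
    and u': "\<And>m. (\<And>i. i < m \<Longrightarrow> \<not> n \<le> i) \<Longrightarrow> u m \<in> B"
    and ku': "\<And>m. (\<And>i. i < m \<Longrightarrow> \<not> n \<le> i) \<Longrightarrow> k (u m) = a m"
    using base_hom_exists by blast
  have u: "u m \<in> B" and ku: "k (u m) = a m" if "m \<le> n" for m
    using that u'[of m] ku'[of m] by force+
  have kint: "k (of_int i * x) = ([i] \<cdot> \<one>) \<otimes> k x" if "x \<in> B" for i x
    using ring_hom_mult[OF B(2), of "of_int i" x] is_subring_of_int[OF B(1)] ring_hom_of_int[OF B] that by simp
  have y: "y m \<in> B" and ky: "k (y m) = w m" if "m \<le> n" for m
    using that u[OF that] ku[OF that] aw[OF that] kint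
    by (auto simp: y_def is_subringD[OF B(1)] is_subring_of_int[OF B(1)])
  \<comment> \<open>A free variable over \<open>B\<close> with value \<open>w (Suc n)\<close>; the
    exponent \<open>p ^ 0\<close> below denotes this variable.\<close>
  have "divided_powers (\<lambda>_. True) (\<lambda>_. w (Suc n))" using wc by (simp add: divided_powers_def)
  from divided_hom_exists[OF B this] obtain B' k' where B': "is_subring B'" "k' \<in> ring_hom (subset_ring B') R"
    and x: "\<And>c. c \<in> B \<Longrightarrow> [:c:] \<in> B'" "\<And>c. c \<in> B \<Longrightarrow> k' [:c:] = k c"
    and t: "Polynomial.monom 1 (p ^ 0) \<in> B'" "k' (Polynomial.monom 1 (p ^ 0)) = w (Suc n)"
    by (metis mult_1 not_less_zero power_0 uexp_simps(1))
  define T :: "rat poly poly" where "T = Polynomial.monom 1 (p ^ 0)"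
  \<comment> \<open>\<open>Z\<close> lifts \<open>w\<close> through index \<open>Suc n\<close>. The
    zeros beyond are harmless, as component \<open>n\<close> of the Frobenius sees no
    further.\<close>
  define Z where "Z i = (if i \<le> n then in_x (y i) else if i = Suc n then T else 0)" for i
  interpret B': cring "subset_ring B'" by (rule cring_subset_ring[OF B'(1)])
  interpret k': ring_hom_cring "subset_ring B'" R k'
    by (intro ring_hom_cringI B' B'.is_cring is_cring)
  have ZB: "Z i \<in> B'" for i
    using x(1)[OF y] t by (auto simp: Z_def in_x_def T_def is_subringD[OF B'(1)])
  have kZ: "k' (Z i) = (if i \<le> Suc n then w i else \<zero>)" for i
    using x(2)[OF y] t ky k'.hom_zero by (auto simp: Z_def in_x_def T_def le_Suc_eq)
  have "k' (wfrob Z n) = witt_frob p R (\<lambda>i. k' (Z i)) n"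
    unfolding wfrob_def witt_frob_def
    using ring_hom_tev[OF B'(1) is_cring B'(2), of Z, OF ZB] by (simp add: comp_def)
  also have "\<dots> = witt_frob p R w n"
    using wc by (intro witt_frob_cong) (auto simp: kZ witt_carrier_iff)
  also have "\<dots> = \<zero>" using w by (auto simp: frob_kernel_def witt_ring_def)
  finally have 0: "k' (wfrob Z n) = \<zero>" .
  \<comment> \<open>\<open>y (Suc n)\<close> is not known to lie in \<open>B\<close>, but
    \<open>p\<close> times it is an integer multiple of \<open>u n ^ p\<close>, which does.\<close>
  have py: "of_nat p * y (Suc n) = of_int (wcoef (Suc n)) * u n ^ p"
    by (simp add: y_def u_power)
  have "wfrob Z n = of_nat p * (T - in_x (y (Suc n)))"
    by (subst wfrob_truncated) (auto simp: Z_def)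
  also have "\<dots> = of_int (int p) * T - in_x (of_nat p * y (Suc n))"
    by (simp add: rhomD[OF rhom_in_x] algebra_simps)
  finally have F: "wfrob Z n = of_int (int p) * T - [:of_int (wcoef (Suc n)) * u n ^ p:]"
    unfolding py by (simp add: in_x_def)
  have unB: "u n ^ p \<in> B" "of_int (wcoef (Suc n)) * u n ^ p \<in> B"
    using u[of n] by (auto simp: is_subringD[OF B(1)] is_subring_of_int[OF B(1)])
  have kup: "k (u n ^ m) = a n [^] m" for m
  proof (induction m)
    case (Suc m)
    then show ?case
      using ring_hom_mult[OF B(2), of "u n" "u n ^ m"] u[of n] ku[of n] a
      by (simp add: is_subringD[OF B(1)] m_comm)
  qed (use ring_hom_one[OF B(2)] in simp)
  have "of_int (int p) \<in> B'" by (rule is_subring_of_int[OF B'(1)])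
  moreover have "T \<in> B'" using t by (simp add: T_def)
  ultimately have pT: "k' (of_int (int p) * T) = ([int p] \<cdot> \<one>) \<otimes> w (Suc n)" "of_int (int p) * T \<in> B'"
    using ring_hom_mult[OF B'(2), of "of_int (int p)" T] ring_hom_of_int[OF B', of "int p"] t
    by (auto simp: T_def is_subringD[OF B'(1)])
  have "k' (of_int (int p) * T) = k' (wfrob Z n + [:of_int (wcoef (Suc n)) * u n ^ p:])"
    by (simp add: F)
  also have "\<dots> = k' (wfrob Z n) \<oplus> k' [:of_int (wcoef (Suc n)) * u n ^ p:]"
    using k'.hom_add[of "wfrob Z n" "[:of_int (wcoef (Suc n)) * u n ^ p:]"] pT x(1)[OF unB(2)] F
      is_subringD(4)[OF B'(1)] by simp
  also have "\<dots> = ([wcoef (Suc n)] \<cdot> \<one>) \<otimes> a n [^] p"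
    using x(2)[OF unB(2)] kint[OF unB(1)] a by (simp add: 0 kup)
  finally show ?thesis using pT(1) by simp
qed

lemma Phi_surj:
  assumes w: "w \<in> frob_kernel"
  obtains g where "g \<in> sharp_pts" "Phi g = w"
proof -
  have wc [simp]: "\<And>i. w i \<in> carrier R" using w frob_kernel_subset by (auto simp: witt_carrier_iff)
  define \<iota> where "\<iota> k = [(k::int)] \<cdot> \<one>" for k
  have \<iota>c [simp]: "\<iota> k \<in> carrier R" for k by (simp add: \<iota>_def)
  have \<iota>m: "\<iota> (k * l) = \<iota> k \<otimes> \<iota> l" and \<iota>a: "\<iota> (k + l) = \<iota> k \<oplus> \<iota> l" for k l
    using ring_hom_mult[OF add_pow_int_hom, of k l] ring_hom_add[OF add_pow_int_hom, of k l]
    by (simp_all add: \<iota>_def)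
  have \<iota>1: "\<iota> 1 = \<one>" by (simp add: \<iota>_def)
  \<comment> \<open>The only possible choice: the next entry must give \<open>w (Suc n)\<close> when
    multiplied by \<open>wcoef (Suc n)\<close> and \<open>a n [^] p\<close> when multiplied by
    \<open>p\<close>, and Bezout combines the two.\<close>
  define a where "a = rec_nat (w 0) (\<lambda>n x. \<iota> (bez_s (Suc n)) \<otimes> w (Suc n) \<oplus> \<iota> (bez_t (Suc n)) \<otimes> x [^] p)"
  have a0: "a 0 = w 0"
    and aS: "a (Suc n) = \<iota> (bez_s (Suc n)) \<otimes> w (Suc n) \<oplus> \<iota> (bez_t (Suc n)) \<otimes> a n [^] p" for n
    by (simp_all add: a_def)
  have ac [simp]: "a n \<in> carrier R" for n
    by (induction n) (simp_all add: a0 aS)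
  \<comment> \<open>Both families of relations up to \<open>n\<close> enter
    \<open>frob_kernel_step\<close>, so they are proved together.\<close>
  have main: "(\<forall>i\<le>n. \<iota> (wcoef i) \<otimes> a i = w i) \<and> (\<forall>i<n. a i [^] p = \<iota> (int p) \<otimes> a (Suc i))" for n
  proof (induction n)
    case 0
    then show ?case by (simp add: a0 wcoef_0 \<iota>1)
  next
    case (Suc n)
    let ?b = "wcoef (Suc n)" and ?s = "bez_s (Suc n)" and ?t = "bez_t (Suc n)"
    have step: "\<iota> (int p) \<otimes> w (Suc n) = \<iota> ?b \<otimes> a n [^] p"
      unfolding \<iota>_def
      by (rule frob_kernel_step[of w a n, OF w ac]) (use Suc in \<open>auto simp: \<iota>_def\<close>)
    have one: "\<iota> ?s \<otimes> \<iota> ?b \<oplus> \<iota> ?t \<otimes> \<iota> (int p) = \<one>"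
      unfolding \<iota>m[symmetric] \<iota>a[symmetric] bezout_wcoef \<iota>1 ..
    have "\<iota> ?b \<otimes> a (Suc n) = \<iota> ?s \<otimes> \<iota> ?b \<otimes> w (Suc n) \<oplus> \<iota> ?t \<otimes> (\<iota> ?b \<otimes> a n [^] p)"
      unfolding aS by (simp add: r_distr m_ac)
    also have "\<dots> = (\<iota> ?s \<otimes> \<iota> ?b \<oplus> \<iota> ?t \<otimes> \<iota> (int p)) \<otimes> w (Suc n)"
      unfolding step[symmetric] by (simp add: l_distr m_assoc)
    finally have 1: "\<iota> ?b \<otimes> a (Suc n) = w (Suc n)" by (simp add: one)
    have "\<iota> (int p) \<otimes> a (Suc n) = \<iota> ?s \<otimes> (\<iota> (int p) \<otimes> w (Suc n)) \<oplus> \<iota> ?t \<otimes> \<iota> (int p) \<otimes> a n [^] p"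
      unfolding aS by (simp add: r_distr m_ac)
    also have "\<dots> = (\<iota> ?s \<otimes> \<iota> ?b \<oplus> \<iota> ?t \<otimes> \<iota> (int p)) \<otimes> a n [^] p"
      unfolding step by (simp add: l_distr m_assoc)
    finally have 2: "a n [^] p = \<iota> (int p) \<otimes> a (Suc n)" by (simp add: one)
    show ?case using Suc 1 2 by (auto simp: le_Suc_eq less_Suc_eq)
  qed
  then have "divided_powers (\<lambda>_. False) a"
    unfolding divided_powers_def \<iota>_def[symmetric] using ac by blast
  then obtain g where g: "g \<in> sharp_pts" "\<And>n. g (u n) = a n" by (rule sharp_pts_exists) blast
  have "Phi g n = w n" for n
  proof -
    have "g (of_int (wcoef n) * u n) = \<iota> (wcoef n) \<otimes> a n"
      using ring_hom_mult[OF sharp_pts_hom[OF g(1)], of "of_int (wcoef n)" "u n"] u_in_A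
        is_subring_of_int[OF is_subring_A] ring_hom_of_int[OF is_subring_A sharp_pts_hom[OF g(1)]] g(2)
      by (simp add: \<iota>_def)
    then show ?thesis using main by (auto simp: Phi_def y_def)
  qed
  with g show ?thesis by (intro that) auto
qed

lemma Phi_bij: "bij_betw Phi sharp_pts frob_kernel"
  unfolding bij_betw_def inj_on_def
  using Phi_inj Phi_in_frob_kernel Phi_surj by (auto simp: image_iff) metis

end

section \<open>Representability\<close>

lemma set_functorI:
  assumes "\<And>R S f x. cring R \<Longrightarrow> cring S \<Longrightarrow> f \<in> ring_hom R S \<Longrightarrow> x \<in> X R \<Longrightarrow> m R S f x \<in> X S"
    and "\<And>R S f g x. cring R \<Longrightarrow> cring S \<Longrightarrow> f \<in> ring_hom R S \<Longrightarrow> g \<in> ring_hom R S \<Longrightarrow> x \<in> X R \<Longrightarrow>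
      (\<And>a. a \<in> carrier R \<Longrightarrow> f a = g a) \<Longrightarrow> m R S f x = m R S g x"
    and "\<And>R x. cring R \<Longrightarrow> x \<in> X R \<Longrightarrow> m R R (\<lambda>a. a) x = x"
    and "\<And>R S T f g x. cring R \<Longrightarrow> cring S \<Longrightarrow> cring T \<Longrightarrow> f \<in> ring_hom R S \<Longrightarrow> g \<in> ring_hom S T \<Longrightarrow>
      x \<in> X R \<Longrightarrow> m R T (g \<circ> f) x = m S T g (m R S f x)"
  shows "set_functor X m"
  unfolding set_functor_def
  by (intro conjI allI impI; elim conjE; rule assms; (assumption | erule (1) bspec))

lemma cring_copy:
  fixes G :: "'a ring" and j :: "'a \<Rightarrow> 'u"
  assumes "cring G" "inj j"
  obtains B :: "'u ring" where "cring B" "j \<in> ring_iso G B"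
proof -
  interpret G: cring G by fact
  define r where "r = the_inv j"
  have r [simp]: "r (j x) = x" for x using assms(2) by (simp add: r_def the_inv_f_f)
  define B :: "'u ring" where "B = \<lparr> carrier = j ` carrier G, monoid.mult = (\<lambda>a b. j (r a \<otimes>\<^bsub>G\<^esub> r b)),
    one = j \<one>\<^bsub>G\<^esub>, zero = j \<zero>\<^bsub>G\<^esub>, add = (\<lambda>a b. j (r a \<oplus>\<^bsub>G\<^esub> r b)) \<rparr>"
  have iso: "j \<in> ring_iso G B"
    unfolding ring_iso_def bij_betw_def ring_hom_def
    using assms(2) by (auto simp: B_def intro: inj_on_subset)
  moreover have "B \<lparr> zero := j \<zero>\<^bsub>G\<^esub> \<rparr> = B" by (simp add: B_def)
  ultimately have "cring B" using G.ring_iso_imp_img_cring by metis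
  then show ?thesis using iso that by blast
qed

text \<open>The representing ring must live in the universe \<open>'u\<close>, so \<open>G\<close>
  is replaced by a copy \<open>B\<close>. The point \<open>q\<close> is universal, and the embedding
  \<open>r\<close> back into \<open>G\<close> later makes torsion-freeness of \<open>A\<close>
  available for \<open>B\<close>.\<close>

lemma universal_point:
  fixes G :: "'a ring" and j :: "'a \<Rightarrow> 'u"
  assumes G: "cring G" and j: "inj j"
  obtains B :: "'u ring" and q r where "cring B" "q \<in> Spec_points G B" "r \<in> ring_hom B G" "inj_on r (carrier B)"
    "\<forall>R :: 'u ring. cring R \<longrightarrow> bij_betw (\<lambda>f. restrict (f \<circ> q) (carrier G)) (Spec_points B R) (Spec_points G R)"
proof -
  interpret G: cring G by fact
  obtain B :: "'u ring" where B: "cring B" and iso: "j \<in> ring_iso G B" using cring_copy[OF G j] .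
  interpret B: cring B by fact
  define q where "q = restrict j (carrier G)"
  define r where "r = inv_into (carrier G) j"
  have jb: "bij_betw j (carrier G) (carrier B)" using iso by (auto simp: ring_iso_def)
  have jh: "j \<in> ring_hom G B" using iso by (auto simp: ring_iso_def)
  have r: "r \<in> ring_iso B G" unfolding r_def by (rule ring_iso_set_sym[OF G.ring_axioms iso])
  then have rh: "r \<in> ring_hom B G" and rinj: "inj_on r (carrier B)"
    by (auto simp: ring_iso_def bij_betw_def)
  have rj: "r (j x) = x" if "x \<in> carrier G" for x
    using jb that by (simp add: r_def bij_betw_inv_into_left)
  have jr: "j (r x) = x" if "x \<in> carrier B" for x
    using jb that by (simp add: r_def bij_betw_inv_into_right)
  have jc: "j x \<in> carrier B" if "x \<in> carrier G" for x using ring_hom_closed[OF jh that] .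
  have rc: "r x \<in> carrier G" if "x \<in> carrier B" for x using ring_hom_closed[OF rh that] .
  have restr: "restrict h (carrier H) \<in> Spec_points H R" if "ring H" "h \<in> ring_hom H R"
    for h :: "'x \<Rightarrow> 'u" and H :: "'x ring" and R :: "'u ring"
  proof -
    interpret H: ring H by fact
    show ?thesis
      using that(2) unfolding Spec_points_def ring_hom_def by (auto simp: Pi_iff)
  qed
  have q: "q \<in> Spec_points G B" unfolding q_def by (rule restr[OF G.ring_axioms jh])
  have "bij_betw (\<lambda>f. restrict (f \<circ> q) (carrier G)) (Spec_points B R) (Spec_points G R)"
    if R: "cring R" for R :: "'u ring"
  proof (rule bij_betw_byWitness[where f' = "\<lambda>h. restrict (h \<circ> r) (carrier B)"])
    show "\<forall>f\<in>Spec_points B R. restrict (restrict (f \<circ> q) (carrier G) \<circ> r) (carrier B) = f"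
      by (auto simp: fun_eq_iff Spec_points_def q_def jr rc extensional_def restrict_def)
    show "\<forall>h\<in>Spec_points G R. restrict (restrict (h \<circ> r) (carrier B) \<circ> q) (carrier G) = h"
      by (auto simp: fun_eq_iff Spec_points_def q_def rj jc extensional_def restrict_def)
    show "(\<lambda>f. restrict (f \<circ> q) (carrier G)) ` Spec_points B R \<subseteq> Spec_points G R"
      using ring_hom_trans[OF Spec_points_hom[OF q]] restr[OF G.ring_axioms] Spec_points_hom by blast
    show "(\<lambda>h. restrict (h \<circ> r) (carrier B)) ` Spec_points G R \<subseteq> Spec_points B R"
      using ring_hom_trans[OF rh] restr[OF B.ring_axioms] Spec_points_hom by blast
  qed
  then show ?thesis using that[OF B q rh rinj] by blast
qed

text \<open>Yoneda: a natural bijection \<open>\<beta>\<close> with the points of \<open>G\<close>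
  carries the universal point \<open>q\<close> to a universal point of \<open>X\<close>.\<close>

lemma affine_schemeI:
  fixes G :: "'a ring" and j :: "'a \<Rightarrow> 'u" and X :: "'u ring \<Rightarrow> 'x set"
  assumes "cring G" "inj j" and X: "set_functor X m"
    and bij: "\<And>R. cring R \<Longrightarrow> bij_betw (\<beta> R) (Spec_points G R) (X R)"
    and nat: "\<And>R S f g. cring R \<Longrightarrow> cring S \<Longrightarrow> f \<in> ring_hom R S \<Longrightarrow> g \<in> Spec_points G R \<Longrightarrow>
      \<beta> S (restrict (f \<circ> g) (carrier G)) = m R S f (\<beta> R g)"
  shows "affine_scheme X m"
proof -
  obtain B :: "'u ring" and q and r :: "'u \<Rightarrow> 'a" where B: "cring B" "q \<in> Spec_points G B"
    and univ: "\<forall>R :: 'u ring. cring R \<longrightarrow>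
      bij_betw (\<lambda>f. restrict (f \<circ> q) (carrier G)) (Spec_points B R) (Spec_points G R)"
    by (rule universal_point[OF assms(1,2)])
  have "bij_betw (\<lambda>f. m B R f (\<beta> B q)) (Spec_points B R) (X R)" if R: "cring R" for R
  proof -
    have "bij_betw (\<beta> R \<circ> (\<lambda>f. restrict (f \<circ> q) (carrier G))) (Spec_points B R) (X R)"
      by (rule bij_betw_trans[OF univ[rule_format, OF R] bij[OF R]])
    moreover have "(\<beta> R \<circ> (\<lambda>f. restrict (f \<circ> q) (carrier G))) f = m B R f (\<beta> B q)" if "f \<in> Spec_points B R" for f
      using nat[OF B(1) R Spec_points_hom[OF that] B(2)] by simp
    ultimately show ?thesis
      using bij_betw_cong[of "Spec_points B R" "\<beta> R \<circ> (\<lambda>f. restrict (f \<circ> q) (carrier G))"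
        "\<lambda>f. m B R f (\<beta> B q)" "X R"] by blast
  qed
  moreover have "\<beta> B q \<in> X B" using bij_betwE[OF bij[OF B(1)]] B(2) by blast
  ultimately show ?thesis unfolding affine_scheme_def using X B(1) by blast
qed

lemma rat_poly_inj:
  assumes "infinite (UNIV :: 'u set)"
  obtains j :: "rat poly \<Rightarrow> 'u" where "inj j"
proof -
  obtain i :: "nat \<Rightarrow> 'u" where "inj i" using infinite_countable_subset[OF assms] by blast
  then have "inj (\<lambda>f. i (to_nat (coeffs f)))"
    by (auto intro!: injI dest!: injD simp: coeffs_eq_iff)
  then show ?thesis by (rule that)
qed

text \<open>Injectivity of \<open>\<Phi>\<close> pulls the laws back, surjectivity provides additive
  inverses.\<close>

lemma module_transport:
  assumes "module R K" and bij: "bij_betw \<Phi> (carrier M) (carrier K)"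
    and add: "\<And>x z. x \<in> carrier M \<Longrightarrow> z \<in> carrier M \<Longrightarrow>
      x \<oplus>\<^bsub>M\<^esub> z \<in> carrier M \<and> \<Phi> (x \<oplus>\<^bsub>M\<^esub> z) = \<Phi> x \<oplus>\<^bsub>K\<^esub> \<Phi> z"
    and zero: "\<zero>\<^bsub>M\<^esub> \<in> carrier M" "\<Phi> \<zero>\<^bsub>M\<^esub> = \<zero>\<^bsub>K\<^esub>"
    and smult: "\<And>c x. c \<in> carrier R \<Longrightarrow> x \<in> carrier M \<Longrightarrow>
      c \<odot>\<^bsub>M\<^esub> x \<in> carrier M \<and> \<Phi> (c \<odot>\<^bsub>M\<^esub> x) = c \<odot>\<^bsub>K\<^esub> \<Phi> x"
  shows "module R M"
proof -
  interpret K: module R K by fact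
  have eqI: "x = z" if "x \<in> carrier M" "z \<in> carrier M" "\<Phi> x = \<Phi> z" for x z
    using bij that by (auto simp: bij_betw_def inj_on_def)
  have cl: "\<Phi> x \<in> carrier K" if "x \<in> carrier M" for x using bij_betwE[OF bij] that by blast
  show ?thesis
  proof (rule moduleI)
    show "cring R" by (rule K.is_cring)
    show "abelian_group M"
    proof (rule abelian_groupI)
      fix x assume x: "x \<in> carrier M"
      then have "\<ominus>\<^bsub>K\<^esub> \<Phi> x \<in> \<Phi> ` carrier M" using bij cl by (simp add: bij_betw_def)
      then obtain z where "z \<in> carrier M" "\<Phi> z = \<ominus>\<^bsub>K\<^esub> \<Phi> x" by auto
      then show "\<exists>z\<in>carrier M. z \<oplus>\<^bsub>M\<^esub> x = \<zero>\<^bsub>M\<^esub>"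
        using x cl by (intro bexI[of _ z] eqI) (auto simp: add zero K.l_neg)
    next
      fix x z v assume "x \<in> carrier M" "z \<in> carrier M" "v \<in> carrier M"
      then show "x \<oplus>\<^bsub>M\<^esub> z \<oplus>\<^bsub>M\<^esub> v = x \<oplus>\<^bsub>M\<^esub> (z \<oplus>\<^bsub>M\<^esub> v)"
        using cl by (intro eqI) (auto simp: add K.a_assoc)
    next
      fix x z assume "x \<in> carrier M" "z \<in> carrier M"
      then show "x \<oplus>\<^bsub>M\<^esub> z = z \<oplus>\<^bsub>M\<^esub> x"
        using cl by (intro eqI) (auto simp: add K.M.a_comm)
    next
      fix x assume "x \<in> carrier M"
      then show "\<zero>\<^bsub>M\<^esub> \<oplus>\<^bsub>M\<^esub> x = x"
        using cl by (intro eqI) (auto simp: add zero)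
    qed (use add zero in auto)
  qed (use cl add smult in \<open>auto intro!: eqI simp: K.smult_l_distr K.smult_r_distr K.smult_assoc1\<close>)
qed

context prime_nat
begin

lemma witt_baseI: "cring R \<Longrightarrow> witt_base p R"
  by (simp add: witt_base_def base_cring_def prime_nat_axioms)

abbreviation WF_points where "WF_points R \<equiv> carrier (qpts (WF p) R)"
abbreviation sharp_points where "sharp_points R \<equiv> carrier (qpts (Ga_sharp p) R)"

lemma sharp_points_eq: "sharp_points R = Spec_points (GA_ring p) R"
  by (simp add: Ga_sharp_def)

lemma qmap_simps: "qmap (WF p) = (\<lambda>R S f w. f \<circ> w)" "qmap (Ga_sharp p) = (\<lambda>R S f h. restrict (f \<circ> h) A)"
  and qd_simps: "qd (WF p) R w = w 0" "qd (Ga_sharp p) R g = g [:0, 1:]"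
  by (simp_all add: WF_def Ga_sharp_def GA_ring_eq)

lemma Phi_natural: "Phi (restrict (f \<circ> g) A) = f \<circ> Phi g"
  by (auto simp: Phi_def y_in_A)

lemma Ga_simps: "rpts Ga R = R" "rmap Ga = (\<lambda>R S f. f)"
  by (simp_all add: Ga_def)

lemma affine_ring_scheme_Ga:
  assumes inf: "infinite (UNIV :: 'u set)"
  shows "affine_ring_scheme (Ga :: ('u, 'u) ring_functor)"
proof -
  obtain j :: "rat poly \<Rightarrow> 'u" where j: "inj j" using rat_poly_inj[OF inf] .
  let ?x = "[:0, 1 :: rat:]"
  let ?G = "subring_gen {?x}"
  have G: "?G = subset_ring (gen {?x})" by (rule subring_gen_eq)
  have "set_functor (\<lambda>R :: 'u ring. carrier R) (\<lambda>R S f. f)"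
    by (rule set_functorI) (auto simp: ring_hom_closed)
  moreover have "bij_betw (\<lambda>g. g ?x) (Spec_points ?G R) (carrier R)" if R: "cring R" for R :: "'u ring"
    unfolding bij_betw_def
  proof
    interpret witt_base p R by (rule witt_baseI[OF R])
    have x: "?x \<in> gen {?x}" by (simp add: gen_incl)
    show "inj_on (\<lambda>g. g ?x) (Spec_points ?G R)"
      by (intro inj_onI Spec_points_gen_eqI[OF R]) auto
    show "(\<lambda>g. g ?x) ` Spec_points ?G R = carrier R"
    proof
      show "(\<lambda>g. g ?x) ` Spec_points ?G R \<subseteq> carrier R"
        using x ring_hom_closed[OF Spec_points_hom] by (fastforce simp: G)
      show "carrier R \<subseteq> (\<lambda>g. g ?x) ` Spec_points ?G R"
      proof
        fix c assume c: "c \<in> carrier R"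
        \<comment> \<open>The variable is \<open>u 0\<close>, and stops everywhere leave its value
          free.\<close>
        then have "divided_powers (\<lambda>_. True) (\<lambda>_. c)" by (simp add: divided_powers_def)
        then obtain B k where B: "is_subring B" "k \<in> ring_hom (subset_ring B) R" "u 0 \<in> B" "k (u 0) = c"
          using base_hom_exists by (metis not_less_zero)
        then have "restrict k (gen {?x}) \<in> Spec_points ?G R"
          unfolding G by (intro restrict_Spec_points[OF B(1)] gen_least is_subring_gen) (auto simp: u_0)
        then show "c \<in> (\<lambda>g. g ?x) ` Spec_points ?G R"
          using B(4) x by (intro image_eqI[of _ _ "restrict k (gen {?x})"]) (auto simp: u_0)
      qed
    qed
  qed
  ultimately have "affine_scheme (\<lambda>R :: 'u ring. carrier R) (\<lambda>R S f. f)"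
    by (intro affine_schemeI[of ?G j _ _ "\<lambda>R g. g ?x"] j)
       (auto simp: G cring_subset_ring is_subring_gen gen_incl)
  then show ?thesis by (simp add: affine_ring_scheme_def Ga_simps)
qed

lemma Spec_points_comp:
  assumes "cring R" "f \<in> ring_hom R S" "g \<in> sharp_points R"
  shows "restrict (f \<circ> g) A \<in> sharp_points S"
  using restrict_Spec_points[OF is_subring_A order.refl is_subring_A, of "f \<circ> g" S]
    ring_hom_trans[OF Spec_points_hom[OF assms(3)[unfolded sharp_points_eq]] assms(2)] by (simp add: sharp_points_eq GA_ring_eq)

lemma set_functor_Ga_sharp:
  "set_functor (\<lambda>R :: 'u ring. sharp_points R) (qmap (Ga_sharp p))"
  unfolding qmap_simps
proof (rule set_functorI)
  fix R S :: "'u ring" and f g x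
  assume "cring R" "x \<in> sharp_points R" and fg: "\<And>a. a \<in> carrier R \<Longrightarrow> f a = g a"
  then show "restrict (f \<circ> x) A = restrict (g \<circ> x) A"
    using ring_hom_closed[OF Spec_points_hom] by (fastforce simp: fun_eq_iff sharp_points_eq GA_ring_eq restrict_def)
next
  fix R S :: "'u ring" and f x
  assume "cring R" "f \<in> ring_hom R S" "x \<in> sharp_points R"
  then show "restrict (f \<circ> x) A \<in> sharp_points S" by (rule Spec_points_comp)
qed (auto simp: fun_eq_iff restrict_def sharp_points_eq Spec_points_def extensional_def GA_ring_eq)

lemma WF_points_comp:
  assumes "cring R" "cring S" "f \<in> ring_hom R S" "w \<in> WF_points R"
  shows "f \<circ> w \<in> WF_points S"
proof -
  interpret R: witt_base p R by (rule witt_baseI) fact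
  interpret S: witt_base p S by (rule witt_baseI) fact
  have "w \<in> carrier (witt_ring p R)" using assms(4) by (simp add: R.frob_kernel_def)
  from witt_ring_natural[OF assms(1-3) this this] show ?thesis
    using assms(4) by (simp add: R.frob_kernel_def S.frob_kernel_def)
qed

lemma set_functor_WF: "set_functor (\<lambda>R :: 'u ring. WF_points R) (qmap (WF p))"
  unfolding qmap_simps
proof (rule set_functorI)
  fix R S :: "'u ring" and f g x
  assume R: "cring R" and x: "x \<in> WF_points R" and fg: "\<And>a. a \<in> carrier R \<Longrightarrow> f a = g a"
  interpret R: witt_base p R by (rule witt_baseI) fact
  show "f \<circ> x = g \<circ> x"
    using x fg by (auto simp: fun_eq_iff R.frob_kernel_def R.witt_carrier_iff)
qed (auto simp: WF_points_comp)

text \<open>Both functors are represented by \<open>A\<close>, the Frobenius kernel through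
  \<open>Phi\<close>; no separate presentation of its coordinate ring is needed.\<close>

lemma affine_Ga_sharp_WF:
  assumes inf: "infinite (UNIV :: 'u set)"
  shows "affine_scheme (\<lambda>R :: 'u ring. sharp_points R) (qmap (Ga_sharp p))"
    and "affine_scheme (\<lambda>R :: 'u ring. WF_points R) (qmap (WF p))"
proof -
  obtain j :: "rat poly \<Rightarrow> 'u" where j: "inj j" using rat_poly_inj[OF inf] .
  have G: "cring (GA_ring p)" by (simp add: GA_ring_eq cring_subset_ring is_subring_A)
  show "affine_scheme (\<lambda>R :: 'u ring. sharp_points R) (qmap (Ga_sharp p))"
    by (rule affine_schemeI[OF G j set_functor_Ga_sharp, of "\<lambda>R g. g"])
       (auto simp: sharp_points_eq GA_ring_eq bij_betw_def qmap_simps)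
  show "affine_scheme (\<lambda>R :: 'u ring. WF_points R) (qmap (WF p))"
    by (rule affine_schemeI[OF G j set_functor_WF, of "\<lambda>R. Phi"])
       (use Phi_natural witt_base.Phi_bij[OF witt_baseI] in \<open>auto simp: GA_ring_eq qmap_simps witt_base.WF_simps[OF witt_baseI]\<close>)
qed


section \<open>The isomorphism of quasi-ideals\<close>

lemma quasi_ideal_GaI:
  fixes Q :: "('u, 'u, 'x) quasi_ideal_data"
  assumes "affine_ring_scheme (Ga :: ('u, 'u) ring_functor)" "affine_scheme (\<lambda>R. carrier (qpts Q R)) (qmap Q)"
    and "\<And>R. cring R \<Longrightarrow> module R (qpts Q R)"
    and "\<And>R S f x z. cring R \<Longrightarrow> cring S \<Longrightarrow> f \<in> ring_hom R S \<Longrightarrow> x \<in> carrier (qpts Q R) \<Longrightarrow> z \<in> carrier (qpts Q R) \<Longrightarrow>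
      qmap Q R S f (x \<oplus>\<^bsub>qpts Q R\<^esub> z) = qmap Q R S f x \<oplus>\<^bsub>qpts Q S\<^esub> qmap Q R S f z"
    and "\<And>R S f x c. cring R \<Longrightarrow> cring S \<Longrightarrow> f \<in> ring_hom R S \<Longrightarrow> x \<in> carrier (qpts Q R) \<Longrightarrow> c \<in> carrier R \<Longrightarrow>
      qmap Q R S f (c \<odot>\<^bsub>qpts Q R\<^esub> x) = f c \<odot>\<^bsub>qpts Q S\<^esub> qmap Q R S f x"
    and "\<And>R S f x. cring R \<Longrightarrow> cring S \<Longrightarrow> f \<in> ring_hom R S \<Longrightarrow> x \<in> carrier (qpts Q R) \<Longrightarrow>
      qd Q S (qmap Q R S f x) = f (qd Q R x)"
    and "\<And>R x. cring R \<Longrightarrow> x \<in> carrier (qpts Q R) \<Longrightarrow> qd Q R x \<in> carrier R"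
    and "\<And>R x z. cring R \<Longrightarrow> x \<in> carrier (qpts Q R) \<Longrightarrow> z \<in> carrier (qpts Q R) \<Longrightarrow>
      qd Q R (x \<oplus>\<^bsub>qpts Q R\<^esub> z) = qd Q R x \<oplus>\<^bsub>R\<^esub> qd Q R z"
    and "\<And>R x c. cring R \<Longrightarrow> x \<in> carrier (qpts Q R) \<Longrightarrow> c \<in> carrier R \<Longrightarrow>
      qd Q R (c \<odot>\<^bsub>qpts Q R\<^esub> x) = c \<otimes>\<^bsub>R\<^esub> qd Q R x"
    and "\<And>R x z. cring R \<Longrightarrow> x \<in> carrier (qpts Q R) \<Longrightarrow> z \<in> carrier (qpts Q R) \<Longrightarrow>
      qd Q R x \<odot>\<^bsub>qpts Q R\<^esub> z = qd Q R z \<odot>\<^bsub>qpts Q R\<^esub> x"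
  shows "quasi_ideal Ga Q"
  unfolding quasi_ideal_def Ga_simps using assms by (intro conjI allI impI ballI) auto

lemma quasi_ideal_WF:
  assumes inf: "infinite (UNIV :: 'u set)"
  shows "quasi_ideal (Ga :: ('u, 'u) ring_functor) (WF p)"
proof (rule quasi_ideal_GaI[OF affine_ring_scheme_Ga[OF inf] affine_Ga_sharp_WF(2)[OF inf]])
  fix R :: "'u ring" assume R: "cring R"
  then interpret R: witt_base p R by (rule witt_baseI)
  have W: "x \<in> carrier (witt_ring p R)" and comp: "x n \<in> carrier R" if "x \<in> WF_points R" for x n
    using that by (auto simp: R.frob_kernel_def R.witt_carrier_iff)
  show "module R (qpts (WF p) R)" by (rule R.WF_module)
  fix x z assume x: "x \<in> WF_points R"
  show "qd (WF p) R x \<in> carrier R" using comp[OF x] by simp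
  show "qd (WF p) R (c \<odot>\<^bsub>qpts (WF p) R\<^esub> x) = c \<otimes>\<^bsub>R\<^esub> qd (WF p) R x" if "c \<in> carrier R" for c
    using x that by (simp add: R.WF_smult R.WF_d)
  show "qd (WF p) R (x \<oplus>\<^bsub>qpts (WF p) R\<^esub> z) = qd (WF p) R x \<oplus>\<^bsub>R\<^esub> qd (WF p) R z" if z: "z \<in> WF_points R"
    using W[OF x] W[OF z] by (simp add: R.witt_add_at_0)
  show "qd (WF p) R x \<odot>\<^bsub>qpts (WF p) R\<^esub> z = qd (WF p) R z \<odot>\<^bsub>qpts (WF p) R\<^esub> x" if z: "z \<in> WF_points R"
    using x z comp[OF x] comp[OF z] by (simp add: R.WF_smult R.WF_d(1))
  fix S :: "'u ring" and f assume S: "cring S" and f: "f \<in> ring_hom R S"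
  interpret S: witt_base p S by (rule witt_baseI[OF S])
  interpret f: ring_hom_cring R S f by (intro ring_hom_cringI f R S)
  show "qd (WF p) S (qmap (WF p) R S f x) = f (qd (WF p) R x)" by simp
  show "qmap (WF p) R S f (x \<oplus>\<^bsub>qpts (WF p) R\<^esub> z) = qmap (WF p) R S f x \<oplus>\<^bsub>qpts (WF p) S\<^esub> qmap (WF p) R S f z"
    if z: "z \<in> WF_points R"
    using witt_ring_natural(2)[OF R S f W[OF x] W[OF z]] by simp
  show "qmap (WF p) R S f (c \<odot>\<^bsub>qpts (WF p) R\<^esub> x) = f c \<odot>\<^bsub>qpts (WF p) S\<^esub> qmap (WF p) R S f x" 
    if c: "c \<in> carrier R" for c
    using x c WF_points_comp[OF R S f x] comp[OF x]
    by (simp add: R.WF_smult S.WF_smult R.kscale_def S.kscale_def comp_def f.ring.hom_nat_pow)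
qed

lemma Phi_props:
  fixes R :: "'u ring"
  assumes R: "cring R"
  shows "bij_betw Phi (sharp_points R) (WF_points R)"
    and "g \<in> sharp_points R \<Longrightarrow> h \<in> sharp_points R \<Longrightarrow> g \<oplus>\<^bsub>qpts (Ga_sharp p) R\<^esub> h \<in> sharp_points R \<and>
      Phi (g \<oplus>\<^bsub>qpts (Ga_sharp p) R\<^esub> h) = Phi g \<oplus>\<^bsub>qpts (WF p) R\<^esub> Phi h"
    and "c \<in> carrier R \<Longrightarrow> g \<in> sharp_points R \<Longrightarrow> c \<odot>\<^bsub>qpts (Ga_sharp p) R\<^esub> g \<in> sharp_points R \<and>
      Phi (c \<odot>\<^bsub>qpts (Ga_sharp p) R\<^esub> g) = c \<odot>\<^bsub>qpts (WF p) R\<^esub> Phi g"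
    and "\<zero>\<^bsub>qpts (Ga_sharp p) R\<^esub> \<in> sharp_points R" "Phi \<zero>\<^bsub>qpts (Ga_sharp p) R\<^esub> = \<zero>\<^bsub>qpts (WF p) R\<^esub>"
    and "g \<in> sharp_points R \<Longrightarrow> Phi g \<in> WF_points R"
    and "qd (WF p) R (Phi g) = qd (Ga_sharp p) R g"
proof -
  interpret R: witt_base p R by (rule witt_baseI[OF R])
  show "bij_betw Phi (sharp_points R) (WF_points R)" by (simp add: R.Ga_sharp_simps R.Phi_bij)
  show "g \<in> sharp_points R \<Longrightarrow> h \<in> sharp_points R \<Longrightarrow> g \<oplus>\<^bsub>qpts (Ga_sharp p) R\<^esub> h \<in> sharp_points R \<and>
      Phi (g \<oplus>\<^bsub>qpts (Ga_sharp p) R\<^esub> h) = Phi g \<oplus>\<^bsub>qpts (WF p) R\<^esub> Phi h"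
    by (simp add: R.Ga_sharp_simps R.Ga_sharp_add)
  show "c \<in> carrier R \<Longrightarrow> g \<in> sharp_points R \<Longrightarrow> c \<odot>\<^bsub>qpts (Ga_sharp p) R\<^esub> g \<in> sharp_points R \<and>
      Phi (c \<odot>\<^bsub>qpts (Ga_sharp p) R\<^esub> g) = c \<odot>\<^bsub>qpts (WF p) R\<^esub> Phi g"
    by (simp add: R.Ga_sharp_simps R.Ga_sharp_act R.WF_smult R.Phi_in_frob_kernel)
  show "\<zero>\<^bsub>qpts (Ga_sharp p) R\<^esub> \<in> sharp_points R" "Phi \<zero>\<^bsub>qpts (Ga_sharp p) R\<^esub> = \<zero>\<^bsub>qpts (WF p) R\<^esub>"
    by (simp_all add: R.Ga_sharp_simps R.Ga_sharp_zero)
  show "g \<in> sharp_points R \<Longrightarrow> Phi g \<in> WF_points R"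
    by (simp add: R.Ga_sharp_simps R.Phi_in_frob_kernel)
  show "qd (WF p) R (Phi g) = qd (Ga_sharp p) R g"
    by (simp add: qd_simps Phi_def y_0)
qed

lemma Phi_eqD:
  fixes R :: "'u ring"
  assumes "cring R" "g \<in> sharp_points R" "h \<in> sharp_points R" "Phi g = Phi h"
  shows "g = h"
  using Phi_props(1)[OF assms(1)] assms(2-) by (auto simp: bij_betw_def inj_on_def)

text \<open>Every algebraic axiom is pulled back from the Frobenius kernel along the injective,
  natural map \<open>Phi\<close>, which preserves \<open>qd\<close>.\<close>

lemma quasi_ideal_Ga_sharp:
  assumes inf: "infinite (UNIV :: 'u set)"
  shows "quasi_ideal (Ga :: ('u, 'u) ring_functor) (Ga_sharp p)"
proof (rule quasi_ideal_GaI[OF affine_ring_scheme_Ga[OF inf] affine_Ga_sharp_WF(1)[OF inf]])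
  note WF = quasi_ideal_WF[OF inf, unfolded quasi_ideal_def Ga_simps]
  fix R :: "'u ring" assume R: "cring R"
  note P = Phi_props[OF R]
  have mod: "module R (qpts (WF p) R)" using WF R by blast
  show "module R (qpts (Ga_sharp p) R)"
    by (rule module_transport[OF mod P(1)]) (use P in auto)
  fix x z assume x: "x \<in> sharp_points R"
  show "qd (Ga_sharp p) R x \<in> carrier R"
    using WF R P(6)[OF x] by (auto simp flip: P(7))
  show "qd (Ga_sharp p) R (c \<odot>\<^bsub>qpts (Ga_sharp p) R\<^esub> x) = c \<otimes>\<^bsub>R\<^esub> qd (Ga_sharp p) R x" if "c \<in> carrier R" for c
    using WF R P(6)[OF x] P(3)[OF that x] that by (auto simp flip: P(7))
  show "qd (Ga_sharp p) R (x \<oplus>\<^bsub>qpts (Ga_sharp p) R\<^esub> z) = qd (Ga_sharp p) R x \<oplus>\<^bsub>R\<^esub> qd (Ga_sharp p) R z"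
    if z: "z \<in> sharp_points R"
    using WF R P(6)[OF x] P(6)[OF z] P(2)[OF x z] by (auto simp flip: P(7))
  show "qd (Ga_sharp p) R x \<odot>\<^bsub>qpts (Ga_sharp p) R\<^esub> z = qd (Ga_sharp p) R z \<odot>\<^bsub>qpts (Ga_sharp p) R\<^esub> x"
    if z: "z \<in> sharp_points R"
  proof -
    have d: "qd (Ga_sharp p) R x \<in> carrier R" "qd (Ga_sharp p) R z \<in> carrier R"
      using WF R P(6)[OF x] P(6)[OF z] by (auto simp flip: P(7))
    have "qd (WF p) R (Phi x) \<odot>\<^bsub>qpts (WF p) R\<^esub> Phi z = qd (WF p) R (Phi z) \<odot>\<^bsub>qpts (WF p) R\<^esub> Phi x"
      using WF R P(6)[OF x] P(6)[OF z] by blast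
    then show ?thesis
      using P(3)[OF d(1) z] P(3)[OF d(2) x] unfolding P(7) by (intro Phi_eqD[OF R]) auto
  qed
  fix S :: "'u ring" and f assume S: "cring S" and f: "f \<in> ring_hom R S"
  note P' = Phi_props[OF S]
  have nat: "Phi (qmap (Ga_sharp p) R S f g) = qmap (WF p) R S f (Phi g)" for g
    by (simp add: qmap_simps Phi_natural)
  have cl: "qmap (Ga_sharp p) R S f g \<in> sharp_points S" if "g \<in> sharp_points R" for g
    using Spec_points_comp[OF R f that] by (simp add: qmap_simps)
  show "qd (Ga_sharp p) S (qmap (Ga_sharp p) R S f x) = f (qd (Ga_sharp p) R x)"
    using WF R S f P(6)[OF x] unfolding P(7)[symmetric] P'(7)[symmetric] nat by blast
  show "qmap (Ga_sharp p) R S f (x \<oplus>\<^bsub>qpts (Ga_sharp p) R\<^esub> z) =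
      qmap (Ga_sharp p) R S f x \<oplus>\<^bsub>qpts (Ga_sharp p) S\<^esub> qmap (Ga_sharp p) R S f z" if z: "z \<in> sharp_points R"
  proof (rule Phi_eqD[OF S])
    have "qmap (WF p) R S f (Phi x \<oplus>\<^bsub>qpts (WF p) R\<^esub> Phi z) =
        qmap (WF p) R S f (Phi x) \<oplus>\<^bsub>qpts (WF p) S\<^esub> qmap (WF p) R S f (Phi z)"
      using WF R S f P(6)[OF x] P(6)[OF z] by blast
    then show "Phi (qmap (Ga_sharp p) R S f (x \<oplus>\<^bsub>qpts (Ga_sharp p) R\<^esub> z)) =
        Phi (qmap (Ga_sharp p) R S f x \<oplus>\<^bsub>qpts (Ga_sharp p) S\<^esub> qmap (Ga_sharp p) R S f z)"
      using P(2)[OF x z] P'(2)[OF cl[OF x] cl[OF z]] by (simp add: nat)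
  qed (use P(2)[OF x z] P'(2)[OF cl[OF x] cl[OF z]] cl in auto)
  show "qmap (Ga_sharp p) R S f (c \<odot>\<^bsub>qpts (Ga_sharp p) R\<^esub> x) =
      f c \<odot>\<^bsub>qpts (Ga_sharp p) S\<^esub> qmap (Ga_sharp p) R S f x" if c: "c \<in> carrier R" for c
  proof (rule Phi_eqD[OF S])
    have fc: "f c \<in> carrier S" by (rule ring_hom_closed[OF f c])
    have "qmap (WF p) R S f (c \<odot>\<^bsub>qpts (WF p) R\<^esub> Phi x) = f c \<odot>\<^bsub>qpts (WF p) S\<^esub> qmap (WF p) R S f (Phi x)"
      using WF R S f P(6)[OF x] c by blast
    then show "Phi (qmap (Ga_sharp p) R S f (c \<odot>\<^bsub>qpts (Ga_sharp p) R\<^esub> x)) =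
        Phi (f c \<odot>\<^bsub>qpts (Ga_sharp p) S\<^esub> qmap (Ga_sharp p) R S f x)"
      using P(3)[OF c x] P'(3)[OF fc cl[OF x]] by (simp add: nat)
    show "f c \<odot>\<^bsub>qpts (Ga_sharp p) S\<^esub> qmap (Ga_sharp p) R S f x \<in> sharp_points S"
      using P'(3)[OF fc cl[OF x]] by blast
  qed (use P(3)[OF c x] cl in auto)
qed

text \<open>The embedding \<open>r\<close> moves the comparison into the torsion-free ring
  \<open>A\<close>, where a vanishing Frobenius leaves only the ghost component of index
  \<open>0\<close>, the zeroth entry.\<close>

lemma WF_points_eqI:
  fixes B :: "'u ring"
  assumes B: "cring B" and r: "r \<in> ring_hom B (GA_ring p)" "inj_on r (carrier B)"
    and vw: "v \<in> WF_points B" "w \<in> WF_points B" "v 0 = w 0"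
  shows "v = w"
proof -
  interpret B: witt_base p B by (rule witt_baseI[OF B])
  have comp: "x n \<in> carrier B" if "x \<in> WF_points B" for x n
    using that by (auto simp: B.frob_kernel_def B.witt_carrier_iff)
  have r': "r \<in> ring_hom B (subset_ring A)" using r(1) by (simp add: GA_ring_eq)
  have GA: "cring (subset_ring A)" by (rule cring_subset_ring[OF is_subring_A])
  have rA: "r (x n) \<in> A" if "x \<in> WF_points B" for x n
    using ring_hom_closed[OF r' comp[OF that]] by simp
  have r0: "r \<zero>\<^bsub>B\<^esub> = 0" using ring_hom_zero[OF r'] B GA by (simp add: cring_def)
  have gh: "ghost p (Suc n) (\<lambda>i. r (x i)) = 0" if x: "x \<in> WF_points B" for x n
  proof -
    have "wfrob (\<lambda>i. r (x i)) m = r (witt_frob p B x m)" for m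
      unfolding wfrob_def witt_frob_def
      using ring_hom_zeval[OF B GA r', of x, OF comp[OF x]]
        zeval_subset_ring[OF is_subring_A, of "\<lambda>i. r (x i)", OF rA[OF x]]
      by (simp add: comp_def)
    also have "\<dots> m = 0" for m
      using x r0 by (simp add: B.frob_kernel_def witt_ring_def)
    finally have "wfrob (\<lambda>i. r (x i)) = (\<lambda>_. 0)" by auto
    then show ?thesis using ghost_wfrob[of n "\<lambda>i. r (x i)"] by simp
  qed
  have "(\<lambda>i. r (v i)) = (\<lambda>i. r (w i))"
  proof (rule ghost_inj[OF p_gt_0])
    fix n
    show "ghost p n (\<lambda>i. r (v i)) = ghost p n (\<lambda>i. r (w i))"
      using gh[OF vw(1)] gh[OF vw(2)] vw(3) by (cases n) auto
  qed
  then have "r (v i) = r (w i)" for i by meson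
  then show ?thesis using r(2) comp[OF vw(1)] comp[OF vw(2)] by (auto simp: inj_on_def)
qed

lemma quasi_ideal_iso_unique:
  assumes inf: "infinite (UNIV :: 'u set)"
    and \<phi>: "quasi_ideal_iso (Ga :: ('u, 'u) ring_functor) (Ga_sharp p) (WF p) \<phi>"
    and \<psi>: "quasi_ideal_iso (Ga :: ('u, 'u) ring_functor) (Ga_sharp p) (WF p) \<psi>"
  shows "\<phi> = \<psi>"
proof
  fix R :: "'u ring"
  obtain j :: "rat poly \<Rightarrow> 'u" where j: "inj j" using rat_poly_inj[OF inf] .
  have G: "cring (GA_ring p)" by (simp add: GA_ring_eq cring_subset_ring is_subring_A)
  obtain B :: "'u ring" and q r where B: "cring B" "q \<in> Spec_points (GA_ring p) B"
    and r: "r \<in> ring_hom B (GA_ring p)" "inj_on r (carrier B)"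
    and univ: "\<forall>R :: 'u ring. cring R \<longrightarrow>
      bij_betw (\<lambda>f. restrict (f \<circ> q) (carrier (GA_ring p))) (Spec_points B R) (Spec_points (GA_ring p) R)"
    using universal_point[OF G j] .
  note B = B[folded sharp_points_eq] and univ = univ[folded sharp_points_eq, unfolded GA_ring_eq subset_ring_simps]
  have iso: "\<theta> R \<in> extensional (sharp_points R)" "\<theta> B q \<in> WF_points B" "qd (WF p) B (\<theta> B q) = qd (Ga_sharp p) B q"
    "f \<in> ring_hom B R \<Longrightarrow> \<theta> R (qmap (Ga_sharp p) B R f q) = qmap (WF p) B R f (\<theta> B q)"
    if "quasi_ideal_iso (Ga :: ('u, 'u) ring_functor) (Ga_sharp p) (WF p) \<theta>" "cring R" for \<theta> and R :: "'u ring" and f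
  proof -
    have "bij_betw (\<theta> B) (sharp_points B) (WF_points B)" using that B unfolding quasi_ideal_iso_def by blast
    then show "\<theta> B q \<in> WF_points B" using B(2) bij_betwE by blast
  qed (use that B in \<open>auto simp: quasi_ideal_iso_def\<close>)
  show "\<phi> R = \<psi> R"
  proof (cases "cring R")
    case False
    then show ?thesis using \<phi> \<psi> by (auto simp: quasi_ideal_iso_def extensional_def)
  next
    case R: True
    have eq: "\<phi> B q = \<psi> B q"
      using iso(2,3)[OF \<phi> R] iso(2,3)[OF \<psi> R] WF_points_eqI[OF B(1) r] by (simp add: qd_simps)
    show ?thesis
    proof (rule extensionalityI[OF iso(1)[OF \<phi> R] iso(1)[OF \<psi> R]])
      fix x assume "x \<in> sharp_points R"
      then obtain f where f: "f \<in> Spec_points B R" "x = restrict (f \<circ> q) A"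
        using univ[rule_format, OF R] by (auto simp: bij_betw_def)
      then show "\<phi> R x = \<psi> R x"
        using iso(4)[OF \<phi> R Spec_points_hom[OF f(1)]] iso(4)[OF \<psi> R Spec_points_hom[OF f(1)]] eq
        by (simp add: qmap_simps)
    qed
  qed
qed

lemma quasi_ideal_iso_Phi:
  assumes inf: "infinite (UNIV :: 'u set)"
  shows "quasi_ideal_iso (Ga :: ('u, 'u) ring_functor) (Ga_sharp p) (WF p)
    (restrict (\<lambda>R. restrict Phi (sharp_points R)) {R. cring R})"
proof -
  have "bij_betw (restrict Phi (sharp_points R)) (sharp_points R) (WF_points R)" if "cring R" for R :: "'u ring"
    using Phi_props(1)[OF that] by (simp cong: bij_betw_cong)
  moreover have "restrict (f \<circ> x) A \<in> sharp_points S" if "cring R" "f \<in> ring_hom R S" "x \<in> sharp_points R" for R S :: "'u ring" and f x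
    using Spec_points_comp[OF that] .
  ultimately show ?thesis
    unfolding quasi_ideal_iso_def Ga_simps qmap_simps
    using quasi_ideal_WF[OF inf] quasi_ideal_Ga_sharp[OF inf]
    by (auto simp: Phi_props Phi_natural)
qed

end

theorem lemma3p2p6:
  fixes p :: nat
  assumes "prime p"
    and "infinite (UNIV :: 'u set)"
  shows "\<exists>!\<phi>. quasi_ideal_iso (Ga :: ('u, 'u) ring_functor) (Ga_sharp p) (WF p) \<phi>"
proof -
  interpret prime_nat p by standard fact
  show ?thesis
    using quasi_ideal_iso_Phi[OF assms(2)] quasi_ideal_iso_unique[OF assms(2)] by blast
qed

end
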